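(* Let $(X_i)_{i\ge 1}$ be i.i.d. real-valued random variables with $\mathbb E(X_1)=0$, $\mathbb E(X_1^2)=\sigma^2>0$, and suppose there exists $\delta\ge 1$ such that $\mathbb E(|X_1|^{2+\delta})<\infty$. Then there exists a constant $c>0$ such that for any integer $n\ge 1$ and any $x\in\mathbb R$, $$\left|\mathbb P(\tau_x>n)-\frac{V(x)\,L\left(\frac{x}{\sigma\sqrt n}\right)}{\sigma\sqrt n}\right|\le \frac{c}{\sqrt n}\left(\frac{1}{n^{\delta/4}}+\frac{V(x)\,L\left(\frac{x}{\sigma\sqrt n}\right)}{n^{1/4}}\log n\right).$$
   Context: Let $S_n=\sum_{i=1}^n X_i$ for $n\ge1$. For $x\in\mathbb R$, $\tau_x=\inf\{k\ge 1: x+S_k<0\}$ (with $\inf\emptyset=\infty$). Define $V(x)=-\mathbb E(S_{\tau_x})$ for $x\in\mathbb R$; under the stated moment assumptions it is known that $V$ is well defined, non-negative and non-decreasing, and that $V(x)=\lim_{n\to\infty}\mathbb E\big((x+S_n)\mathbf 1_{\{\tau_x>n\}}\big)$. Let $\Phi$ be the standard normal distribution function and $H(x)=2\Phi(x)-1$. Define $L(x)=H(x)/x$ for $x\neq 0$ and $L(0)=2/\sqrt{2\pi}$. The constant $c$ may depend on $\delta$ and on the law of $X_1$, but not on $n$ or $x$. *)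

theory Defs
  imports "HOL-Probability.Probability"
begin

definition partial_sum :: "(nat \<Rightarrow> 'a \<Rightarrow> real) \<Rightarrow> nat \<Rightarrow> 'a \<Rightarrow> real" where
  "partial_sum X n \<omega> = (\<Sum>i=1..n. X i \<omega>)"

(* The infimum is taken in enat, where Inf {} = \<infinity>. *)
definition exit_time :: "(nat \<Rightarrow> 'a \<Rightarrow> real) \<Rightarrow> real \<Rightarrow> 'a \<Rightarrow> enat" where
  "exit_time X x \<omega> = Inf {enat k | k. k \<ge> 1 \<and> x + partial_sum X k \<omega> < 0}"

(* The walk at the exit time. The value 0 on the event that the exit time is infinite is a
   convention: for a centred walk with positive finite variance that event is a null set. *)
definition exit_sum :: "(nat \<Rightarrow> 'a \<Rightarrow> real) \<Rightarrow> real \<Rightarrow> 'a \<Rightarrow> real" where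
  "exit_sum X x \<omega> = (case exit_time X x \<omega> of enat k \<Rightarrow> partial_sum X k \<omega> | \<infinity> \<Rightarrow> 0)"

definition harmonic_V :: "'a measure \<Rightarrow> (nat \<Rightarrow> 'a \<Rightarrow> real) \<Rightarrow> real \<Rightarrow> real" where
  "harmonic_V M X x = - (\<integral>\<omega>. exit_sum X x \<omega> \<partial>M)"

definition normal_Phi :: "real \<Rightarrow> real" where
  "normal_Phi = cdf std_normal_distribution"

definition normal_H :: "real \<Rightarrow> real" where
  "normal_H x = 2 * normal_Phi x - 1"

definition normal_L :: "real \<Rightarrow> real" where
  "normal_L x = (if x = 0 then 2 / sqrt (2 * pi) else normal_H x / x)"

end

theory Submission
  imports Defs
begin

text \<open>
  The proof is a quantitative Lindeberg comparison with the heat flow, in which the exit from the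
  half-line is handled by optional stopping. Write p_n(x) for the probability that x + S_k \<ge> 0
  for all k \<le> n, put G_t(y) = H(y / (\<sigma> sqrt t)) and \<theta> = H'(0), and let o(y) be
  the mean of (y + X_1)^-, the expected overshoot below zero in one step from y.

  For Brownian motion p_n = G_n, because G solves the heat equation, equals one at time zero on
  the positive axis and vanishes at the origin. For the walk, one step turns G_t into G_(t+1) up
  to an error O(t^(-3/2)) (lemma \<open>heat_lindeberg\<close>; this uses the third moment).
  Started from G_(T+n)(x) and run for n steps with killing, the comparison leaves three
  contributions. First, the accumulated step errors, a sum of (T+n-k)^(-3/2) p_k(x). Second, the
  terminal mismatch 1 - G_T at time n on the event of survival, which only counts positions within
  about sqrt T of the origin. Third, the exits: the walk does not stop at 0 but at a negative
  point, where G_t is close to \<theta> / (\<sigma> sqrt t) times that point. Summed over the exit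
  times this gives \<theta> / (\<sigma> sqrt n) times the mean total overshoot, and that overshoot
  is V(x) - x. The choice T = sqrt n balances the relative errors T^(-1/2) and sqrt (T/n), both
  n^(-1/4), and H(u) + \<theta> (V(x) - x) / (\<sigma> sqrt n) with u = x / (\<sigma> sqrt n)
  agrees to that order with V(x) L(u) / (\<sigma> sqrt n) (theorem
  \<open>surv_gaussian_approximation\<close> and its corollaries).

  To make every error relative to min(1, (1+x)/sqrt n), which has the order of p_n(x), two a
  priori bounds are used: the mean overshoot is bounded uniformly in the starting point
  (\<open>mean_overshoot_bounded\<close>), and p_n(x) \<le> C (1+x) / sqrt n
  (\<open>surv_bound\<close>). Both follow from optional stopping for the concave functions min(y,
  a), which lose a fixed amount in mean at each visit to a slab just below the level a.

  To survive, a walk started at x < 0 must jump to a point y \<ge> 0 in its first step, so its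
  survival probability is an average of those from the points y. Only jumps longer than n^(1/4)
  leave the region where L is nearly constant. They contribute O(n^(-(1+\<delta>)/4)) by the
  moment assumption, which is the origin of the error term free of V. The comparison gives the
  rate n^(-1/4) itself; the logarithm enters only through ln n \<ge> ln 2 for n \<ge> 2.

  All estimates are proved for the law \<mu> of one step and the operator f \<mapsto> E (f(x +
  X_1); x + X_1 \<ge> 0), whose powers encode the Markov property. Independence is used only in
  the last section, to identify these powers with expectations over the walk.
\<close>

section \<open>The Gaussian profile\<close>

definition H_slope :: real where
  "H_slope = 2 / sqrt (2 * pi)"

lemma H_slope_pos: "0 < H_slope"
  by (simp add: H_slope_def)

lemma H_slope_le_1: "H_slope \<le> 1"
proof -
  have "2 = sqrt (2 * 2)" by simp
  also have "\<dots> \<le> sqrt (2 * pi)"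
    using pi_ge_two by (intro real_sqrt_le_mono) simp
  finally show ?thesis by (simp add: H_slope_def)
qed

lemma two_normal_density: "2 * std_normal_density z = H_slope * exp (- (z^2) / 2)"
  by (simp add: std_normal_density_def H_slope_def)

text \<open>
  The distribution function is compared with an indefinite integral of the density based at a
  point strictly to the left of z, so that differentiability at z is an interior statement.
\<close>
lemma normal_H_has_derivative [derivative_intros]:
  "(normal_H has_real_derivative H_slope * exp (- (z^2) / 2)) (at z)"
proof -
  interpret N: real_distribution std_normal_distribution
    by (rule real_dist_normal_dist)
  define a where "a = z - 1"
  define F where "F x = integral {a - 1..x} std_normal_density" for x
  have cont: "continuous_on {a - 1..b} std_normal_density" for b
    unfolding std_normal_density_def by (intro continuous_intros) auto
  have dF: "(F has_real_derivative std_normal_density x) (at x)" if "a \<le> x" for x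
  proof -
    have "(F has_real_derivative std_normal_density x) (at x within {a - 1..x + 1})"
      unfolding F_def by (rule integral_has_real_derivative[OF cont]) (use that in auto)
    moreover have "at x within {a - 1..x + 1} = at x"
      by (rule at_within_Icc_at) (use that in auto)
    ultimately show ?thesis by simp
  qed
  have Phi: "normal_Phi x = normal_Phi a + (F x - F a)" if "a < x" for x
  proof -
    have "emeasure std_normal_distribution {a..x}
        = (\<integral>\<^sup>+ s. ennreal (std_normal_density s) * indicator {a..x} s \<partial>lborel)"
      by (subst emeasure_density) (auto simp: mult.commute)
    also have "\<dots> = ennreal (F x - F a)"
      using that dF by (intro nn_integral_FTC_Icc) auto
    finally have "measure std_normal_distribution {a..x} = F x - F a"
    proof -
      assume *: "emeasure std_normal_distribution {a..x} = ennreal (F x - F a)"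
      have "F a \<le> F x"
        using that dF by (intro DERIV_nonneg_imp_nondecreasing[of a x F]) (auto intro!: exI)
      thus ?thesis using * by (simp add: measure_def)
    qed
    moreover have "measure std_normal_distribution {a..x} = measure std_normal_distribution {a<..x}"
    proof -
      have "{a..x} = {a} \<union> {a<..x}" using that by auto
      moreover have "emeasure std_normal_distribution {a} = 0"
        by (subst emeasure_density) (auto simp: nn_integral_indicator_singleton)
      hence "measure std_normal_distribution {a} = 0" by (simp add: measure_def)
      moreover have "measure std_normal_distribution ({a} \<union> {a<..x})
          = measure std_normal_distribution {a} + measure std_normal_distribution {a<..x}"
        by (rule N.finite_measure_Union) auto
      ultimately show ?thesis by simp
    qed
    ultimately show ?thesis
      using N.cdf_diff_eq[OF that] by (simp add: normal_Phi_def)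
  qed
  have "(F has_real_derivative std_normal_density z) (at z)"
    by (rule dF) (simp add: a_def)
  hence "((\<lambda>x. normal_Phi a + (F x - F a)) has_real_derivative std_normal_density z) (at z)"
    by (auto intro!: derivative_eq_intros)
  hence "(normal_Phi has_real_derivative std_normal_density z) (at z)"
    by (rule DERIV_cong_ev[THEN iffD1, rotated -1])
       (auto simp: eventually_nhds a_def Phi intro!: exI[of _ "{z-1<..}"])
  hence "((\<lambda>x. 2 * normal_Phi x - 1) has_real_derivative 2 * std_normal_density z) (at z)"
    by (auto intro!: derivative_eq_intros)
  thus ?thesis
    unfolding two_normal_density normal_H_def[abs_def] .
qed

lemma normal_H_mvt:
  assumes "a < b"
  obtains w where "a < w" "w < b" "normal_H b - normal_H a = (b - a) * (H_slope * exp (- (w^2) / 2))"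
  using MVT2[OF assms, of normal_H "\<lambda>z. H_slope * exp (- (z^2) / 2)"] normal_H_has_derivative by metis

lemma normal_H_mono: "a \<le> b \<Longrightarrow> normal_H a \<le> normal_H b"
  by (rule DERIV_nonneg_imp_nondecreasing)
     (use H_slope_pos normal_H_has_derivative in \<open>force intro: less_imp_le\<close>)+

lemma normal_H_tendsto_at_top: "(normal_H \<longlongrightarrow> 1) at_top"
proof -
  interpret N: real_distribution std_normal_distribution
    by (rule real_dist_normal_dist)
  have "((\<lambda>x. 2 * normal_Phi x - 1) \<longlongrightarrow> 2 * 1 - 1) at_top"
    unfolding normal_Phi_def by (intro tendsto_intros N.cdf_lim_at_top_prob)
  thus ?thesis by (simp add: normal_H_def[abs_def])
qed

lemma normal_H_tendsto_at_bot: "(normal_H \<longlongrightarrow> - 1) at_bot"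
proof -
  interpret N: real_distribution std_normal_distribution
    by (rule real_dist_normal_dist)
  have "((\<lambda>x. 2 * normal_Phi x - 1) \<longlongrightarrow> 2 * 0 - 1) at_bot"
    unfolding normal_Phi_def by (intro tendsto_intros N.cdf_lim_at_bot)
  thus ?thesis by (simp add: normal_H_def[abs_def])
qed

text \<open>
  The sum H(x) + H(-x) has derivative zero, and its limit at infinity is 1 - 1. In particular H(0)
  = 0 is obtained without computing a Gaussian integral.
\<close>
lemma normal_H_minus: "normal_H (- x) = - normal_H x"
proof -
  have "((\<lambda>x. normal_H x + normal_H (- x)) has_real_derivative 0) (at z)" for z
    by (rule derivative_eq_intros refl DERIV_chain2[of normal_H] normal_H_has_derivative)+ simp
  hence const: "normal_H z + normal_H (- z) = normal_H x + normal_H (- x)" for z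
    using DERIV_isconst_all[of "\<lambda>x. normal_H x + normal_H (- x)"] by blast
  have "((\<lambda>z. normal_H z + normal_H (- z)) \<longlongrightarrow> 1 + (- 1)) at_top"
    by (intro tendsto_add normal_H_tendsto_at_top filterlim_compose[OF normal_H_tendsto_at_bot]
        filterlim_uminus_at_bot_at_top)
  moreover have "(\<lambda>z. normal_H z + normal_H (- z)) = (\<lambda>_. normal_H x + normal_H (- x))"
    using const by (intro ext)
  ultimately have "((\<lambda>_::real. normal_H x + normal_H (- x)) \<longlongrightarrow> 0) at_top"
    by (simp only:) simp
  hence "normal_H x + normal_H (- x) = 0"
    by (subst (asm) tendsto_const_iff) auto
  thus ?thesis by simp
qed

lemma normal_H_0 [simp]: "normal_H 0 = 0"
  using normal_H_minus[of 0] by simp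

lemma normal_H_le_1: "normal_H x \<le> 1"
  by (rule tendsto_lowerbound[OF normal_H_tendsto_at_top])
     (auto simp: eventually_at_top_linorder intro!: exI[of _ x] normal_H_mono)

lemma abs_normal_H_le_1: "\<bar>normal_H x\<bar> \<le> 1"
  using normal_H_le_1[of x] normal_H_le_1[of "-x"] by (simp add: normal_H_minus abs_le_iff)

lemma normal_H_nonneg: "0 \<le> x \<Longrightarrow> 0 \<le> normal_H x"
  using normal_H_mono[of 0 x] by simp

lemma normal_H_measurable [measurable]: "normal_H \<in> borel_measurable borel"
  by (intro borel_measurable_continuous_onI continuous_at_imp_continuous_on ballI
      DERIV_isCont[OF normal_H_has_derivative])

text \<open>
  Since H(0) = 0, the quotient L is a difference quotient of H, so the mean value theorem
  represents it by the Gaussian density. All bounds on L are read off from this form.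
\<close>
lemma normal_L_eq:
  obtains w where "\<bar>w\<bar> \<le> \<bar>u\<bar>" "normal_L u = H_slope * exp (- (w^2) / 2)"
proof (cases u "0::real" rule: linorder_cases)
  case equal
  show ?thesis by (rule that[of 0]) (auto simp: equal normal_L_def H_slope_def)
next
  case less
  obtain w where "u < w" "w < 0" "normal_H 0 - normal_H u = (0 - u) * (H_slope * exp (- (w^2) / 2))"
    using normal_H_mvt[OF less] .
  thus ?thesis using less by (intro that[of w]) (auto simp: normal_L_def field_simps)
next
  case greater
  obtain w where "0 < w" "w < u" "normal_H u - normal_H 0 = (u - 0) * (H_slope * exp (- (w^2) / 2))"
    using normal_H_mvt[OF greater] .
  thus ?thesis using greater by (intro that[of w]) (auto simp: normal_L_def field_simps)
qed

lemma normal_H_eq_L: "normal_H u = u * normal_L u"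
  by (simp add: normal_L_def)

lemma normal_L_pos: "0 < normal_L u"
  by (rule normal_L_eq[of u]) (simp add: H_slope_pos)

lemma normal_L_le: "normal_L u \<le> H_slope"
  by (rule normal_L_eq[of u]) (simp add: H_slope_pos)

lemma normal_L_le_1: "normal_L u \<le> 1"
  using normal_L_le[of u] H_slope_le_1 by simp

lemma normal_L_near_0: "\<bar>normal_L u - H_slope\<bar> \<le> \<bar>u\<bar>"
proof -
  obtain w where w: "\<bar>w\<bar> \<le> \<bar>u\<bar>" "normal_L u = H_slope * exp (- (w^2) / 2)"
    by (rule normal_L_eq)
  have "1 - w\<^sup>2 / 2 \<le> exp (- (w^2) / 2)"
    using exp_ge_add_one_self[of "- (w^2) / 2"] by simp
  moreover have "0 < exp (- (w^2) / 2)" "exp (- (w^2) / 2) \<le> 1" by auto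
  moreover have "min 1 (w\<^sup>2 / 2) \<le> \<bar>w\<bar>"
  proof (cases "\<bar>w\<bar> \<le> 1")
    case True
    hence "\<bar>w\<bar> * \<bar>w\<bar> \<le> \<bar>w\<bar> * 1" by (intro mult_left_mono) auto
    thus ?thesis by (simp add: power2_eq_square)
  qed simp
  ultimately have *: "1 - exp (- (w^2) / 2) \<le> \<bar>w\<bar>" "0 \<le> 1 - exp (- (w^2) / 2)"
    by linarith+
  have "\<bar>normal_L u - H_slope\<bar> = H_slope * (1 - exp (- (w^2) / 2))"
    using *(2) H_slope_pos unfolding w by (simp add: abs_if algebra_simps)
  also have "\<dots> \<le> 1 * \<bar>w\<bar>"
    using * H_slope_le_1 H_slope_pos by (intro mult_mono) auto
  finally show ?thesis using w by simp
qed

lemma exp_half_le_2: "exp (1 / 2 :: real) \<le> 2"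
  using exp_bound_half[of "1/2 :: real"] by simp

lemma normal_L_ge: "\<bar>u\<bar> \<le> 1 \<Longrightarrow> H_slope / 2 \<le> normal_L u"
proof -
  assume u: "\<bar>u\<bar> \<le> 1"
  obtain w where w: "\<bar>w\<bar> \<le> \<bar>u\<bar>" "normal_L u = H_slope * exp (- (w^2) / 2)"
    by (rule normal_L_eq)
  have "w^2 \<le> 1" using w(1) u by (simp add: abs_square_le_1)
  hence "exp (- (1/2)) \<le> exp (- (w^2) / 2)" by simp
  moreover have "1 / 2 \<le> exp (- (1/2 :: real))"
    using exp_half_le_2 by (simp add: exp_minus field_simps)
  ultimately have "1 / 2 \<le> exp (- (w^2) / 2)" by linarith
  hence "H_slope * (1/2) \<le> H_slope * exp (- (w^2) / 2)"
    using H_slope_pos by (intro mult_left_mono) auto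
  thus ?thesis by (simp add: w(2))
qed

lemma normal_L_ge_inverse: "1 \<le> u \<Longrightarrow> H_slope / (2 * u) \<le> normal_L u"
  using normal_L_ge[of 1] normal_H_mono[of 1 u] by (simp add: normal_L_def field_simps)

lemma normal_H_upper: "0 \<le> u \<Longrightarrow> normal_H u \<le> H_slope * u"
  using mult_left_mono[OF normal_L_le, of u u] by (simp add: normal_H_eq_L mult.commute)

lemma normal_H_linear: "\<bar>normal_H u - H_slope * u\<bar> \<le> u\<^sup>2"
proof -
  have "\<bar>normal_H u - H_slope * u\<bar> = \<bar>u\<bar> * \<bar>normal_L u - H_slope\<bar>"
    by (simp add: normal_H_eq_L abs_mult[symmetric] algebra_simps)
  also have "\<dots> \<le> \<bar>u\<bar> * \<bar>u\<bar>" by (intro mult_left_mono normal_L_near_0) auto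
  finally show ?thesis by (simp add: power2_eq_square)
qed

text \<open>
  Gaussian tails decay at least geometrically: beyond z there is no more mass than a multiple of
  what lies in a unit neighbourhood of z. This dominates the tail by an increment of H, and
  increments of H can be propagated through the walk with the same comparison as H itself. The
  proof shows that the difference of the two sides is monotone beyond 1 and vanishes at infinity.
\<close>
lemma normal_H_tail:
  obtains C :: real where "0 \<le> C" "\<And>z. 0 \<le> z \<Longrightarrow> 1 - normal_H z \<le> C * (normal_H (z + 1) - normal_H (z - 1))"
proof -
  define C where "C = 2 + 2 / H_slope"
  define D where "D z = C * (normal_H (z + 1) - normal_H (z - 1)) + normal_H z" for z
  have C2: "2 \<le> C" using H_slope_pos by (simp add: C_def)
  have dD: "(D has_real_derivative H_slope * exp (- (z^2) / 2) * (1 - C * exp (- (1/2)) * (exp z - exp (- z)))) (at z)" for z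
  proof -
    have "(D has_real_derivative C * (H_slope * exp (- ((z + 1)^2) / 2) - H_slope * exp (- ((z - 1)^2) / 2))
        + H_slope * exp (- (z^2) / 2)) (at z)"
      unfolding D_def[abs_def]
      by (rule derivative_eq_intros refl DERIV_chain2[of normal_H] normal_H_has_derivative)+ simp
    moreover have "exp (- ((z + 1)^2) / 2) = exp (- (z^2) / 2) * exp (- (1/2)) * exp (- z)"
      "exp (- ((z - 1)^2) / 2) = exp (- (z^2) / 2) * exp (- (1/2)) * exp z"
      by (simp_all add: exp_add[symmetric] power2_eq_square field_simps)
    ultimately show ?thesis by (simp add: algebra_simps)
  qed
  have decr: "D b \<le> D a" if "1 \<le> a" "a \<le> b" for a b
  proof (rule DERIV_nonpos_imp_nonincreasing[OF that(2)])
    fix z assume "a \<le> z" "z \<le> b"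
    hence z: "1 \<le> z" using that by simp
    have "1 + z \<le> exp z" by (rule exp_ge_add_one_self)
    moreover have "exp (- z) \<le> 1" using z by simp
    ultimately have "1 \<le> exp z - exp (- z)" using z by linarith
    moreover have "1 \<le> C * exp (- (1/2))"
      using C2 exp_half_le_2 by (simp add: exp_minus field_simps)
    ultimately have "1 * 1 \<le> C * exp (- (1/2)) * (exp z - exp (- z))"
      by (intro mult_mono) auto
    thus "\<exists>y. DERIV D z :> y \<and> y \<le> 0"
      using dD[of z] H_slope_pos by (intro exI conjI) (auto simp: mult_nonneg_nonpos)
  qed
  have shift: "((\<lambda>z. normal_H (z + c)) \<longlongrightarrow> 1) at_top" for c
    using filterlim_compose[OF normal_H_tendsto_at_top
        filterlim_tendsto_add_at_top[OF tendsto_const[of c] filterlim_ident]]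
    by (simp add: add.commute)
  have "(D \<longlongrightarrow> C * (1 - 1) + 1) at_top"
    unfolding D_def[abs_def]
    using shift[of 1] shift[of "-1"]
    by (intro tendsto_intros normal_H_tendsto_at_top) auto
  hence D1: "1 \<le> D z" if "1 \<le> z" for z
    using decr[OF that] by (intro tendsto_upperbound[of D 1 at_top]) (auto simp: eventually_at_top_linorder)
  show ?thesis
  proof (rule that[of C])
    fix z :: real assume z: "0 \<le> z"
    show "1 - normal_H z \<le> C * (normal_H (z + 1) - normal_H (z - 1))"
    proof (cases "1 \<le> z")
      case True
      thus ?thesis using D1[of z] by (simp add: D_def)
    next
      case False
      have "H_slope / 2 \<le> normal_H 1" using normal_L_ge[of 1] by (simp add: normal_L_def)
      also have "\<dots> \<le> normal_H (z + 1)" using z by (intro normal_H_mono) simp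
      also have "\<dots> \<le> normal_H (z + 1) - normal_H (z - 1)"
        using normal_H_nonneg[of "1 - z"] False normal_H_minus[of "1 - z"] by simp
      finally have "2 / H_slope * (H_slope / 2) \<le> C * (normal_H (z + 1) - normal_H (z - 1))"
        using H_slope_pos by (intro mult_mono) (auto simp: C_def)
      thus ?thesis using H_slope_pos normal_H_nonneg[OF z] by simp
    qed
  qed (use C2 in simp)
qed

lemma square_gauss_le_1: "w\<^sup>2 * exp (- (w^2) / 2) \<le> (1::real)"
proof -
  define u where "u = w\<^sup>2 / 2"
  have u: "0 \<le> u" by (simp add: u_def)
  have "2 * u \<le> 1 + u + u\<^sup>2 / 2"
    using zero_le_power2[of "u - 1"] by (simp add: power2_eq_square algebra_simps)
  also have "\<dots> \<le> exp u" using exp_lower_Taylor_quadratic[OF u] .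
  finally show ?thesis by (simp add: u_def exp_minus field_simps)
qed

lemma abs_gauss_le_1: "\<bar>w\<bar> * exp (- (w^2) / 2) \<le> (1::real)"
proof (cases "\<bar>w\<bar> \<le> 1")
  case True
  thus ?thesis using mult_mono[of "\<bar>w\<bar>" 1 "exp (- (w^2) / 2)" 1] by simp
next
  case False
  hence "\<bar>w\<bar> * 1 \<le> \<bar>w\<bar> * \<bar>w\<bar>" by (intro mult_left_mono) auto
  hence "\<bar>w\<bar> * exp (- (w^2) / 2) \<le> w\<^sup>2 * exp (- (w^2) / 2)"
    by (intro mult_right_mono) (auto simp: power2_eq_square)
  thus ?thesis using square_gauss_le_1[of w] by linarith
qed

lemma fourth_gauss_le: "w ^ 4 * exp (- (w^2) / 2) \<le> (8::real)"
proof -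
  define u where "u = w\<^sup>2 / 2"
  have u: "0 \<le> u" by (simp add: u_def)
  have "w ^ 4 = 4 * u\<^sup>2" by (simp add: u_def power2_eq_square power4_eq_xxxx)
  also have "\<dots> \<le> 8 * (1 + u + u\<^sup>2 / 2)" using u by simp
  also have "\<dots> \<le> 8 * exp u" using exp_lower_Taylor_quadratic[OF u] by simp
  finally show ?thesis by (simp add: u_def exp_minus field_simps)
qed

lemma cube_gauss_le: "\<bar>w\<bar> ^ 3 * exp (- (w^2) / 2) \<le> (9::real)"
proof -
  have "\<bar>w\<bar> ^ 3 \<le> 1 + w ^ 4"
  proof (cases "\<bar>w\<bar> \<le> 1")
    case True
    hence "\<bar>w\<bar> ^ 3 \<le> 1" by (simp add: power_le_one)
    thus ?thesis by (simp add: add_increasing2)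
  next
    case False
    hence "\<bar>w\<bar> ^ 3 \<le> \<bar>w\<bar> ^ 4" by (intro power_increasing) auto
    thus ?thesis by simp
  qed
  hence "\<bar>w\<bar> ^ 3 * exp (- (w^2) / 2) \<le> (1 + w ^ 4) * exp (- (w^2) / 2)"
    by (intro mult_right_mono) auto
  also have "\<dots> = exp (- (w^2) / 2) + w ^ 4 * exp (- (w^2) / 2)" by (simp add: algebra_simps)
  also have "\<dots> \<le> 1 + 8" by (intro add_mono fourth_gauss_le) simp
  finally show ?thesis by simp
qed

lemma normal_H_taylor:
  fixes n :: nat and z h :: real
  assumes "0 < n" "n \<le> 3"
  defines "d \<equiv> \<lambda>m w. if m = 0 then normal_H w else if m = 1 then H_slope * exp (- (w^2) / 2)
              else if m = 2 then - H_slope * w * exp (- (w^2) / 2)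
              else H_slope * (w\<^sup>2 - 1) * exp (- (w^2) / 2)"
  shows "\<exists>w. min z (z + h) \<le> w \<and> w \<le> max z (z + h) \<and>
    normal_H (z + h) = (\<Sum>m<n. d m z / fact m * h ^ m) + d n w / fact n * h ^ n"
proof -
  have deriv: "\<forall>m t. m < n \<and> min z (z + h) \<le> t \<and> t \<le> max z (z + h) \<longrightarrow> DERIV (d m) t :> d (Suc m) t"
  proof (intro allI impI, elim conjE)
    fix m t assume "m < n"
    hence "m = 0 \<or> m = 1 \<or> m = 2" using assms by auto
    thus "DERIV (d m) t :> d (Suc m) t"
    proof (elim disjE)
      assume "m = 0"
      thus ?thesis using normal_H_has_derivative by (simp add: d_def)
    next
      assume "m = 1"
      thus ?thesis by (auto simp: d_def intro!: derivative_eq_intros)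
    next
      assume "m = 2"
      thus ?thesis by (auto simp: d_def power2_eq_square algebra_simps intro!: derivative_eq_intros)
    qed
  qed
  show ?thesis
  proof (cases "h = 0")
    case True
    have "(\<Sum>m<n. d m z / fact m * h ^ m) = d 0 z"
      using assms(1) True by (subst sum.remove[of _ 0]) (auto simp: power_0_left)
    thus ?thesis using True assms(1) by (intro exI[of _ z]) (auto simp: d_def)
  next
    case False
    have "\<exists>t. (if z + h < z then z + h < t \<and> t < z else z < t \<and> t < z + h) \<and>
      normal_H (z + h) = (\<Sum>m<n. d m z / fact m * (z + h - z) ^ m) + d n t / fact n * (z + h - z) ^ n"
      using False
      by (intro Taylor[where a="min z (z + h)" and b="max z (z + h)"] assms(1) deriv) (auto simp: d_def)
    then obtain t where "if z + h < z then z + h < t \<and> t < z else z < t \<and> t < z + h"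
      "normal_H (z + h) = (\<Sum>m<n. d m z / fact m * h ^ m) + d n t / fact n * h ^ n"
      by auto
    thus ?thesis by (intro exI[of _ t]) (auto split: if_splits)
  qed
qed

text \<open>
  The third derivative \<theta> (w^2 - 1) exp (-w^2/2) is bounded by one, both terms of the
  difference lying in the unit interval.
\<close>
lemma normal_H_third_order:
  "\<bar>normal_H (z + h) - normal_H z - H_slope * exp (- (z^2) / 2) * h
     + H_slope * z * exp (- (z^2) / 2) * h\<^sup>2 / 2\<bar> \<le> \<bar>h\<bar> ^ 3"
proof -
  have sum3: "(\<Sum>m<3. f m) = f 0 + f 1 + f 2" for f :: "nat \<Rightarrow> real"
    by (simp add: numeral_3_eq_3 numeral_2_eq_2)
  obtain w where w: "normal_H (z + h) = normal_H z + H_slope * exp (- (z^2) / 2) * h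
     - H_slope * z * exp (- (z^2) / 2) * h\<^sup>2 / 2 + H_slope * (w\<^sup>2 - 1) * exp (- (w^2) / 2) / 6 * h ^ 3"
    using normal_H_taylor[of 3 z h] unfolding sum3 by (force simp: fact_numeral)
  have "\<bar>(w\<^sup>2 - 1) * exp (- (w^2) / 2)\<bar> \<le> 1"
    using square_gauss_le_1[of w] by (auto simp: abs_le_iff algebra_simps intro: add_increasing2)
  hence "H_slope * \<bar>(w\<^sup>2 - 1) * exp (- (w^2) / 2)\<bar> / 6 * \<bar>h\<bar> ^ 3 \<le> 1 * \<bar>h\<bar> ^ 3"
    using H_slope_pos H_slope_le_1 mult_mono[of H_slope 1 "\<bar>(w\<^sup>2 - 1) * exp (- (w^2) / 2)\<bar>" 1]
    by (intro mult_right_mono) auto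
  thus ?thesis using H_slope_pos unfolding w by (simp add: abs_mult power_abs)
qed

lemma sqrt_ratio_expansion:
  assumes "1 \<le> t"
  shows "\<bar>sqrt (t / (t + 1)) - 1 + 1 / (2 * t)\<bar> \<le> 1 / t\<^sup>2"
proof -
  define q where "q = sqrt (1 + 1 / t)"
  have q: "1 \<le> q" "q\<^sup>2 = 1 + 1 / t" using assms by (auto simp: q_def)
  have tq: "1 / t = q\<^sup>2 - 1" using q by simp
  have "sqrt (t / (t + 1)) = 1 / q"
    using assms unfolding q_def by (subst real_sqrt_divide[symmetric, of 1, simplified]) (simp add: real_sqrt_inverse[symmetric] field_simps)
  moreover have "1 / (2 * t) = (q\<^sup>2 - 1) / 2" using tq by simp
  moreover have "1 / q - 1 + (q\<^sup>2 - 1) / 2 = (q - 1)\<^sup>2 * ((q + 2) / (2 * q))"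
    using q(1) by (simp add: field_simps power2_eq_square)
  ultimately have eq: "sqrt (t / (t + 1)) - 1 + 1 / (2 * t) = (q - 1)\<^sup>2 * ((q + 2) / (2 * q))"
    by (simp only:)
  have pos: "(q + 2) / (2 * q) \<le> 2" "0 \<le> (q + 2) / (2 * q)" using q(1) by (auto simp: field_simps)
  hence le2: "(q - 1)\<^sup>2 * ((q + 2) / (2 * q)) \<le> (q - 1)\<^sup>2 * 2" by (intro mult_left_mono) auto
  have "2 * (q - 1) \<le> 1 / t"
    unfolding tq using zero_le_power2[of "q - 1"] by (simp add: power2_eq_square algebra_simps)
  hence "(2 * (q - 1))\<^sup>2 \<le> (1 / t)\<^sup>2" using q by (intro power_mono) auto
  hence "4 * (q - 1)\<^sup>2 \<le> 1 / t\<^sup>2" by (simp only: power_mult_distrib power_divide) simp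
  hence "(q - 1)\<^sup>2 * 2 \<le> 1 / t\<^sup>2" using zero_le_power2[of "q - 1"] by linarith
  with le2 have "(q - 1)\<^sup>2 * ((q + 2) / (2 * q)) \<le> 1 / t\<^sup>2" by linarith
  moreover have "0 \<le> (q - 1)\<^sup>2 * ((q + 2) / (2 * q))" using pos by (intro mult_nonneg_nonneg) auto
  ultimately show ?thesis unfolding eq by (simp only: abs_of_nonneg)
qed

text \<open>
  One unit of time rescales the argument of H by sqrt (t/(t+1)). The linear term is -1/(2t) times
  z H'(z), which by the heat equation agrees with the second-order space term in
  \<open>normal_H_third_order\<close> for a displacement of variance 1/t. The remainder is of
  second order in 1/t, uniformly in z, because powers of z are absorbed by the Gaussian factor.
\<close>
lemma normal_H_time_step:
  assumes t: "1 \<le> t"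
  shows "\<bar>normal_H (z * sqrt (t / (t + 1))) - normal_H z + H_slope * z * exp (- (z^2) / 2) / (2 * t)\<bar> \<le> 37 / t\<^sup>2"
proof -
  define r where "r = sqrt (t / (t + 1))"
  define h where "h = z * (r - 1)"
  have r: "0 < r" "r \<le> 1" "r\<^sup>2 = t / (t + 1)" using t by (auto simp: r_def)
  have rexp: "\<bar>r - 1 + 1 / (2 * t)\<bar> \<le> 1 / t\<^sup>2" unfolding r_def by (rule sqrt_ratio_expansion[OF t])
  obtain w where w: "min z (z + h) \<le> w" "w \<le> max z (z + h)"
    "normal_H (z + h) = normal_H z + H_slope * exp (- (z^2) / 2) * h - H_slope * w * exp (- (w^2) / 2) / 2 * h\<^sup>2"
    using normal_H_taylor[of 2 z h] by (auto simp: numeral_2_eq_2 fact_numeral)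
  have zh: "z + h = z * r" by (simp add: h_def algebra_simps)
  have "\<bar>z\<bar> * r \<le> \<bar>w\<bar>"
  proof (cases "0 \<le> z")
    case True
    hence "0 \<le> z * r" "z * r \<le> z" using r by (auto simp: mult_left_le)
    thus ?thesis using w(1) True unfolding zh by auto
  next
    case False
    hence "z * r \<le> 0" "z \<le> z * r" using r by (auto simp: mult_nonpos_nonneg mult_le_cancel_left1)
    thus ?thesis using w(2) False unfolding zh by auto
  qed
  hence "(\<bar>z\<bar> * r)\<^sup>2 \<le> \<bar>w\<bar>\<^sup>2" using r by (intro power_mono) auto
  moreover have "1 / 2 \<le> r\<^sup>2" using t by (simp add: r(3) field_simps)
  hence "z\<^sup>2 * (1 / 2) \<le> z\<^sup>2 * r\<^sup>2" by (intro mult_left_mono) auto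
  ultimately have zw: "z\<^sup>2 \<le> 2 * w\<^sup>2" by (simp add: power_mult_distrib)
  have "1 - r \<le> 1 / (2 * t) + 1 / t\<^sup>2" using rexp by linarith
  also have "\<dots> \<le> 1 / t + 1 / t"
    using t by (intro add_mono) (auto simp: field_simps power2_eq_square)
  finally have "(1 - r)\<^sup>2 \<le> (2 / t)\<^sup>2" using r by (intro power_mono) auto
  hence r2: "(r - 1)\<^sup>2 \<le> 4 / t\<^sup>2" by (simp add: power_divide power2_commute)
  have "\<bar>H_slope * w * exp (- (w^2) / 2) / 2 * h\<^sup>2\<bar> = H_slope * (\<bar>w\<bar> * exp (- (w^2) / 2)) / 2 * (z\<^sup>2 * (r - 1)\<^sup>2)"
    using H_slope_pos by (simp add: abs_mult h_def power_mult_distrib)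
  also have "\<dots> \<le> 1 * (\<bar>w\<bar> * exp (- (w^2) / 2)) / 2 * ((2 * w\<^sup>2) * (4 / t\<^sup>2))"
    using H_slope_pos H_slope_le_1 r2 zw
    by (intro mult_mono divide_right_mono mult_right_mono) auto
  also have "\<dots> = (\<bar>w\<bar> ^ 3 * exp (- (w^2) / 2)) * (4 / t\<^sup>2)"
    by (simp add: power2_eq_square power3_eq_cube abs_mult[symmetric])
  also have "\<dots> \<le> 9 * (4 / t\<^sup>2)" by (intro mult_right_mono cube_gauss_le) auto
  finally have e1: "\<bar>H_slope * w * exp (- (w^2) / 2) / 2 * h\<^sup>2\<bar> \<le> 36 / t\<^sup>2" by simp
  have "\<bar>H_slope * exp (- (z^2) / 2) * h + H_slope * z * exp (- (z^2) / 2) / (2 * t)\<bar>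
      = H_slope * (\<bar>z\<bar> * exp (- (z^2) / 2)) * \<bar>r - 1 + 1 / (2 * t)\<bar>"
  proof -
    have "H_slope * exp (- (z^2) / 2) * h + H_slope * z * exp (- (z^2) / 2) / (2 * t)
        = H_slope * (z * exp (- (z^2) / 2)) * (r - 1 + 1 / (2 * t))"
      by (simp add: h_def algebra_simps)
    thus ?thesis using H_slope_pos by (simp add: abs_mult)
  qed
  also have "\<dots> \<le> 1 * 1 * (1 / t\<^sup>2)"
    using H_slope_pos H_slope_le_1 rexp abs_gauss_le_1[of z] by (intro mult_mono) auto
  finally have "\<bar>H_slope * exp (- (z^2) / 2) * h + H_slope * z * exp (- (z^2) / 2) / (2 * t)\<bar> \<le> 1 / t\<^sup>2" by simp
  moreover have "normal_H (z * r) - normal_H z + H_slope * z * exp (- (z^2) / 2) / (2 * t)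
     = (H_slope * exp (- (z^2) / 2) * h + H_slope * z * exp (- (z^2) / 2) / (2 * t))
       - H_slope * w * exp (- (w^2) / 2) / 2 * h\<^sup>2"
    using w(3) unfolding zh by simp
  ultimately have "\<bar>normal_H (z * r) - normal_H z + H_slope * z * exp (- (z^2) / 2) / (2 * t)\<bar> \<le> 1 / t\<^sup>2 + 36 / t\<^sup>2"
    using e1 by linarith
  thus ?thesis by (simp add: r_def add_divide_distrib[symmetric])
qed

text \<open>
  Multiplying the argument by 1 + e moves H by at most e v H'(v), and v exp (-v^2/2) is bounded
  both by 1 and by v. This covers small and large arguments at once.
\<close>
lemma normal_H_rescale:
  assumes "0 \<le> v" "v \<le> u" "u \<le> v * (1 + e)" "0 \<le> e"
  shows "\<bar>normal_H u - normal_H v\<bar> \<le> e * min 1 v"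
proof (cases "v = u")
  case False
  hence "v < u" using assms by simp
  then obtain w where w: "v < w" "w < u" "normal_H u - normal_H v = (u - v) * (H_slope * exp (- (w^2) / 2))"
    by (rule normal_H_mvt)
  have "exp (- (w^2) / 2) \<le> exp (- (v^2) / 2)"
    using w assms by (auto intro!: power_mono)
  hence "(u - v) * (H_slope * exp (- (w^2) / 2)) \<le> (v * e) * (1 * exp (- (v^2) / 2))"
    using assms H_slope_pos H_slope_le_1 w by (intro mult_mono) (auto simp: algebra_simps)
  also have "\<dots> = e * (v * exp (- (v^2) / 2))" by simp
  also have "v * exp (- (v^2) / 2) \<le> min 1 v"
    using abs_gauss_le_1[of v] assms by (auto simp: mult_left_le)
  hence "e * (v * exp (- (v^2) / 2)) \<le> e * min 1 v"
    using assms by (intro mult_left_mono) auto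
  finally show ?thesis using w normal_H_mono[of v u] assms by simp
qed (use assms in auto)

section \<open>The walk killed below zero\<close>

text \<open>
  The law of one step. The locale asks for a third moment; the exponent 2 + \<delta> matters for
  negative starting points alone and is assumed there.
\<close>
locale step_law = prob_space \<mu> for \<mu> :: "real measure" +
  fixes \<sigma> :: real
  assumes sets_step [measurable_cong]: "sets \<mu> = sets borel"
    and third_moment: "integrable \<mu> (\<lambda>s. \<bar>s\<bar> ^ 3)"
    and mean_zero: "(\<integral>s. s \<partial>\<mu>) = 0"
    and second_moment: "(\<integral>s. s\<^sup>2 \<partial>\<mu>) = \<sigma>\<^sup>2"
    and sigma_pos: "0 < \<sigma>"
begin

lemma space_step [simp]: "space \<mu> = UNIV"
  using sets_eq_imp_space_eq[OF sets_step] by simp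

lemma integrable_square: "integrable \<mu> (\<lambda>s. s\<^sup>2)"
proof (rule Bochner_Integration.integrable_bound)
  show "integrable \<mu> (\<lambda>s. 1 + \<bar>s\<bar> ^ 3)" using third_moment by auto
  have "s\<^sup>2 \<le> 1 + \<bar>s\<bar> ^ 3" for s :: real
  proof (cases "\<bar>s\<bar> \<le> 1")
    case True
    hence "s\<^sup>2 \<le> 1" by (simp add: abs_square_le_1)
    thus ?thesis by (simp add: add_increasing2)
  next
    case False
    hence "\<bar>s\<bar>\<^sup>2 \<le> \<bar>s\<bar> ^ 3" by (intro power_increasing) auto
    thus ?thesis by simp
  qed
  thus "AE s in \<mu>. norm (s\<^sup>2) \<le> norm (1 + \<bar>s\<bar> ^ 3)" by auto
qed auto

lemma integrable_step: "integrable \<mu> (\<lambda>s. s)"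
proof (rule Bochner_Integration.integrable_bound)
  show "integrable \<mu> (\<lambda>s. 1 + s\<^sup>2)" using integrable_square by auto
  have "\<bar>s\<bar> \<le> 1 + s\<^sup>2" for s :: real
    using zero_le_power2[of "\<bar>s\<bar> - 1"] zero_le_power2[of s] by (simp add: power2_eq_square algebra_simps)
  thus "AE s in \<mu>. norm s \<le> norm (1 + s\<^sup>2)" by auto
qed auto

lemma integrable_abs_step: "integrable \<mu> (\<lambda>s. \<bar>s\<bar>)"
  using integrable_step by (rule integrable_abs)

text \<open>
  Boundedness is required on the half-line only: after a step the killed walk evaluates functions
  at non-negative points, and the overshoot function below is unbounded there.
\<close>
definition adm :: "(real \<Rightarrow> real) \<Rightarrow> bool" where
  "adm f \<longleftrightarrow> f \<in> borel_measurable borel \<and> (\<exists>B. \<forall>y\<ge>0. \<bar>f y\<bar> \<le> B)"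

lemma admI: "f \<in> borel_measurable borel \<Longrightarrow> (\<And>y. 0 \<le> y \<Longrightarrow> \<bar>f y\<bar> \<le> B) \<Longrightarrow> adm f"
  by (auto simp: adm_def)

lemma adm_measurable [measurable_dest]: "adm f \<Longrightarrow> f \<in> borel_measurable borel"
  by (simp add: adm_def)

lemma adm_bound: "adm f \<Longrightarrow> (\<And>B. 0 \<le> B \<Longrightarrow> (\<And>y. 0 \<le> y \<Longrightarrow> \<bar>f y\<bar> \<le> B) \<Longrightarrow> thesis) \<Longrightarrow> thesis"
  unfolding adm_def by (metis abs_ge_zero order_trans order_refl)

lemma adm_const [simp, intro]: "adm (\<lambda>_. c)"
  by (rule admI[where B="\<bar>c\<bar>"]) auto

lemma adm_add [intro]: "adm f \<Longrightarrow> adm g \<Longrightarrow> adm (\<lambda>y. f y + g y)"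
proof -
  assume f: "adm f" and g: "adm g"
  obtain A where A: "\<And>y. 0 \<le> y \<Longrightarrow> \<bar>f y\<bar> \<le> A" using adm_bound[OF f] by blast
  obtain B where B: "\<And>y. 0 \<le> y \<Longrightarrow> \<bar>g y\<bar> \<le> B" using adm_bound[OF g] by blast
  have [measurable]: "f \<in> borel_measurable borel" "g \<in> borel_measurable borel" using f g by (auto dest: adm_measurable)
  show ?thesis
    by (rule admI[where B="A + B"]) (use A B in \<open>auto intro: order_trans[OF abs_triangle_ineq] add_mono\<close>)
qed

lemma adm_cmult [intro]: "adm f \<Longrightarrow> adm (\<lambda>y. c * f y)"
proof -
  assume f: "adm f"
  obtain A where A: "\<And>y. 0 \<le> y \<Longrightarrow> \<bar>f y\<bar> \<le> A" using adm_bound[OF f] by blast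
  have [measurable]: "f \<in> borel_measurable borel" using f by (auto dest: adm_measurable)
  show ?thesis
    by (rule admI[where B="\<bar>c\<bar> * A"]) (use A in \<open>auto simp: abs_mult intro: mult_left_mono\<close>)
qed

lemma adm_divide [intro]: "adm f \<Longrightarrow> adm (\<lambda>y. f y / c)"
  using adm_cmult[of f "inverse c"] by (simp add: divide_inverse mult.commute)

lemma adm_diff [intro]: "adm f \<Longrightarrow> adm g \<Longrightarrow> adm (\<lambda>y. f y - g y)"
  using adm_add[OF _ adm_cmult[of g "-1"]] by simp

lemma adm_sum [intro]: "(\<And>i. i \<in> I \<Longrightarrow> adm (f i)) \<Longrightarrow> adm (\<lambda>y. \<Sum>i\<in>I. f i y)"
  by (induction I rule: infinite_finite_induct) auto

lemma adm_indicator [intro]: "A \<in> sets borel \<Longrightarrow> adm (indicator A)"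
  by (rule admI[where B=1]) (auto simp: indicator_def)

lemma adm_min [intro]: "adm (\<lambda>y. min y a)"
  by (rule admI[where B="\<bar>a\<bar>"]) auto

definition killed :: "(real \<Rightarrow> real) \<Rightarrow> real \<Rightarrow> real" where
  "killed f x = (\<integral>s. indicator {0..} (x + s) * f (x + s) \<partial>\<mu>)"

lemma integrable_killed:
  assumes "adm f"
  shows "integrable \<mu> (\<lambda>s. indicator {0..} (x + s) * f (x + s))"
proof -
  have [measurable]: "f \<in> borel_measurable borel" using assms by (rule adm_measurable)
  obtain B where "0 \<le> B" "\<And>y. 0 \<le> y \<Longrightarrow> \<bar>f y\<bar> \<le> B" using adm_bound[OF assms] by blast
  thus ?thesis
    by (intro integrable_const_bound[where B=B]) (auto simp: indicator_def)
qed

lemma killed_measurable [measurable]: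
  assumes [measurable]: "f \<in> borel_measurable borel"
  shows "killed f \<in> borel_measurable borel"
  unfolding killed_def[abs_def] by measurable

lemma killed_bound:
  assumes "\<And>y. 0 \<le> y \<Longrightarrow> \<bar>f y\<bar> \<le> B" "0 \<le> B" and [measurable]: "f \<in> borel_measurable borel"
  shows "\<bar>killed f x\<bar> \<le> B"
proof -
  have "\<bar>killed f x\<bar> \<le> (\<integral>s. \<bar>indicator {0..} (x + s) * f (x + s)\<bar> \<partial>\<mu>)"
    unfolding killed_def by (rule integral_abs_bound)
  also have "\<dots> \<le> (\<integral>s. B \<partial>\<mu>)"
    by (intro integral_mono_AE' integrable_const) (use assms in \<open>auto simp: indicator_def\<close>)
  finally show ?thesis using prob_space by simp
qed

lemma adm_killed [intro]: "adm f \<Longrightarrow> adm (killed f)"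
  by (metis adm_bound adm_measurable admI killed_bound killed_measurable)

lemma killed_add: "adm f \<Longrightarrow> adm g \<Longrightarrow> killed (\<lambda>y. f y + g y) = (\<lambda>x. killed f x + killed g x)"
  unfolding killed_def
  by (subst Bochner_Integration.integral_add[symmetric]) (auto intro!: integrable_killed simp: distrib_left)

lemma killed_cmult: "killed (\<lambda>y. c * f y) = (\<lambda>x. c * killed f x)"
  unfolding killed_def by (simp flip: integral_mult_right_zero add: mult_ac)

lemma killed_mono:
  assumes "adm f" "adm g" "\<And>y. 0 \<le> y \<Longrightarrow> f y \<le> g y"
  shows "killed f x \<le> killed g x"
  unfolding killed_def
  by (intro integral_mono integrable_killed assms) (auto simp: indicator_def assms)

text \<open>
  In terms of the walk, \<open>evolve n f x\<close> is the expectation of f(x + S_n) on the event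
  that x + S_k \<ge> 0 for 1 \<le> k \<le> n. The identity \<open>evolve_add_time\<close> is the
  Markov property.
\<close>
definition evolve :: "nat \<Rightarrow> (real \<Rightarrow> real) \<Rightarrow> real \<Rightarrow> real" where
  "evolve n f = (killed ^^ n) f"

lemma evolve_0 [simp]: "evolve 0 f = f"
  by (simp add: evolve_def)

lemma evolve_Suc: "evolve (Suc n) f = killed (evolve n f)"
  by (simp add: evolve_def)

lemma evolve_Suc': "evolve (Suc n) f = evolve n (killed f)"
  by (simp add: evolve_def funpow_swap1)

lemma evolve_add_time: "evolve (m + n) f = evolve m (evolve n f)"
  by (simp add: evolve_def funpow_add)

lemma adm_evolve [intro]: "adm f \<Longrightarrow> adm (evolve n f)"
  by (induction n) (auto simp: evolve_Suc)

lemma evolve_add: "adm f \<Longrightarrow> adm g \<Longrightarrow> evolve n (\<lambda>y. f y + g y) = (\<lambda>x. evolve n f x + evolve n g x)"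
  by (induction n) (auto simp: evolve_Suc killed_add adm_evolve)

lemma evolve_cmult: "evolve n (\<lambda>y. c * f y) = (\<lambda>x. c * evolve n f x)"
  by (induction n) (auto simp: evolve_Suc killed_cmult)

lemma evolve_diff: "adm f \<Longrightarrow> adm g \<Longrightarrow> evolve n (\<lambda>y. f y - g y) = (\<lambda>x. evolve n f x - evolve n g x)"
  using evolve_add[of f "\<lambda>y. - 1 * g y" n] evolve_cmult[of n "-1" g] adm_cmult[of g "-1"] by simp

lemma evolve_sum:
  "(\<And>i. i \<in> I \<Longrightarrow> adm (f i)) \<Longrightarrow> evolve n (\<lambda>y. \<Sum>i\<in>I. f i y) = (\<lambda>x. \<Sum>i\<in>I. evolve n (f i) x)"
proof (induction I rule: infinite_finite_induct)
  case (infinite A)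
  thus ?case using evolve_cmult[of n 0 "\<lambda>_. 0"] by simp
next
  case empty
  thus ?case using evolve_cmult[of n 0 "\<lambda>_. 0"] by simp
next
  case (insert x F)
  thus ?case using evolve_add[of "f x" "\<lambda>y. \<Sum>i\<in>F. f i y" n] by (simp add: adm_sum)
qed

lemma evolve_mono:
  assumes "adm f" "adm g" "\<And>y. 0 \<le> y \<Longrightarrow> f y \<le> g y" "0 \<le> x"
  shows "evolve n f x \<le> evolve n g x"
  using assms(4)
proof (induction n arbitrary: x)
  case (Suc n)
  thus ?case unfolding evolve_Suc by (intro killed_mono adm_evolve assms(1,2))
qed (use assms in auto)

lemma evolve_nonneg:
  assumes "adm f" "\<And>y. 0 \<le> y \<Longrightarrow> 0 \<le> f y" "0 \<le> x"
  shows "0 \<le> evolve n f x"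
  using evolve_mono[of "\<lambda>_. 0" f x n] evolve_cmult[of n 0 "\<lambda>_. 0"] assms by simp

lemma evolve_abs_le:
  assumes "adm f" "adm g" "\<And>y. 0 \<le> y \<Longrightarrow> \<bar>f y\<bar> \<le> g y" "0 \<le> x"
  shows "\<bar>evolve n f x\<bar> \<le> evolve n g x"
proof -
  have "evolve n f x \<le> evolve n g x"
    using assms by (intro evolve_mono) (auto simp: abs_le_iff)
  moreover have "evolve n (\<lambda>y. - 1 * f y) x \<le> evolve n g x"
    using assms by (intro evolve_mono adm_cmult) (auto simp: abs_le_iff)
  ultimately show ?thesis unfolding evolve_cmult by simp
qed

definition surv :: "nat \<Rightarrow> real \<Rightarrow> real" where
  "surv n = evolve n (\<lambda>_. 1)"

lemma adm_surv [intro]: "adm (surv n)"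
  by (auto simp: surv_def)

lemma evolve_const: "evolve n (\<lambda>_. c) x = c * surv n x"
  using evolve_cmult[of n c "\<lambda>_. 1"] by (simp add: surv_def)

lemma surv_Suc: "surv (Suc n) = killed (surv n)"
  by (simp add: surv_def evolve_Suc)

lemma surv_nonneg: "0 \<le> x \<Longrightarrow> 0 \<le> surv n x"
  unfolding surv_def by (intro evolve_nonneg) auto

lemma surv_le_1: "surv n x \<le> 1"
proof -
  have "\<bar>surv n x\<bar> \<le> 1"
  proof (induction n arbitrary: x)
    case (Suc n)
    thus ?case unfolding surv_Suc by (intro killed_bound) (auto intro: adm_measurable)
  qed (simp add: surv_def)
  thus ?thesis by simp
qed

lemma surv_add: "surv (m + n) = evolve m (surv n)"
  by (simp add: surv_def evolve_add_time)

lemma surv_antimono: "m \<le> n \<Longrightarrow> 0 \<le> x \<Longrightarrow> surv n x \<le> surv m x"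
  using evolve_mono[of "surv (n - m)" "\<lambda>_. 1" x m] surv_add[of m "n - m"] surv_le_1
  by (simp add: adm_surv) (simp add: surv_def)

text \<open>
  The Green operator of the killed walk up to time n: applied to an indicator it counts the
  expected visits.
\<close>
definition potential :: "nat \<Rightarrow> (real \<Rightarrow> real) \<Rightarrow> real \<Rightarrow> real" where
  "potential n f x = (\<Sum>k<n. evolve k f x)"

lemma adm_potential [intro]: "adm f \<Longrightarrow> adm (potential n f)"
  unfolding potential_def[abs_def] by auto

lemma potential_add: "adm f \<Longrightarrow> adm g \<Longrightarrow> potential n (\<lambda>y. f y + g y) x = potential n f x + potential n g x"
  by (simp add: potential_def evolve_add sum.distrib)

lemma potential_diff: "adm f \<Longrightarrow> adm g \<Longrightarrow> potential n (\<lambda>y. f y - g y) x = potential n f x - potential n g x"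
  by (simp add: potential_def evolve_diff sum_subtractf)

lemma potential_cmult: "potential n (\<lambda>y. c * f y) x = c * potential n f x"
  by (simp add: potential_def evolve_cmult sum_distrib_left)

lemma potential_sum:
  "(\<And>i. i \<in> I \<Longrightarrow> adm (f i)) \<Longrightarrow> potential n (\<lambda>y. \<Sum>i\<in>I. f i y) x = (\<Sum>i\<in>I. potential n (f i) x)"
  unfolding potential_def by (subst sum.swap) (simp add: evolve_sum)

lemma potential_mono:
  "adm f \<Longrightarrow> adm g \<Longrightarrow> (\<And>y. 0 \<le> y \<Longrightarrow> f y \<le> g y) \<Longrightarrow> 0 \<le> x \<Longrightarrow> potential n f x \<le> potential n g x"
  unfolding potential_def by (intro sum_mono evolve_mono)

lemma potential_nonneg:
  "adm f \<Longrightarrow> (\<And>y. 0 \<le> y \<Longrightarrow> 0 \<le> f y) \<Longrightarrow> 0 \<le> x \<Longrightarrow> 0 \<le> potential n f x"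
  unfolding potential_def by (intro sum_nonneg evolve_nonneg)

lemma potential_const: "potential n (\<lambda>_. c) x = c * (\<Sum>k<n. surv k x)"
  by (simp add: potential_def evolve_const sum_distrib_left)

lemma potential_const_le: "0 \<le> c \<Longrightarrow> potential n (\<lambda>_. c) x \<le> c * real n"
  unfolding potential_const
  by (intro mult_left_mono order_trans[OF sum_bounded_above[of _ _ 1]]) (auto simp: surv_le_1)

text \<open>
  Optional stopping in operator form: the left-hand side sums the mean losses of f along the
  killed walk, where being killed counts as losing the whole value.
\<close>
lemma potential_dynkin:
  assumes "adm f"
  shows "potential n (\<lambda>y. f y - killed f y) x = f x - evolve n f x"
proof (induction n)
  case (Suc n)
  thus ?case
    using assms by (simp add: potential_def evolve_diff adm_killed evolve_Suc')
qed (simp add: potential_def)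

lemma evolve_potential: "adm f \<Longrightarrow> evolve m (potential n f) x = (\<Sum>k=m..<m+n. evolve k f x)"
proof -
  assume f: "adm f"
  have "evolve m (potential n f) x = (\<Sum>k<n. evolve (m + k) f x)"
    unfolding potential_def[abs_def] using f by (simp add: evolve_sum adm_evolve evolve_add_time)
  also have "\<dots> = (\<Sum>k=m..<m+n. evolve k f x)"
    by (rule sum.reindex_bij_witness[of _ "\<lambda>k. k - m" "\<lambda>k. m + k"]) auto
  finally show ?thesis .
qed

lemma potential_Suc: "adm f \<Longrightarrow> potential (Suc n) f x = f x + killed (potential n f) x"
  using evolve_potential[of f 1 n x]
  by (simp add: potential_def evolve_Suc lessThan_atLeast0 sum.atLeast_Suc_lessThan del: sum.lessThan_Suc)

end

section \<open>Visits to slabs and the mean overshoot\<close>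

context step_law
begin

definition overshoot :: "real \<Rightarrow> real" where
  "overshoot x = (\<integral>s. max 0 (- (x + s)) \<partial>\<mu>)"

definition overshoot2 :: "real \<Rightarrow> real" where
  "overshoot2 x = (\<integral>s. (max 0 (- (x + s)))\<^sup>2 \<partial>\<mu>)"

lemma integrable_overshoot: "integrable \<mu> (\<lambda>s. max 0 (- (x + s)))"
proof (rule Bochner_Integration.integrable_bound)
  show "integrable \<mu> (\<lambda>s. \<bar>x\<bar> + \<bar>s\<bar>)" using integrable_abs_step by auto
qed auto

lemma integrable_overshoot2: "integrable \<mu> (\<lambda>s. (max 0 (- (x + s)))\<^sup>2)"
proof (rule Bochner_Integration.integrable_bound)
  show "integrable \<mu> (\<lambda>s. 2 * x\<^sup>2 + 2 * s\<^sup>2)" using integrable_square by auto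
  have "(max 0 (- (x + s)))\<^sup>2 \<le> 2 * x\<^sup>2 + 2 * s\<^sup>2" for s
  proof -
    have "(max 0 (- (x + s)))\<^sup>2 \<le> (x + s)\<^sup>2" by (subst abs_le_square_iff[symmetric]) auto
    also have "\<dots> \<le> 2 * x\<^sup>2 + 2 * s\<^sup>2"
      using zero_le_power2[of "x - s"] by (simp add: power2_eq_square algebra_simps)
    finally show ?thesis .
  qed
  thus "AE s in \<mu>. norm ((max 0 (- (x + s)))\<^sup>2) \<le> norm (2 * x\<^sup>2 + 2 * s\<^sup>2)" by auto
qed auto

lemma overshoot_measurable [measurable]: "overshoot \<in> borel_measurable borel"
  unfolding overshoot_def[abs_def] by measurable

lemma overshoot2_measurable [measurable]: "overshoot2 \<in> borel_measurable borel"
  unfolding overshoot2_def[abs_def] by measurable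

lemma overshoot_nonneg: "0 \<le> overshoot x"
  unfolding overshoot_def by (rule integral_nonneg_AE) auto

lemma overshoot2_nonneg: "0 \<le> overshoot2 x"
  unfolding overshoot2_def by (rule integral_nonneg_AE) auto

lemma overshoot_antimono: "x \<le> y \<Longrightarrow> overshoot y \<le> overshoot x"
  unfolding overshoot_def by (intro integral_mono integrable_overshoot) auto

lemma overshoot2_antimono: "x \<le> y \<Longrightarrow> overshoot2 y \<le> overshoot2 x"
  unfolding overshoot2_def by (intro integral_mono integrable_overshoot2 power_mono) auto

lemma adm_overshoot [intro, simp]: "adm overshoot"
  by (rule admI[where B="overshoot 0"]) (auto simp: overshoot_nonneg overshoot_antimono)

lemma adm_overshoot2 [intro, simp]: "adm overshoot2"
  by (rule admI[where B="overshoot2 0"]) (auto simp: overshoot2_nonneg overshoot2_antimono)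

text \<open>
  A width b with E(X - b)^+ \<ge> b. Since E X^+ = E|X|/2, a quarter of E|X| will do.
\<close>
definition slab :: real where
  "slab = (\<integral>s. \<bar>s\<bar> \<partial>\<mu>) / 4"

lemma slab_pos: "0 < slab"
proof -
  have "(\<integral>s. \<bar>s\<bar> \<partial>\<mu>) \<noteq> 0"
  proof
    assume "(\<integral>s. \<bar>s\<bar> \<partial>\<mu>) = 0"
    hence "AE s in \<mu>. \<bar>s\<bar> = 0"
      using integral_nonneg_eq_0_iff_AE[OF integrable_abs_step] by auto
    hence "(\<integral>s. s\<^sup>2 \<partial>\<mu>) = (\<integral>s. 0 \<partial>\<mu>)"
      by (intro integral_cong_AE) auto
    thus False using second_moment sigma_pos by simp
  qed
  moreover have "0 \<le> (\<integral>s. \<bar>s\<bar> \<partial>\<mu>)" by (rule integral_nonneg_AE) auto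
  ultimately have "0 < (\<integral>s. \<bar>s\<bar> \<partial>\<mu>)" by linarith
  thus ?thesis by (simp add: slab_def)
qed

lemma mean_positive_part: "(\<integral>s. max 0 s \<partial>\<mu>) = 2 * slab"
proof -
  have "(\<integral>s. max 0 s \<partial>\<mu>) = (\<integral>s. (\<bar>s\<bar> + s) / 2 \<partial>\<mu>)"
    by (rule Bochner_Integration.integral_cong) auto
  also have "\<dots> = 2 * slab"
    using integrable_abs_step integrable_step mean_zero by (simp add: slab_def)
  finally show ?thesis .
qed

lemma overshoot_0: "overshoot 0 = 2 * slab"
proof -
  have "overshoot 0 = (\<integral>s. (\<bar>s\<bar> - s) / 2 \<partial>\<mu>)"
    unfolding overshoot_def by (rule Bochner_Integration.integral_cong) auto
  also have "\<dots> = 2 * slab"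
    using integrable_abs_step integrable_step mean_zero by (simp add: slab_def)
  finally show ?thesis .
qed

lemma integrable_excess: "integrable \<mu> (\<lambda>s. max 0 (s - slab))"
proof (rule Bochner_Integration.integrable_bound)
  show "integrable \<mu> (\<lambda>s. \<bar>s\<bar>)" by (rule integrable_abs_step)
  show "AE s in \<mu>. norm (max 0 (s - slab)) \<le> norm \<bar>s\<bar>" using slab_pos by auto
qed auto

lemma slab_le_mean_excess: "slab \<le> (\<integral>s. max 0 (s - slab) \<partial>\<mu>)"
proof -
  have i: "integrable \<mu> (\<lambda>s. max 0 s)"
    by (rule Bochner_Integration.integrable_bound[OF integrable_abs_step]) auto
  have "slab = (\<integral>s. max 0 s - slab \<partial>\<mu>)"
    using i mean_positive_part prob_space by simp
  also have "\<dots> \<le> (\<integral>s. max 0 (s - slab) \<partial>\<mu>)"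
    using slab_pos by (intro integral_mono integrable_excess) (use i in auto)
  finally show ?thesis .
qed

text \<open>
  The function min(z, a) is concave, so its mean does not increase along the walk. From a point
  within distance b below a the truncation at a loses at least E(X - b)^+ \<ge> b. Killing
  replaces the negative part by zero, which is the overshoot term.
\<close>
lemma min_drift:
  assumes y: "0 \<le> y" and a: "0 \<le> a"
  shows "slab * indicator {a - slab..a} y - overshoot y \<le> min y a - killed (\<lambda>z. min z a) y"
proof -
  \<comment> \<open>adding a multiple of the centred step makes the integrand non-negative pointwise\<close>
  define c where "c = (if y \<le> a then 1 else 0 :: real)"
  define g where "g s = min y a + c * s - indicator {0..} (y + s) * min (y + s) a + max 0 (- (y + s))" for s
  have int: "integrable \<mu> (\<lambda>s. indicator {0..} (y + s) * min (y + s) a)"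
    by (rule integrable_killed) auto
  have g: "integrable \<mu> g"
    unfolding g_def using int integrable_step integrable_overshoot by auto
  have eq: "(\<integral>s. g s \<partial>\<mu>) = min y a - killed (\<lambda>z. min z a) y + overshoot y"
    unfolding g_def killed_def overshoot_def
    using int integrable_step integrable_overshoot mean_zero prob_space by simp
  have "slab * indicator {a - slab..a} y \<le> (\<integral>s. g s \<partial>\<mu>)"
  proof (cases "y \<in> {a - slab..a}")
    case True
    have "(\<integral>s. max 0 (s - slab) \<partial>\<mu>) \<le> (\<integral>s. g s \<partial>\<mu>)"
      by (intro integral_mono integrable_excess g)
         (use True y slab_pos in \<open>auto simp: g_def c_def indicator_def\<close>)
    thus ?thesis using True slab_le_mean_excess by simp
  next
    case False
    have "0 \<le> (\<integral>s. g s \<partial>\<mu>)"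
      by (intro integral_nonneg_AE) (use False y a slab_pos in \<open>auto simp: g_def c_def indicator_def\<close>)
    thus ?thesis using False by simp
  qed
  thus ?thesis unfolding eq by simp
qed

text \<open>
  Every visit to the slab costs b in mean, and the total budget is the initial value plus what is
  gained from the exits.
\<close>
lemma potential_slab:
  assumes "0 \<le> x" "0 \<le> a"
  shows "slab * potential n (indicator {a - slab..a}) x + evolve n (\<lambda>z. min z a) x
    \<le> min x a + potential n overshoot x"
proof -
  have "potential n (\<lambda>y. slab * indicator {a - slab..a} y - overshoot y) x
      \<le> potential n (\<lambda>y. min y a - killed (\<lambda>z. min z a) y) x"
    by (intro potential_mono min_drift adm_diff adm_cmult adm_indicator adm_overshoot adm_min adm_killed assms) auto
  also have "\<dots> = min x a - evolve n (\<lambda>z. min z a) x"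
    by (rule potential_dynkin) auto
  also have "potential n (\<lambda>y. slab * indicator {a - slab..a} y - overshoot y) x
     = slab * potential n (indicator {a - slab..a}) x - potential n overshoot x"
    by (subst potential_diff) (auto simp: potential_cmult adm_indicator)
  finally show ?thesis by simp
qed

definition down :: real where
  "down = prob {..< - slab}"

lemma down_pos: "0 < down"
proof (rule ccontr)
  assume "\<not> 0 < down"
  hence "prob {..< - slab} = 0" using measure_nonneg[of \<mu> "{..< - slab}"] by (simp add: down_def)
  hence "AE s in \<mu>. s \<notin> {..< - slab}"
    by (intro AE_not_in) (auto simp: emeasure_eq_measure null_sets_def)
  hence "AE s in \<mu>. max 0 (- (0 + s)) \<le> slab"
    by eventually_elim (use slab_pos in auto)
  hence "overshoot 0 \<le> (\<integral>s. slab \<partial>\<mu>)"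
    unfolding overshoot_def by (intro integral_mono_AE integrable_overshoot) auto
  thus False using slab_pos prob_space overshoot_0 by simp
qed

lemma down_le_1: "down \<le> 1"
  by (simp add: down_def)

text \<open>
  From below level j b, a run of j consecutive steps below -b leads out of the half-line.
\<close>
lemma surv_lower_levels:
  assumes "0 \<le> y" "y < real j * slab"
  shows "surv j y \<le> 1 - down ^ j"
  using assms
proof (induction j arbitrary: y)
  case (Suc j)
  have "surv (Suc j) y \<le> (\<integral>s. 1 - down ^ j * indicator {..< - slab} s \<partial>\<mu>)"
    unfolding surv_Suc killed_def
  proof (intro integral_mono integrable_killed adm_surv)
    fix s
    have "0 \<le> 1 - down ^ j" using down_pos down_le_1 by (simp add: power_le_one)
    moreover have "surv j (y + s) \<le> 1 - down ^ j" if "s < - slab" "0 \<le> y + s"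
      using that Suc.prems by (intro Suc.IH) (auto simp: algebra_simps)
    ultimately show "indicator {0..} (y + s) * surv j (y + s) \<le> 1 - down ^ j * indicator {..< - slab} s"
      using surv_le_1[of j "y + s"] by (auto simp: indicator_def)
  qed (intro Bochner_Integration.integrable_diff integrable_mult_right integrable_real_indicator;
       simp add: emeasure_eq_measure)+
  also have "\<dots> = 1 - down ^ Suc j"
  proof -
    have "integrable \<mu> (\<lambda>s. indicator {..< - slab} s :: real)"
      by (simp add: emeasure_eq_measure)
    thus ?thesis using prob_space by (simp add: down_def)
  qed
  finally show ?case .
qed simp

text \<open>
  Each visit to [0, Y) is followed by an exit within J steps with probability bounded below. The
  sum of the probabilities of exiting during the J steps after time k telescopes to at most J.
\<close>
lemma potential_lower_levels:
  obtains C where "0 \<le> C" "\<And>n x. 0 \<le> x \<Longrightarrow> potential n (indicator {0..<Y}) x \<le> C"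
proof -
  define J where "J = nat \<lceil>Y / slab\<rceil>"
  have J: "Y \<le> real J * slab"
    using slab_pos real_nat_ceiling_ge[of "Y / slab"] by (simp add: J_def field_simps)
  have dJ: "0 < down ^ J" using down_pos by simp
  have "potential n (indicator {0..<Y}) x \<le> real J / down ^ J" if x: "0 \<le> x" for n x
  proof -
    have le: "(\<Sum>k<n. surv k x - surv (k + j) x) \<le> real j" for j
    proof (induction j)
      case (Suc j)
      have "(\<Sum>k<n. surv (k + j) x - surv (Suc (k + j)) x) = surv (0 + j) x - surv (n + j) x"
        using sum_lessThan_telescope'[of "\<lambda>k. surv (k + j) x" n] by simp
      also have "\<dots> \<le> 1" using surv_le_1[of j x] surv_nonneg[OF x, of "n + j"] by simp
      finally have "(\<Sum>k<n. surv k x - surv (k + j) x) + (\<Sum>k<n. surv (k + j) x - surv (Suc (k + j)) x) \<le> real j + 1"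
        using Suc by linarith
      thus ?case by (simp add: sum.distrib[symmetric])
    qed simp
    have "down ^ J * potential n (indicator {0..<Y}) x = potential n (\<lambda>y. down ^ J * indicator {0..<Y} y) x"
      by (simp add: potential_cmult)
    also have "\<dots> \<le> potential n (\<lambda>y. 1 - surv J y) x"
    proof (intro potential_mono x)
      fix y :: real assume y: "0 \<le> y"
      show "down ^ J * indicator {0..<Y} y \<le> 1 - surv J y"
        using surv_lower_levels[OF y, of J] surv_le_1[of J y] J y by (auto simp: indicator_def)
    qed (intro adm_cmult adm_indicator adm_diff adm_const adm_surv; simp)+
    also have "\<dots> = (\<Sum>k<n. surv k x - surv (k + J) x)"
      by (subst potential_diff) (auto simp: potential_def surv_add[symmetric] sum_subtractf, simp add: surv_def)
    also have "\<dots> \<le> real J" by (rule le)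
    finally show ?thesis using dJ by (simp add: field_simps)
  qed
  thus ?thesis using dJ by (intro that[of "real J / down ^ J"]) auto
qed

text \<open>
  A decreasing function is dominated by its values at the lower ends of the slabs. The first J
  slabs are kept together because their visits can be bounded without reference to the overshoot.
  The visits above level N b are bounded crudely by the number of steps; N is chosen large in
  terms of n.
\<close>
lemma potential_antimono_le:
  assumes w: "adm w" "\<And>y. 0 \<le> w y" "\<And>y z. y \<le> z \<Longrightarrow> w z \<le> w y"
    and x: "0 \<le> x" and JN: "J \<le> N"
  shows "potential n w x \<le> w 0 * potential n (indicator {0..<real J * slab}) x
    + (\<Sum>j=J..<N. w (real j * slab) / slab * (min x (real (Suc j) * slab) + potential n overshoot x))
    + w (real N * slab) * real n"
proof -
  define I where "I j = (indicator {real (Suc j) * slab - slab..real (Suc j) * slab} :: real \<Rightarrow> real)" for j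
  have admI: "adm (I j)" for j unfolding I_def by auto
  have dom: "w y \<le> w 0 * indicator {0..<real J * slab} y + ((\<Sum>j=J..<N. w (real j * slab) * I j y) + w (real N * slab))"
    if y: "0 \<le> y" for y
  proof -
    define j where "j = nat \<lfloor>y / slab\<rfloor>"
    have "real j \<le> y / slab" "y / slab < real j + 1"
      using y slab_pos by (auto simp: j_def of_nat_nat)
    hence j: "real j * slab \<le> y" "y \<le> real (Suc j) * slab"
      using slab_pos by (auto simp: field_simps)
    have nn: "0 \<le> (\<Sum>j=J..<N. w (real j * slab) * I j y)"
      by (intro sum_nonneg mult_nonneg_nonneg w) (auto simp: I_def)
    consider "j < J" | "N \<le> j" | "j \<in> {J..<N}" by force
    thus ?thesis
    proof cases
      case 1
      hence "real (Suc j) * slab \<le> real J * slab" using slab_pos by (intro mult_right_mono) auto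
      moreover have "y < real (Suc j) * slab"
        using \<open>y / slab < real j + 1\<close> slab_pos by (simp add: field_simps)
      ultimately have "w y \<le> w 0 * indicator {0..<real J * slab} y" using y by (simp add: w)
      thus ?thesis using nn w(2)[of "real N * slab"] by linarith
    next
      case 2
      hence "real N * slab \<le> real j * slab" using slab_pos by (intro mult_right_mono) auto
      hence "w y \<le> w (real N * slab)" using j by (intro w) auto
      moreover have "0 \<le> w 0 * indicator {0..<real J * slab} y" by (simp add: w)
      ultimately show ?thesis using nn by linarith
    next
      case 3
      have "w y \<le> w (real j * slab) * I j y"
        using j w(3) by (simp add: I_def algebra_simps)
      also have "\<dots> \<le> (\<Sum>j=J..<N. w (real j * slab) * I j y)"
        by (rule member_le_sum[of j "{J..<N}" "\<lambda>j. w (real j * slab) * I j y"])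
           (use 3 in \<open>auto intro!: mult_nonneg_nonneg w simp: I_def\<close>)
      moreover have "0 \<le> w 0 * indicator {0..<real J * slab} y" by (simp add: w)
      ultimately show ?thesis using w(2)[of "real N * slab"] by linarith
    qed
  qed
  have "potential n w x \<le> potential n (\<lambda>y. w 0 * indicator {0..<real J * slab} y
      + ((\<Sum>j=J..<N. w (real j * slab) * I j y) + w (real N * slab))) x"
    by (intro potential_mono dom x w adm_add adm_cmult adm_sum adm_indicator admI) auto
  also have "\<dots> = w 0 * potential n (indicator {0..<real J * slab}) x
     + ((\<Sum>j=J..<N. w (real j * slab) * potential n (I j) x) + potential n (\<lambda>_. w (real N * slab)) x)"
    by (subst potential_add potential_sum | (intro adm_add adm_cmult adm_sum adm_indicator admI; simp; fail)
        | simp add: potential_cmult)+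
  also have "\<dots> \<le> w 0 * potential n (indicator {0..<real J * slab}) x
     + ((\<Sum>j=J..<N. w (real j * slab) / slab * (min x (real (Suc j) * slab) + potential n overshoot x))
        + w (real N * slab) * real n)"
  proof (intro add_left_mono add_mono sum_mono)
    fix j
    have "0 \<le> evolve n (\<lambda>z. min z (real (Suc j) * slab)) x"
      using slab_pos x by (intro evolve_nonneg adm_min) auto
    hence "slab * potential n (I j) x \<le> min x (real (Suc j) * slab) + potential n overshoot x"
      using potential_slab[OF x, of "real (Suc j) * slab" n] slab_pos unfolding I_def by simp
    hence "w (real j * slab) / slab * (slab * potential n (I j) x)
       \<le> w (real j * slab) / slab * (min x (real (Suc j) * slab) + potential n overshoot x)"
      using slab_pos w(2) by (intro mult_left_mono) auto
    thus "w (real j * slab) * potential n (I j) x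
       \<le> w (real j * slab) / slab * (min x (real (Suc j) * slab) + potential n overshoot x)"
      using slab_pos by simp
  qed (use potential_const_le w(2) in auto)
  finally show ?thesis by simp
qed

lemma potential_antimono_linear:
  assumes w: "adm w" "\<And>y. 0 \<le> w y" "\<And>y z. y \<le> z \<Longrightarrow> w z \<le> w y"
    and K: "\<And>n x. 0 \<le> x \<Longrightarrow> potential n overshoot x \<le> K" and x: "0 \<le> x"
  shows "potential n w x \<le> (\<Sum>j<N. w (real j * slab)) / slab * (x + K) + w (real N * slab) * real n"
proof -
  have "potential n w x \<le> w 0 * potential n (indicator {0..<real 0 * slab}) x
    + (\<Sum>j=0..<N. w (real j * slab) / slab * (min x (real (Suc j) * slab) + potential n overshoot x))
    + w (real N * slab) * real n"
    by (intro potential_antimono_le w x) auto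
  also have "potential n (indicator {0..<real 0 * slab}) x = 0"
    using potential_cmult[of n 0 "\<lambda>_. 0"] by (simp add: indicator_def[abs_def])
  also have "(\<Sum>j=0..<N. w (real j * slab) / slab * (min x (real (Suc j) * slab) + potential n overshoot x))
    \<le> (\<Sum>j=0..<N. w (real j * slab) / slab * (x + K))"
    using slab_pos K[OF x, of n] w(2) by (intro sum_mono mult_left_mono add_mono) auto
  also have "\<dots> = (\<Sum>j<N. w (real j * slab)) / slab * (x + K)"
    by (simp add: sum_distrib_right sum_divide_distrib lessThan_atLeast0)
  finally show ?thesis by simp
qed

lemma count_levels:
  assumes "0 \<le> r"
  shows "(\<Sum>j<N. if real j * slab < r then 1 else 0 :: real) \<le> r / slab + 1"
proof -
  have "(\<Sum>j<N. if real j * slab < r then 1 else 0 :: real) = real (card {j \<in> {..<N}. real j * slab < r})"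
    by (simp add: sum.If_cases Int_def)
  also have "card {j \<in> {..<N}. real j * slab < r} \<le> card {..<nat \<lceil>r / slab\<rceil>}"
  proof (intro card_mono subsetI)
    fix j assume "j \<in> {j \<in> {..<N}. real j * slab < r}"
    hence "real j < r / slab" using slab_pos by (simp add: field_simps)
    thus "j \<in> {..<nat \<lceil>r / slab\<rceil>}" by (simp add: less_ceiling_iff zless_nat_eq_int_zless)
  qed auto
  also have "real (card {..<nat \<lceil>r / slab\<rceil>}) \<le> r / slab + 1"
    using assms slab_pos by (simp add: of_nat_nat)
  finally show ?thesis by simp
qed

lemma level_excess_le:
  "max 0 (- (real j * slab + s)) \<le> \<bar>s\<bar> * (if real j * slab < \<bar>s\<bar> then 1 else 0)"
proof -
  have "0 \<le> real j * slab" using slab_pos by simp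
  thus ?thesis by (cases "real j * slab < \<bar>s\<bar>") auto
qed

text \<open>
  For a single jump of length r the sum of (j+1) (r - j b)^+ over j is of order r^3, so the weight
  j + 1 costs exactly a third moment.
\<close>
lemma summable_overshoot: "summable (\<lambda>j. real (Suc j) * overshoot (real j * slab))"
proof (rule summableI_nonneg_bounded)
  fix N
  have pt: "(\<Sum>j<N. real (Suc j) * max 0 (- (real j * slab + s)))
      \<le> \<bar>s\<bar> ^ 3 / slab\<^sup>2 + 2 * s\<^sup>2 / slab + \<bar>s\<bar>" for s
  proof -
    have "(\<Sum>j<N. real (Suc j) * max 0 (- (real j * slab + s)))
       \<le> (\<Sum>j<N. (\<bar>s\<bar> / slab + 1) * \<bar>s\<bar> * (if real j * slab < \<bar>s\<bar> then 1 else 0))"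
    proof (intro sum_mono)
      fix j
      show "real (Suc j) * max 0 (- (real j * slab + s)) \<le> (\<bar>s\<bar> / slab + 1) * \<bar>s\<bar> * (if real j * slab < \<bar>s\<bar> then 1 else 0)"
      proof (cases "real j * slab < \<bar>s\<bar>")
        case True
        hence "real (Suc j) \<le> \<bar>s\<bar> / slab + 1" using slab_pos by (simp add: field_simps)
        thus ?thesis using level_excess_le[of j s] True slab_pos by (auto intro!: mult_mono)
      next
        case False
        thus ?thesis using level_excess_le[of j s] by (auto simp: mult_nonneg_nonpos)
      qed
    qed
    also have "\<dots> = (\<bar>s\<bar> / slab + 1) * \<bar>s\<bar> * (\<Sum>j<N. if real j * slab < \<bar>s\<bar> then 1 else 0)"
      by (simp only: sum_distrib_left)
    also have "\<dots> \<le> (\<bar>s\<bar> / slab + 1) * \<bar>s\<bar> * (\<bar>s\<bar> / slab + 1)"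
      using slab_pos by (intro mult_left_mono count_levels) auto
    also have "\<dots> = \<bar>s\<bar> ^ 3 / slab\<^sup>2 + 2 * \<bar>s\<bar>\<^sup>2 / slab + \<bar>s\<bar>"
      using slab_pos by (simp add: field_simps power2_eq_square power3_eq_cube)
    finally show ?thesis by simp
  qed
  have "(\<Sum>j<N. real (Suc j) * overshoot (real j * slab))
      = (\<integral>s. (\<Sum>j<N. real (Suc j) * max 0 (- (real j * slab + s))) \<partial>\<mu>)"
    unfolding overshoot_def using integrable_overshoot by (simp add: Bochner_Integration.integral_sum)
  also have "\<dots> \<le> (\<integral>s. \<bar>s\<bar> ^ 3 / slab\<^sup>2 + 2 * s\<^sup>2 / slab + \<bar>s\<bar> \<partial>\<mu>)"
    using third_moment integrable_square integrable_abs_step integrable_overshoot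
    by (intro integral_mono pt) auto
  finally show "(\<Sum>j<N. real (Suc j) * overshoot (real j * slab))
     \<le> (\<integral>s. \<bar>s\<bar> ^ 3 / slab\<^sup>2 + 2 * s\<^sup>2 / slab + \<bar>s\<bar> \<partial>\<mu>)" .
qed (simp add: overshoot_nonneg)

lemma summable_overshoot2: "summable (\<lambda>j. overshoot2 (real j * slab))"
proof (rule summableI_nonneg_bounded)
  fix N
  have pt: "(\<Sum>j<N. (max 0 (- (real j * slab + s)))\<^sup>2) \<le> \<bar>s\<bar> ^ 3 / slab + s\<^sup>2" for s
  proof -
    have "(\<Sum>j<N. (max 0 (- (real j * slab + s)))\<^sup>2)
       \<le> (\<Sum>j<N. \<bar>s\<bar>\<^sup>2 * (if real j * slab < \<bar>s\<bar> then 1 else 0))"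
    proof (intro sum_mono)
      fix j
      have "(max 0 (- (real j * slab + s)))\<^sup>2 \<le> (\<bar>s\<bar> * (if real j * slab < \<bar>s\<bar> then 1 else 0))\<^sup>2"
        by (intro power_mono level_excess_le) simp
      also have "\<dots> = \<bar>s\<bar>\<^sup>2 * (if real j * slab < \<bar>s\<bar> then 1 else 0)" by simp
      finally show "(max 0 (- (real j * slab + s)))\<^sup>2 \<le> \<bar>s\<bar>\<^sup>2 * (if real j * slab < \<bar>s\<bar> then 1 else 0)" .
    qed
    also have "\<dots> = \<bar>s\<bar>\<^sup>2 * (\<Sum>j<N. if real j * slab < \<bar>s\<bar> then 1 else 0)"
      by (simp only: sum_distrib_left)
    also have "\<dots> \<le> \<bar>s\<bar>\<^sup>2 * (\<bar>s\<bar> / slab + 1)"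
      by (intro mult_left_mono count_levels) auto
    also have "\<dots> = \<bar>s\<bar> ^ 3 / slab + \<bar>s\<bar>\<^sup>2"
      using slab_pos by (simp add: field_simps power2_eq_square power3_eq_cube)
    finally show ?thesis by simp
  qed
  have "(\<Sum>j<N. overshoot2 (real j * slab))
      = (\<integral>s. (\<Sum>j<N. (max 0 (- (real j * slab + s)))\<^sup>2) \<partial>\<mu>)"
    unfolding overshoot2_def using integrable_overshoot2 by (simp add: Bochner_Integration.integral_sum)
  also have "\<dots> \<le> (\<integral>s. \<bar>s\<bar> ^ 3 / slab + s\<^sup>2 \<partial>\<mu>)"
    using third_moment integrable_square integrable_overshoot2
    by (intro integral_mono pt) auto
  finally show "(\<Sum>j<N. overshoot2 (real j * slab)) \<le> (\<integral>s. \<bar>s\<bar> ^ 3 / slab + s\<^sup>2 \<partial>\<mu>)" .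
qed (simp add: overshoot2_nonneg)

lemma overshoot_le_weighted: "overshoot y \<le> real (Suc j) * overshoot y"
  using mult_right_mono[of 1 "real (Suc j)" "overshoot y"] overshoot_nonneg by simp

lemma overshoot_level_tendsto: "(\<lambda>N. overshoot (real N * slab)) \<longlonglongrightarrow> 0"
proof (rule tendsto_sandwich[OF _ _ tendsto_const summable_LIMSEQ_zero[OF summable_overshoot]])
  show "\<forall>\<^sub>F N in sequentially. overshoot (real N * slab) \<le> real (Suc N) * overshoot (real N * slab)"
    by (intro always_eventually allI overshoot_le_weighted)
qed (simp add: overshoot_nonneg)

lemma exists_small_level:
  assumes "w \<longlonglongrightarrow> (0::real)"
  obtains N where "J \<le> N" "w N * real n \<le> 1"
proof -
  have "(\<lambda>N. w N * real n) \<longlonglongrightarrow> 0 * real n" by (intro tendsto_intros assms)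
  hence "\<forall>\<^sub>F N in sequentially. w N * real n < 1" by (intro order_tendstoD(2)) auto
  then obtain N0 where "\<And>N. N0 \<le> N \<Longrightarrow> w N * real n < 1" by (auto simp: eventually_sequentially)
  thus ?thesis by (intro that[of "max J N0"]) (auto intro: less_imp_le)
qed

text \<open>
  The mean overshoot R is a sum over slabs of the one-step overshoot from there, weighted by the
  number of visits, and that number is bounded in terms of the height of the slab and of R again.
  Beyond a high level J the coefficient of R is at most one half, so R can be absorbed; below it
  the visits are bounded by \<open>potential_lower_levels\<close>. Since R is finite for each n,
  the absorption is legitimate.
\<close>
theorem mean_overshoot_bounded:
  obtains C where "0 \<le> C" "\<And>n x. 0 \<le> x \<Longrightarrow> potential n overshoot x \<le> C"
proof -
  define S where "S = (\<Sum>j. real (Suc j) * overshoot (real j * slab))"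
  have S0: "0 \<le> S" unfolding S_def by (intro suminf_nonneg summable_overshoot) (simp add: overshoot_nonneg)
  \<comment> \<open>the level above which the overshoot is absorbed into the left-hand side\<close>
  obtain J where J: "\<And>m n. J \<le> m \<Longrightarrow> norm (\<Sum>j=m..<n. real (Suc j) * overshoot (real j * slab)) < slab / 2"
    using summable_overshoot slab_pos unfolding summable_Cauchy by (meson half_gt_zero)
  obtain D where D: "0 \<le> D" "\<And>n x. 0 \<le> x \<Longrightarrow> potential n (indicator {0..<real J * slab}) x \<le> D"
    using potential_lower_levels by blast
  have "potential n overshoot x \<le> 2 * (overshoot 0 * D + S + 1)" if x: "0 \<le> x" for n x
  proof -
    define R where "R = potential n overshoot x"
    have R0: "0 \<le> R" unfolding R_def by (intro potential_nonneg x) (auto simp: overshoot_nonneg)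
    obtain N where N: "J \<le> N" "overshoot (real N * slab) * real n \<le> 1"
      using exists_small_level[OF overshoot_level_tendsto] .
    have "R \<le> overshoot 0 * potential n (indicator {0..<real J * slab}) x
      + (\<Sum>j=J..<N. overshoot (real j * slab) / slab * (min x (real (Suc j) * slab) + R))
      + overshoot (real N * slab) * real n"
      unfolding R_def by (intro potential_antimono_le x N overshoot_nonneg overshoot_antimono) auto
    also have "(\<Sum>j=J..<N. overshoot (real j * slab) / slab * (min x (real (Suc j) * slab) + R))
        \<le> (\<Sum>j=J..<N. overshoot (real j * slab) / slab * (real (Suc j) * slab + R))"
      using slab_pos by (intro sum_mono mult_left_mono) (auto simp: overshoot_nonneg)
    also have "\<dots> = (\<Sum>j=J..<N. real (Suc j) * overshoot (real j * slab))
        + (\<Sum>j=J..<N. overshoot (real j * slab)) / slab * R"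
    proof -
      have "overshoot (real j * slab) / slab * (real (Suc j) * slab + R)
          = real (Suc j) * overshoot (real j * slab) + overshoot (real j * slab) / slab * R" for j
        using slab_pos by (simp add: field_simps)
      thus ?thesis by (simp only: sum.distrib sum_distrib_right sum_divide_distrib)
    qed
    also have "(\<Sum>j=J..<N. real (Suc j) * overshoot (real j * slab)) \<le> S"
      unfolding S_def by (intro sum_le_suminf summable_overshoot) (auto simp: overshoot_nonneg)
    also have "(\<Sum>j=J..<N. overshoot (real j * slab)) / slab * R \<le> 1 / 2 * R"
    proof (intro mult_right_mono R0)
      have "(\<Sum>j=J..<N. overshoot (real j * slab)) \<le> (\<Sum>j=J..<N. real (Suc j) * overshoot (real j * slab))"
        by (intro sum_mono overshoot_le_weighted)
      also have "\<dots> \<le> slab / 2" using J[of J N] by simp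
      finally show "(\<Sum>j=J..<N. overshoot (real j * slab)) / slab \<le> 1 / 2"
        using slab_pos by (simp add: field_simps)
    qed
    also have "overshoot 0 * potential n (indicator {0..<real J * slab}) x \<le> overshoot 0 * D"
      by (intro mult_left_mono D x overshoot_nonneg)
    finally show ?thesis using N(2) unfolding R_def[symmetric] by (simp add: field_simps)
  qed
  thus ?thesis using D(1) S0 overshoot_nonneg by (intro that[of "2 * (overshoot 0 * D + S + 1)"]) auto
qed

text \<open>
  A bound uniform in x would call for a fourth moment. With three moments the visit counts O(1 +
  x), without the factor j of the slab, still give linear growth in x, which suffices for the
  relative errors below.
\<close>
theorem potential_overshoot2_bounded:
  obtains C where "0 \<le> C" "\<And>n x. 0 \<le> x \<Longrightarrow> potential n overshoot2 x \<le> C * (1 + x)"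
proof -
  define S where "S = (\<Sum>j. overshoot2 (real j * slab))"
  have S0: "0 \<le> S" unfolding S_def by (intro suminf_nonneg summable_overshoot2) (simp add: overshoot2_nonneg)
  obtain K where K: "0 \<le> K" "\<And>n x. 0 \<le> x \<Longrightarrow> potential n overshoot x \<le> K"
    using mean_overshoot_bounded by blast
  have "potential n overshoot2 x \<le> (S / slab * (1 + K) + 1) * (1 + x)" if x: "0 \<le> x" for n x
  proof -
    obtain N where N: "0 \<le> N" "overshoot2 (real N * slab) * real n \<le> 1"
      using exists_small_level[OF summable_LIMSEQ_zero[OF summable_overshoot2]] .
    have "potential n overshoot2 x
        \<le> (\<Sum>j<N. overshoot2 (real j * slab)) / slab * (x + K) + overshoot2 (real N * slab) * real n"
      by (intro potential_antimono_linear adm_overshoot2 overshoot2_nonneg overshoot2_antimono K x)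
    also have "(\<Sum>j<N. overshoot2 (real j * slab)) / slab * (x + K) \<le> S / slab * (x + K)"
      unfolding S_def using slab_pos K x
      by (intro mult_right_mono divide_right_mono sum_le_suminf summable_overshoot2) (auto simp: overshoot2_nonneg)
    also have "\<dots> \<le> S / slab * ((1 + K) * (1 + x))"
      using S0 slab_pos K x by (intro mult_left_mono) (auto simp: algebra_simps)
    finally have "potential n overshoot2 x \<le> S / slab * (1 + K) * (1 + x) + 1" using N(2) by simp
    moreover have "(S / slab * (1 + K) + 1) * (1 + x) = S / slab * (1 + K) * (1 + x) + (1 + x)"
      by (rule distrib_right[where c="1 + x" and b=1, simplified mult_1])
    ultimately show ?thesis using x by linarith
  qed
  thus ?thesis using S0 slab_pos K by (intro that[of "S / slab * (1 + K) + 1"]) auto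
qed

text \<open>
  Write 1 as (1 - y/A)^+ plus min(y, A)/A. The first part decreases and is supported below A, so
  it is summed over the slabs and gives O(A (1 + x)) in total. The second part has mean at most (x
  + K) / A at each time, because the mean of the surviving position is at most x + K. With A =
  sqrt n both contributions are O((1 + x) sqrt n), and the monotonicity of p_k turns the bound on
  the sum into a bound on p_n.
\<close>
theorem surv_bound:
  obtains C where "0 \<le> C" "\<And>n x. 0 \<le> x \<Longrightarrow> (\<Sum>k<n. surv k x) \<le> C * (1 + x) * sqrt (real n)"
    "\<And>n x. 0 \<le> x \<Longrightarrow> surv n x \<le> C * (1 + x) / sqrt (real (Suc n))"
proof -
  obtain K where K: "0 \<le> K" "\<And>n x. 0 \<le> x \<Longrightarrow> potential n overshoot x \<le> K"
    using mean_overshoot_bounded by blast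
  define C where "C = (1 / slab\<^sup>2 + 1 / slab + 1) * (1 + K)"
  have C0: "0 \<le> C" using K slab_pos by (simp add: C_def)
  have sum: "(\<Sum>k<n. surv k x) \<le> C * (1 + x) * sqrt (real n)" if x: "0 \<le> x" for n x
  proof (cases "n = 0")
    case False
    define A where "A = sqrt (real n)"
    have A: "1 \<le> A" "A * A = real n" using False by (auto simp: A_def)
    define w where "w y = max 0 (1 - y / A)" for y
    define M where "M = nat \<lceil>A / slab\<rceil>"
    have M: "A / slab \<le> real M" "real M \<le> A / slab + A"
      using A slab_pos by (auto simp: M_def of_nat_nat intro: order_trans[of _ "A / slab + 1"])
    have w: "adm w" "\<And>y. 0 \<le> w y" "\<And>y z. y \<le> z \<Longrightarrow> w z \<le> w y"
    proof -
      show "adm w" unfolding w_def[abs_def] by (rule admI[where B=1]) (use A in auto)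
      show "w z \<le> w y" if "y \<le> z" for y z
        using divide_right_mono[OF that, of A] A by (auto simp: w_def)
    qed (simp add: w_def)
    have wM: "w (real M * slab) = 0" using M(1) A slab_pos by (simp add: w_def field_simps)
    have w1: "w y \<le> 1" if "0 \<le> y" for y using that A by (simp add: w_def)
    have excess: "evolve k (\<lambda>y. min y A) x \<le> x + K" for k
    proof -
      have "0 \<le> slab * potential k (indicator {A - slab..A}) x"
        using slab_pos x by (intro mult_nonneg_nonneg potential_nonneg adm_indicator) auto
      moreover have "min x A \<le> x" by simp
      ultimately show ?thesis
        using potential_slab[OF x, of A k] K(2)[OF x, of k] A by linarith
    qed
    have "(\<Sum>k<n. surv k x) = potential n (\<lambda>_. 1) x" by (simp add: potential_const)
    also have "\<dots> \<le> potential n (\<lambda>y. w y + min y A / A) x"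
    proof (intro potential_mono x adm_add w adm_divide adm_min adm_const)
      fix y :: real assume "0 \<le> y"
      thus "1 \<le> w y + min y A / A" using A by (cases "y \<le> A") (auto simp: w_def)
    qed
    also have "\<dots> = potential n w x + potential n (\<lambda>y. min y A) x / A"
      using potential_cmult[of n "1 / A" "\<lambda>y. min y A" x]
      by (subst potential_add) (auto simp: w(1) adm_min adm_divide)
    also have "\<dots> \<le> (A / slab + A) / slab * (x + K) + A * (x + K)"
    proof (intro add_mono)
      have "potential n w x \<le> (\<Sum>j<M. w (real j * slab)) / slab * (x + K)"
        using potential_antimono_linear[OF w K(2) x, of n M] wM by simp
      also have "(\<Sum>j<M. w (real j * slab)) \<le> A / slab + A"
        using sum_bounded_above[of "{..<M}" "\<lambda>j. w (real j * slab)" 1] w1 slab_pos M(2) by simp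
      hence "(\<Sum>j<M. w (real j * slab)) / slab * (x + K) \<le> (A / slab + A) / slab * (x + K)"
        using slab_pos x K(1) by (intro mult_right_mono divide_right_mono) auto
      finally show "potential n w x \<le> (A / slab + A) / slab * (x + K)" .
      have "potential n (\<lambda>y. min y A) x \<le> real n * (x + K)"
        unfolding potential_def
        using sum_bounded_above[of "{..<n}" "\<lambda>k. evolve k (\<lambda>y. min y A) x" "x + K"] excess by simp
      hence "potential n (\<lambda>y. min y A) x / A \<le> real n * (x + K) / A"
        using A by (intro divide_right_mono) auto
      thus "potential n (\<lambda>y. min y A) x / A \<le> A * (x + K)" using A(1) by (simp add: A(2)[symmetric])
    qed
    also have "\<dots> = (1 / slab\<^sup>2 + 1 / slab + 1) * (x + K) * A"
      using slab_pos by (simp add: field_simps power2_eq_square)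
    also have "\<dots> \<le> (1 / slab\<^sup>2 + 1 / slab + 1) * ((1 + K) * (1 + x)) * A"
      using slab_pos K x A by (intro mult_right_mono mult_left_mono) (auto simp: algebra_simps)
    finally show ?thesis by (simp add: C_def A_def mult_ac)
  qed simp
  have "surv n x \<le> C * (1 + x) / sqrt (real (Suc n))" if x: "0 \<le> x" for n x
  proof -
    have "real (Suc n) * surv n x = (\<Sum>k<Suc n. surv n x)" by simp
    also have "\<dots> \<le> (\<Sum>k<Suc n. surv k x)" using x by (intro sum_mono surv_antimono) auto
    also have "\<dots> \<le> C * (1 + x) * sqrt (real (Suc n))" by (rule sum[OF x])
    finally have "surv n x \<le> C * (1 + x) * (sqrt (real (Suc n)) / real (Suc n))"
      by (simp add: field_simps)
    also have "sqrt (real (Suc n)) / real (Suc n) = 1 / sqrt (real (Suc n))"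
      by (simp add: field_simps del: of_nat_Suc)
    finally show ?thesis by simp
  qed
  thus ?thesis using C0 sum by (intro that[of C]) auto
qed

end

section \<open>Comparison with the heat flow\<close>

lemma normal_H_lipschitz: "\<bar>normal_H a - normal_H b\<bar> \<le> \<bar>a - b\<bar>"
proof -
  have *: "normal_H v - normal_H u \<le> v - u" if uv: "u < v" for u v
  proof -
    obtain w where w: "normal_H v - normal_H u = (v - u) * (H_slope * exp (- (w^2) / 2))"
      using normal_H_mvt[OF uv] by metis
    have "H_slope * exp (- (w^2) / 2) \<le> 1 * 1"
      using H_slope_pos H_slope_le_1 by (intro mult_mono) auto
    thus ?thesis unfolding w using uv by (simp add: mult_left_le)
  qed
  show ?thesis
    using *[of a b] *[of b a] normal_H_mono[of a b] normal_H_mono[of b a]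
    by (cases a b rule: linorder_cases) auto
qed

lemma inverse_three_halves_le:
  assumes "1 \<le> u"
  shows "1 / (u * sqrt u) \<le> 4 / sqrt u - 4 / sqrt (u + 1)"
proof -
  define p where "p = sqrt u"
  define q where "q = sqrt (u + 1)"
  have p: "1 \<le> p" "p * p = u" using assms by (auto simp: p_def)
  have q: "0 < q" "q * q = u + 1" using assms by (auto simp: q_def)
  have "q\<^sup>2 \<le> (3 / 2 * p)\<^sup>2"
    using p(2) q(2) assms by (simp add: power2_eq_square)
  hence "q \<le> 3 / 2 * p" by (rule power2_le_imp_le) (use p(1) in simp)
  hence "q * (p + q) \<le> (3 / 2 * p) * (p + 3 / 2 * p)"
    using p(1) q(1) by (intro mult_mono) auto
  also have "\<dots> \<le> 4 * (p * p)" using p(1) by simp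
  finally have le: "q * (p + q) \<le> 4 * (p * p)" .
  have "(q - p) * (q + p) = 1" using p q by (simp add: algebra_simps)
  hence diff: "q - p = 1 / (p + q)" using p q by (simp add: field_simps)
  have "1 / (p * p * p) = 4 / (p * (4 * (p * p)))" using p(1) by simp
  also have "\<dots> \<le> 4 / (p * (q * (p + q)))"
    using le p(1) q(1) by (intro divide_left_mono mult_left_mono mult_pos_pos) auto
  also have "\<dots> = 4 * (q - p) / (p * q)" unfolding diff by (simp add: mult_ac)
  also have "\<dots> = 4 / p - 4 / q" using p(1) q(1) by (simp add: field_simps)
  finally have "1 / (p * p * p) \<le> 4 / p - 4 / q" .
  thus ?thesis using p by (simp add: p_def q_def)
qed

lemma sum_inverse_three_halves:
  assumes "1 \<le> T"
  shows "(\<Sum>k<m. 1 / ((T + real k) * sqrt (T + real k))) \<le> 4 / sqrt T"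
proof -
  have "(\<Sum>k<m. 1 / ((T + real k) * sqrt (T + real k)))
      \<le> (\<Sum>k<m. 4 / sqrt (T + real k) - 4 / sqrt (T + real (Suc k)))"
    using assms inverse_three_halves_le[of "T + real k" for k]
    by (intro sum_mono) (auto simp: add_ac)
  also have "\<dots> = 4 / sqrt T - 4 / sqrt (T + real m)"
    using sum_lessThan_telescope'[of "\<lambda>k. 4 / sqrt (T + real k)" m] by simp
  also have "\<dots> \<le> 4 / sqrt T" using assms by simp
  finally show ?thesis .
qed

lemma half_sqrt_le:
  assumes "r / 4 \<le> t"
  shows "sqrt r / 2 \<le> sqrt t"
proof -
  have "sqrt (r / 4) \<le> sqrt t" using assms by (intro real_sqrt_le_mono) simp
  thus ?thesis by (simp add: real_sqrt_divide)
qed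

context step_law
begin

definition heat :: "real \<Rightarrow> real \<Rightarrow> real" where
  "heat t y = normal_H (y / (\<sigma> * sqrt t))"

lemma heat_measurable [measurable]: "heat t \<in> borel_measurable borel"
  unfolding heat_def[abs_def] by measurable

lemma abs_heat_le_1: "\<bar>heat t y\<bar> \<le> 1"
  by (simp add: heat_def abs_normal_H_le_1)

lemma heat_le_1: "heat t y \<le> 1"
  by (simp add: heat_def normal_H_le_1)

lemma adm_heat [intro, simp]: "adm (heat t)"
  by (rule admI[where B=1]) (auto simp: abs_heat_le_1)

text \<open>
  The value picked up at an exit, with the sign changed: G_t is odd, so at the negative point
  reached by the walk it equals minus H of the rescaled overshoot.
\<close>
definition defect :: "real \<Rightarrow> real \<Rightarrow> real" where
  "defect t y = (\<integral>s. normal_H (max 0 (- (y + s)) / (\<sigma> * sqrt t)) \<partial>\<mu>)"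

lemma integrable_bounded_normal_H:
  assumes [measurable]: "g \<in> borel_measurable borel"
  shows "integrable \<mu> (\<lambda>s. normal_H (g s))"
  by (rule integrable_const_bound[where B=1]) (auto simp: abs_normal_H_le_1)

lemma defect_measurable [measurable]: "defect t \<in> borel_measurable borel"
  unfolding defect_def[abs_def] by measurable

lemma killed_heat: "killed (heat t) y = (\<integral>s. heat t (y + s) \<partial>\<mu>) + defect t y"
proof -
  have "killed (heat t) y = (\<integral>s. heat t (y + s) + normal_H (max 0 (- (y + s)) / (\<sigma> * sqrt t)) \<partial>\<mu>)"
    unfolding killed_def
  proof (rule Bochner_Integration.integral_cong)
    fix s
    have "(- (y + s)) / (\<sigma> * sqrt t) = - ((y + s) / (\<sigma> * sqrt t))"
      by (rule minus_divide_left[symmetric])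
    thus "indicator {0..} (y + s) * heat t (y + s)
      = heat t (y + s) + normal_H (max 0 (- (y + s)) / (\<sigma> * sqrt t))"
      by (auto simp: heat_def indicator_def max_def normal_H_minus simp del: minus_add_distrib)
  qed simp
  thus ?thesis
    unfolding defect_def heat_def by (simp add: integrable_bounded_normal_H)
qed

lemma defect_nonneg: "0 < t \<Longrightarrow> 0 \<le> defect t y"
  unfolding defect_def using sigma_pos
  by (intro integral_nonneg_AE) (auto intro!: normal_H_nonneg)

lemma defect_le:
  assumes t: "0 < t"
  shows "defect t y \<le> H_slope / (\<sigma> * sqrt t) * overshoot y"
proof -
  have "defect t y \<le> (\<integral>s. H_slope / (\<sigma> * sqrt t) * max 0 (- (y + s)) \<partial>\<mu>)"
    unfolding defect_def
    by (intro integral_mono integrable_bounded_normal_H integrable_mult_right integrable_overshoot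
        order_trans[OF normal_H_upper]) (use t sigma_pos in auto)
  thus ?thesis by (simp add: overshoot_def)
qed

text \<open>
  The overshoot is small on the scale sqrt t, and H is linear near the origin up to a quadratic
  error.
\<close>
lemma defect_linear:
  assumes t: "0 < t"
  shows "\<bar>defect t y - H_slope / (\<sigma> * sqrt t) * overshoot y\<bar> \<le> overshoot2 y / (\<sigma>\<^sup>2 * t)"
proof -
  define h where "h s = max 0 (- (y + s)) / (\<sigma> * sqrt t)" for s
  have [measurable]: "h \<in> borel_measurable borel" unfolding h_def[abs_def] by measurable
  have h: "integrable \<mu> h" unfolding h_def[abs_def] by (intro integrable_divide integrable_overshoot)
  have h2: "(h s)\<^sup>2 = (max 0 (- (y + s)))\<^sup>2 / (\<sigma>\<^sup>2 * t)" for s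
    using t by (simp add: h_def power_divide power_mult_distrib)
  have ih2: "integrable \<mu> (\<lambda>s. (h s)\<^sup>2)"
    unfolding h2 by (intro integrable_divide integrable_overshoot2)
  have "defect t y = (\<integral>s. normal_H (h s) \<partial>\<mu>)"
    by (simp only: defect_def h_def)
  moreover have "H_slope / (\<sigma> * sqrt t) * overshoot y = (\<integral>s. H_slope * h s \<partial>\<mu>)"
    by (simp add: overshoot_def h_def)
  ultimately have eq: "defect t y - H_slope / (\<sigma> * sqrt t) * overshoot y = (\<integral>s. normal_H (h s) - H_slope * h s \<partial>\<mu>)"
    using h by (simp add: integrable_bounded_normal_H)
  have "\<bar>defect t y - H_slope / (\<sigma> * sqrt t) * overshoot y\<bar> \<le> (\<integral>s. \<bar>normal_H (h s) - H_slope * h s\<bar> \<partial>\<mu>)"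
    unfolding eq by (rule integral_abs_bound)
  also have "\<dots> \<le> (\<integral>s. (h s)\<^sup>2 \<partial>\<mu>)"
    using h normal_H_linear ih2
    by (intro integral_mono integrable_abs Bochner_Integration.integrable_diff integrable_bounded_normal_H integrable_mult_right)
       auto
  finally show ?thesis unfolding h2 by (simp add: overshoot2_def)
qed

definition lindeberg :: real where
  "lindeberg = (\<integral>s. \<bar>s\<bar> ^ 3 \<partial>\<mu>) / \<sigma> ^ 3 + 37"

lemma lindeberg_nonneg: "0 \<le> lindeberg"
  unfolding lindeberg_def using sigma_pos
  by (intro add_nonneg_nonneg divide_nonneg_nonneg integral_nonneg_AE) auto

text \<open>
  The Taylor expansion of order two in space is averaged over a step: the first moment vanishes
  and the second gives -\<theta> z exp (-z^2/2)/(2t), the same as the first-order change over one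
  unit of time.
\<close>
lemma heat_lindeberg:
  assumes t: "1 \<le> t"
  shows "\<bar>heat (t + 1) y - (\<integral>s. heat t (y + s) \<partial>\<mu>)\<bar> \<le> lindeberg / (t * sqrt t)"
proof -
  define c where "c = \<sigma> * sqrt t"
  have c: "0 < c" "c\<^sup>2 = \<sigma>\<^sup>2 * t" "c ^ 3 = \<sigma> ^ 3 * (t * sqrt t)"
    using t sigma_pos by (auto simp: c_def power_mult_distrib power3_eq_cube)
  define z where "z = y / c"
  define e where "e = exp (- (z^2) / 2)"
  define p where "p s = s / c" for s
  have taylor: "\<bar>heat t (y + s) - normal_H z - H_slope * e * p s + H_slope * z * e / 2 * (p s)\<^sup>2\<bar>
      \<le> \<bar>s\<bar> ^ 3 / c ^ 3" for s
    using normal_H_third_order[of z "s / c"] c(1)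
    by (simp add: heat_def c_def[symmetric] z_def e_def p_def add_divide_distrib power_divide power_abs)
  have ih: "integrable \<mu> (\<lambda>s. heat t (y + s))"
    unfolding heat_def by (intro integrable_bounded_normal_H) measurable
  have i2: "integrable \<mu> (\<lambda>s. (p s)\<^sup>2)" using integrable_square by (simp add: p_def power_divide)
  have i1: "integrable \<mu> p" using integrable_step by (simp add: p_def[abs_def])
  have m1: "(\<integral>s. p s \<partial>\<mu>) = 0" using mean_zero by (simp add: p_def)
  have m2: "(\<integral>s. (p s)\<^sup>2 \<partial>\<mu>) = 1 / t"
    using second_moment sigma_pos by (simp add: p_def power_divide c)
  have eq: "(\<integral>s. heat t (y + s) \<partial>\<mu>) - normal_H z + H_slope * z * e / (2 * t)
      = (\<integral>s. heat t (y + s) - normal_H z - H_slope * e * p s + H_slope * z * e / 2 * (p s)\<^sup>2 \<partial>\<mu>)"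
    using ih i1 i2 m1 m2 prob_space by simp
  have "\<bar>(\<integral>s. heat t (y + s) \<partial>\<mu>) - normal_H z + H_slope * z * e / (2 * t)\<bar>
      \<le> (\<integral>s. \<bar>heat t (y + s) - normal_H z - H_slope * e * p s + H_slope * z * e / 2 * (p s)\<^sup>2\<bar> \<partial>\<mu>)"
    unfolding eq by (rule integral_abs_bound)
  also have "\<dots> \<le> (\<integral>s. \<bar>s\<bar> ^ 3 / c ^ 3 \<partial>\<mu>)"
    by (intro integral_mono taylor) (use ih i1 i2 third_moment in auto)
  finally have space: "\<bar>(\<integral>s. heat t (y + s) \<partial>\<mu>) - normal_H z + H_slope * z * e / (2 * t)\<bar>
      \<le> (\<integral>s. \<bar>s\<bar> ^ 3 \<partial>\<mu>) / c ^ 3" by simp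
  have "y / (\<sigma> * sqrt (t + 1)) = z * sqrt (t / (t + 1))"
    using t sigma_pos by (simp add: z_def c_def real_sqrt_divide)
  hence "\<bar>heat (t + 1) y - normal_H z + H_slope * z * e / (2 * t)\<bar> \<le> 37 / t\<^sup>2"
    using normal_H_time_step[OF t, of z] by (simp add: heat_def e_def)
  also have "37 / t\<^sup>2 \<le> 37 / (t * sqrt t)"
    using t by (intro divide_left_mono) (auto simp: power2_eq_square real_le_lsqrt intro!: mult_left_mono)
  finally have "\<bar>heat (t + 1) y - (\<integral>s. heat t (y + s) \<partial>\<mu>)\<bar>
     \<le> 37 / (t * sqrt t) + (\<integral>s. \<bar>s\<bar> ^ 3 \<partial>\<mu>) / c ^ 3" using space by linarith
  also have "\<dots> = lindeberg / (t * sqrt t)"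
    using sigma_pos t by (simp add: lindeberg_def c add_divide_distrib)
  finally show ?thesis .
qed

text \<open>
  The walk without killing. It dominates the killed walk on non-negative functions and commutes
  with translations, which makes concentration bounds accessible.
\<close>
definition free :: "(real \<Rightarrow> real) \<Rightarrow> real \<Rightarrow> real" where
  "free f x = (\<integral>s. f (x + s) \<partial>\<mu>)"

lemma free_measurable [measurable]:
  assumes [measurable]: "f \<in> borel_measurable borel"
  shows "free f \<in> borel_measurable borel"
  unfolding free_def[abs_def] by measurable

lemma integrable_bounded_shift:
  fixes f :: "real \<Rightarrow> real"
  assumes [measurable]: "f \<in> borel_measurable borel" and "\<And>y. \<bar>f y\<bar> \<le> B"
  shows "integrable \<mu> (\<lambda>s. f (x + s))"
  by (rule integrable_const_bound[where B=B]) (auto simp: assms)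

lemma free_bound:
  fixes f :: "real \<Rightarrow> real"
  assumes [measurable]: "f \<in> borel_measurable borel" and "\<And>y. \<bar>f y\<bar> \<le> B"
  shows "\<bar>free f x\<bar> \<le> B"
proof -
  have "\<bar>free f x\<bar> \<le> (\<integral>s. \<bar>f (x + s)\<bar> \<partial>\<mu>)" unfolding free_def by (rule integral_abs_bound)
  also have "\<dots> \<le> (\<integral>s. B \<partial>\<mu>)"
    by (intro integral_mono integrable_abs integrable_bounded_shift[where B=B] integrable_const assms)
  finally show ?thesis using prob_space by simp
qed

lemma free_iterate_measurable: "f \<in> borel_measurable borel \<Longrightarrow> (free ^^ m) f \<in> borel_measurable borel"
  by (induction m) auto

lemma free_iterate_bound:
  "f \<in> borel_measurable borel \<Longrightarrow> (\<And>y. \<bar>f y\<bar> \<le> B) \<Longrightarrow> \<bar>(free ^^ m) f x\<bar> \<le> B"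
  by (induction m arbitrary: x) (auto intro!: free_bound free_iterate_measurable)

lemma free_shift: "(free ^^ m) (\<lambda>y. f (y + c)) x = (free ^^ m) f (x + c)"
  by (induction m arbitrary: x) (auto simp: free_def add_ac)

lemma free_iterate_diff:
  assumes "f \<in> borel_measurable borel" "g \<in> borel_measurable borel"
    and "\<And>y. \<bar>f y\<bar> \<le> B" "\<And>y. \<bar>g y\<bar> \<le> B"
  shows "(free ^^ m) (\<lambda>y. c * (f y - g y)) x = c * ((free ^^ m) f x - (free ^^ m) g x)"
proof (induction m arbitrary: x)
  case (Suc m)
  define F where "F = (free ^^ m) f"
  define G where "G = (free ^^ m) g"
  have "integrable \<mu> (\<lambda>s. F (x + s))" "integrable \<mu> (\<lambda>s. G (x + s))"
    unfolding F_def G_def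
    by (intro integrable_bounded_shift[where B=B] free_iterate_measurable free_iterate_bound assms)+
  moreover have "(free ^^ m) (\<lambda>y. c * (f y - g y)) = (\<lambda>x. c * (F x - G x))"
    using Suc by (auto simp: F_def G_def)
  ultimately show ?case by (simp add: F_def[symmetric] G_def[symmetric]) (simp add: free_def)
qed simp

lemma evolve_le_free:
  assumes f: "f \<in> borel_measurable borel" "\<And>y. \<bar>f y\<bar> \<le> B" "\<And>y. 0 \<le> f y"
  shows "evolve m f x \<le> (free ^^ m) f x"
proof (induction m arbitrary: x)
  case (Suc m)
  have adm: "adm f" using f by (intro admI[where B=B])
  have nn: "0 \<le> (free ^^ m) f y" for y
    by (induction m arbitrary: y) (auto simp: f free_def[of "(free ^^ _) f"] intro!: integral_nonneg_AE)
  have "killed (evolve m f) x \<le> free ((free ^^ m) f) x"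
    unfolding killed_def free_def[of "(free ^^ m) f"]
  proof (intro integral_mono integrable_killed adm_evolve adm integrable_bounded_shift[where B=B]
      free_iterate_measurable free_iterate_bound f)
    fix s
    show "indicator {0..} (x + s) * evolve m f (x + s) \<le> (free ^^ m) f (x + s)"
      using Suc[of "x + s"] nn[of "x + s"] by (auto simp: indicator_def)
  qed
  thus ?case by (simp add: evolve_Suc)
qed simp

text \<open>
  The errors of the single steps add up, and the sum of t^(-3/2) from T on is of order T^(-1/2).
\<close>
lemma free_heat:
  assumes T: "1 \<le> T"
  shows "\<bar>(free ^^ m) (heat T) x - heat (T + real m) x\<bar> \<le> 4 * lindeberg / sqrt T"
proof -
  have "\<bar>(free ^^ m) (heat T) x - heat (T + real m) x\<bar>
      \<le> (\<Sum>k<m. lindeberg * (1 / ((T + real k) * sqrt (T + real k))))"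
  proof (induction m arbitrary: x)
    case (Suc m)
    define E where "E = (\<Sum>k<m. lindeberg * (1 / ((T + real k) * sqrt (T + real k))))"
    have i1: "integrable \<mu> (\<lambda>s. (free ^^ m) (heat T) (x + s))"
      by (intro integrable_bounded_shift[where B=1] free_iterate_measurable free_iterate_bound)
         (auto simp: abs_heat_le_1)
    have i2: "integrable \<mu> (\<lambda>s. heat (T + real m) (x + s))"
      by (intro integrable_bounded_shift[where B=1]) (auto simp: abs_heat_le_1)
    have "\<bar>(free ^^ Suc m) (heat T) x - free (heat (T + real m)) x\<bar>
        = \<bar>\<integral>s. (free ^^ m) (heat T) (x + s) - heat (T + real m) (x + s) \<partial>\<mu>\<bar>"
      using i1 i2 by (simp add: free_def)
    also have "\<dots> \<le> (\<integral>s. \<bar>(free ^^ m) (heat T) (x + s) - heat (T + real m) (x + s)\<bar> \<partial>\<mu>)"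
      by (rule integral_abs_bound)
    also have "\<dots> \<le> (\<integral>s. E \<partial>\<mu>)"
      by (intro integral_mono integrable_abs Bochner_Integration.integrable_diff i1 i2)
         (use Suc in \<open>auto simp: E_def\<close>)
    finally have "\<bar>(free ^^ Suc m) (heat T) x - free (heat (T + real m)) x\<bar> \<le> E"
      using prob_space by simp
    moreover have "\<bar>heat (T + real m + 1) x - free (heat (T + real m)) x\<bar>
        \<le> lindeberg / ((T + real m) * sqrt (T + real m))"
      unfolding free_def using T by (intro heat_lindeberg) simp
    ultimately show ?case by (simp add: E_def add_ac)
  qed simp
  also have "\<dots> = lindeberg * (\<Sum>k<m. 1 / ((T + real k) * sqrt (T + real k)))"
    by (simp only: sum_distrib_left)
  also have "\<dots> \<le> lindeberg * (4 / sqrt T)"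
    by (intro mult_left_mono sum_inverse_three_halves T lindeberg_nonneg)
  also have "lindeberg * (4 / sqrt T) = 4 * lindeberg / sqrt T" by simp
  finally show ?thesis .
qed

text \<open>
  A concentration bound at scale sqrt T. The function 1 - G_T is dominated on the half-line by a
  multiple of the increment G_T(y + a) - G_T(y - a) with a = \<sigma> sqrt T. After m free steps
  this becomes an increment of the flatter profile G_(T+m), of size sqrt (T/(T+m)), up to the
  error O(T^(-1/2)) of \<open>free_heat\<close>.
\<close>
theorem evolve_heat_tail:
  obtains C where "0 \<le> C"
    "\<And>T m x. 1 \<le> T \<Longrightarrow> 0 \<le> x \<Longrightarrow>
       evolve m (\<lambda>y. 1 - heat T y) x \<le> C * (1 / sqrt T + sqrt T / sqrt (T + real m))"
proof -
  obtain D where D: "0 \<le> D"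
    "\<And>z. 0 \<le> z \<Longrightarrow> 1 - normal_H z \<le> D * (normal_H (z + 1) - normal_H (z - 1))"
    using normal_H_tail by blast
  have "evolve m (\<lambda>y. 1 - heat T y) x \<le> D * (8 * lindeberg + 2) * (1 / sqrt T + sqrt T / sqrt (T + real m))"
    if T: "1 \<le> T" and x: "0 \<le> x" for T m x
  proof -
    \<comment> \<open>a shift by one unit in the argument of H\<close>
    define a where "a = \<sigma> * sqrt T"
    have a: "0 < a" using T sigma_pos by (simp add: a_def)
    define f where "f y = D * (heat T (y + a) - heat T (y + - a))" for y
    have [measurable]: "f \<in> borel_measurable borel" unfolding f_def[abs_def] by measurable
    have fb: "\<bar>f y\<bar> \<le> D * 2" for y
      using abs_heat_le_1[of T "y + a"] abs_heat_le_1[of T "y - a"] D(1)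
      by (auto simp: f_def abs_mult intro!: mult_left_mono)
    have f0: "0 \<le> f y" for y
      unfolding f_def heat_def using a T sigma_pos D(1)
      by (intro mult_nonneg_nonneg) (auto intro!: normal_H_mono divide_right_mono)
    have "evolve m (\<lambda>y. 1 - heat T y) x \<le> evolve m f x"
    proof (intro evolve_mono x)
      show "adm f" by (rule admI[where B="D * 2"]) (auto simp: fb)
      show "adm (\<lambda>y. 1 - heat T y)" by (intro adm_diff adm_const adm_heat)
      fix y :: real assume "0 \<le> y"
      thus "1 - heat T y \<le> f y"
        using D(2)[of "y / a"] a
        by (simp add: f_def heat_def a_def[symmetric] add_divide_distrib diff_divide_distrib)
    qed
    also have "\<dots> \<le> (free ^^ m) f x" by (intro evolve_le_free[where B="D * 2"] fb f0) auto
    also have "\<dots> = D * ((free ^^ m) (heat T) (x + a) - (free ^^ m) (heat T) (x + - a))"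
      unfolding f_def[abs_def]
      by (subst free_iterate_diff[where B=1]) (auto simp: abs_heat_le_1 free_shift simp del: add_uminus_conv_diff)
    also have "\<dots> \<le> D * (8 * lindeberg / sqrt T + 2 * (sqrt T / sqrt (T + real m)))"
    proof (intro mult_left_mono D(1))
      have "heat (T + real m) (x + a) - heat (T + real m) (x + - a) \<le> \<bar>(x + a) / (\<sigma> * sqrt (T + real m)) - (x + - a) / (\<sigma> * sqrt (T + real m))\<bar>"
        unfolding heat_def using normal_H_lipschitz abs_le_D1 by blast
      also have "\<dots> = 2 * a / (\<sigma> * sqrt (T + real m))"
        using a T sigma_pos by (simp add: diff_divide_distrib[symmetric])
      also have "\<dots> = 2 * (sqrt T / sqrt (T + real m))" using sigma_pos by (simp add: a_def)
      finally show "(free ^^ m) (heat T) (x + a) - (free ^^ m) (heat T) (x + - a)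
          \<le> 8 * lindeberg / sqrt T + 2 * (sqrt T / sqrt (T + real m))"
        using free_heat[OF T, of m "x + a"] free_heat[OF T, of m "x + - a"]
        by (simp add: abs_le_iff)
    qed
    also have "\<dots> \<le> D * ((8 * lindeberg + 2) * (1 / sqrt T + sqrt T / sqrt (T + real m)))"
    proof (intro mult_left_mono D(1))
      define u where "u = 1 / sqrt T"
      define v where "v = sqrt T / sqrt (T + real m)"
      have "0 \<le> u" "0 \<le> v" using T by (auto simp: u_def v_def)
      hence "0 \<le> 2 * u" "0 \<le> 8 * lindeberg * v" using lindeberg_nonneg by auto
      hence "8 * lindeberg * u + 2 * v \<le> (8 * lindeberg + 2) * (u + v)" by (simp add: algebra_simps)
      thus "8 * lindeberg / sqrt T + 2 * (sqrt T / sqrt (T + real m))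
        \<le> (8 * lindeberg + 2) * (1 / sqrt T + sqrt T / sqrt (T + real m))" by (simp add: u_def v_def)
    qed
    finally show ?thesis by (simp add: mult_ac)
  qed
  thus ?thesis using D(1) lindeberg_nonneg by (intro that[of "D * (8 * lindeberg + 2)"]) auto
qed

definition residual :: "real \<Rightarrow> real \<Rightarrow> real" where
  "residual t y = heat (t + 1) y - killed (heat t) y"

lemma adm_residual [intro, simp]: "adm (residual t)"
  unfolding residual_def[abs_def] by auto

lemma residual_defect: "1 \<le> t \<Longrightarrow> \<bar>residual t y + defect t y\<bar> \<le> lindeberg / (t * sqrt t)"
  using heat_lindeberg[of t y] by (simp add: residual_def killed_heat)

text \<open>
  The heat profile is followed along the killed walk while its own time runs backwards from T + n
  to T.
\<close>
lemma heat_telescope: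
  assumes "j \<le> n"
  shows "heat (T + real n) x = evolve j (heat (T + real (n - j))) x + (\<Sum>k<j. evolve k (residual (T + real (n - Suc k))) x)"
  using assms
proof (induction j)
  case (Suc j)
  have "residual (T + real (n - Suc j)) = (\<lambda>y. heat (T + real (n - j)) y - killed (heat (T + real (n - Suc j))) y)"
    using Suc.prems by (simp add: residual_def[abs_def] of_nat_diff add_ac algebra_simps)
  hence "evolve j (residual (T + real (n - Suc j))) x
      = evolve j (heat (T + real (n - j))) x - evolve (Suc j) (heat (T + real (n - Suc j))) x"
    by (simp add: evolve_diff adm_killed evolve_Suc')
  thus ?case using Suc by simp
qed simp

end

section \<open>Gaussian approximation for non-negative starting points\<close>

context step_law
begin

text \<open>
  The order of the survival probability, and the scale against which all errors are measured.
\<close>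
definition weight :: "nat \<Rightarrow> real \<Rightarrow> real" where
  "weight n x = min 1 ((1 + x) / sqrt (real n))"

lemma weight_nonneg: "0 \<le> x \<Longrightarrow> 0 \<le> weight n x"
  by (simp add: weight_def)

lemma min_le_weight:
  assumes n: "1 \<le> n" and x: "0 \<le> x"
  shows "min 1 (x / (\<sigma> * sqrt (real n))) \<le> (1 + 1 / \<sigma>) * weight n x"
proof -
  define a where "a = sqrt (real n)"
  have a: "0 < a" using n by (simp add: a_def)
  have "x / (\<sigma> * a) = 1 / \<sigma> * (x / a)" by simp
  also have "\<dots> \<le> (1 + 1 / \<sigma>) * ((1 + x) / a)"
    using x a sigma_pos by (intro mult_mono divide_right_mono) auto
  finally have "min 1 (x / (\<sigma> * a)) \<le> (1 + 1 / \<sigma>) * ((1 + x) / a)" by linarith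
  moreover have "min 1 (x / (\<sigma> * a)) \<le> 1" "1 \<le> (1 + 1 / \<sigma>) * 1" using sigma_pos by simp_all
  hence "min 1 (x / (\<sigma> * a)) \<le> (1 + 1 / \<sigma>) * 1" by linarith
  ultimately show ?thesis
    unfolding weight_def a_def[symmetric] by (simp only: min_def[of 1 "(1 + x) / a"] simp_thms split: if_split)
qed

text \<open>
  Halving the time changes the bound on the survival probability only by a constant. The errors
  made in the second half of the time interval therefore inherit the factor \<open>weight\<close>.
\<close>
lemma surv_half_le_weight:
  obtains C where "0 \<le> C" "\<And>n x. 1 \<le> n \<Longrightarrow> 0 \<le> x \<Longrightarrow> surv (n div 2) x \<le> C * weight n x"
proof -
  obtain D where D: "0 \<le> D" "\<And>n x. 0 \<le> x \<Longrightarrow> surv n x \<le> D * (1 + x) / sqrt (real (Suc n))"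
    using surv_bound by metis
  have "surv (n div 2) x \<le> (1 + 2 * D) * weight n x" if n: "1 \<le> n" and x: "0 \<le> x" for n x
  proof -
    define a where "a = sqrt (real n)"
    have a: "0 < a" using n by (simp add: a_def)
    have half: "a / 2 \<le> sqrt (real (Suc (n div 2)))" unfolding a_def by (rule half_sqrt_le) linarith
    have "surv (n div 2) x \<le> D * (1 + x) / sqrt (real (Suc (n div 2)))" by (rule D(2)[OF x])
    also have "\<dots> \<le> D * (1 + x) / (a / 2)"
      using half a D(1) x by (intro divide_left_mono) auto
    also have "\<dots> = 2 * D * ((1 + x) / a)" by simp
    also have "\<dots> \<le> (1 + 2 * D) * ((1 + x) / a)"
      using a x by (intro mult_right_mono) auto
    finally have "surv (n div 2) x \<le> (1 + 2 * D) * ((1 + x) / a)" .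
    moreover have "surv (n div 2) x \<le> (1 + 2 * D) * 1" using surv_le_1[of "n div 2" x] D(1) by simp
    ultimately show ?thesis by (simp add: weight_def a_def min_def)
  qed
  thus ?thesis using D(1) by (intro that[of "1 + 2 * D"]) auto
qed

lemma evolve_overshoot_tail:
  assumes K: "\<And>n x. 0 \<le> x \<Longrightarrow> potential n overshoot x \<le> K" and x: "0 \<le> x" and "i \<le> m"
  shows "(\<Sum>k=i..<m. evolve k overshoot x) \<le> K * surv i x"
proof -
  have "(\<Sum>k=i..<m. evolve k overshoot x) = evolve i (potential (m - i) overshoot) x"
    using \<open>i \<le> m\<close> by (simp add: evolve_potential)
  also have "\<dots> \<le> evolve i (\<lambda>_. K) x"
    by (intro evolve_mono adm_potential adm_overshoot adm_const K x)
  finally show ?thesis by (simp add: evolve_const)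
qed

text \<open>
  The mean of the exit time times the overshoot. Written as a double sum, the inner sum is the
  overshoot still to come after time i, which is at most K on the event of survival up to i.
\<close>
lemma sum_index_overshoot:
  assumes K: "\<And>n x. 0 \<le> x \<Longrightarrow> potential n overshoot x \<le> K" and x: "0 \<le> x"
  shows "(\<Sum>k<m. real (Suc k) * evolve k overshoot x) \<le> K * (\<Sum>i<m. surv i x)"
proof -
  have "(\<Sum>k<m. real (Suc k) * evolve k overshoot x)
      = (\<Sum>k<m. \<Sum>i<m. if i \<le> k then evolve k overshoot x else 0)"
  proof (intro sum.cong refl)
    fix k assume "k \<in> {..<m}"
    hence "{..<m} \<inter> {i. i \<le> k} = {..k}" by auto
    thus "real (Suc k) * evolve k overshoot x = (\<Sum>i<m. if i \<le> k then evolve k overshoot x else 0)"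
      by (simp add: sum.If_cases)
  qed
  also have "\<dots> = (\<Sum>i<m. \<Sum>k<m. if i \<le> k then evolve k overshoot x else 0)"
    by (rule sum.swap)
  also have "\<dots> = (\<Sum>i<m. \<Sum>k=i..<m. evolve k overshoot x)"
  proof (rule sum.cong[OF refl])
    fix i
    have "{..<m} \<inter> {k. i \<le> k} = {i..<m}" by auto
    thus "(\<Sum>k<m. if i \<le> k then evolve k overshoot x else 0) = (\<Sum>k=i..<m. evolve k overshoot x)"
      by (simp add: sum.If_cases)
  qed
  also have "\<dots> \<le> (\<Sum>i<m. K * surv i x)"
    by (intro sum_mono evolve_overshoot_tail K x) auto
  finally show ?thesis by (simp add: sum_distrib_left)
qed

text \<open>
  In the first half of the time interval the remaining time t is comparable with n. The first
  bound replaces 1/sqrt t by 1/sqrt n at a cost proportional to the elapsed time; the second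
  simply uses that both are of order 1/sqrt n. The first is better for small x, the second for x
  above sqrt n.
\<close>
lemma residual_pointwise:
  assumes n: "1 \<le> n" and k: "k < n div 2"
  defines "a \<equiv> sqrt (real n)" and "t \<equiv> sqrt (real n) + real (n - Suc k)"
  shows "\<bar>residual t y + H_slope / (\<sigma> * a) * overshoot y\<bar>
      \<le> 4 * lindeberg / (real n * a) + 2 / (\<sigma>\<^sup>2 * real n) * overshoot2 y
         + 2 / (\<sigma> * (real n * a)) * (a + real (Suc k)) * overshoot y" (is ?A)
    and "\<bar>residual t y + H_slope / (\<sigma> * a) * overshoot y\<bar>
      \<le> 4 * lindeberg / (real n * a) + 2 / (\<sigma> * a) * overshoot y" (is ?B)
proof -
  define s where "s = sqrt t"
  have a: "1 \<le> a" "a * a = real n" using n by (auto simp: a_def)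
  have "real n / 2 \<le> real (n - Suc k)" using k by linarith
  hence t: "real n / 2 \<le> t" "1 \<le> t" "real n / 4 \<le> t" using a(1) unfolding t_def a_def by linarith+
  have s: "a / 2 \<le> s" unfolding a_def s_def by (rule half_sqrt_le[OF t(3)])
  have s2: "s * s = t" "0 < s" using t by (auto simp: s_def)
  have "real n / 2 * (a / 2) \<le> t * s" using t s a by (intro mult_mono) auto
  hence "lindeberg / (t * s) \<le> lindeberg / (real n / 2 * (a / 2))"
    using lindeberg_nonneg a n t s2 by (intro divide_left_mono) auto
  hence lind: "lindeberg / (t * s) \<le> 4 * lindeberg / (real n * a)" by (simp add: mult.commute)
  have res: "\<bar>residual t y + defect t y\<bar> \<le> 4 * lindeberg / (real n * a)"
    using residual_defect[OF t(2), of y] lind by (simp add: s_def)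
  have def1: "\<bar>defect t y - H_slope / (\<sigma> * s) * overshoot y\<bar> \<le> 2 / (\<sigma>\<^sup>2 * real n) * overshoot2 y"
  proof -
    have "\<bar>defect t y - H_slope / (\<sigma> * s) * overshoot y\<bar> \<le> overshoot2 y / (\<sigma>\<^sup>2 * t)"
      unfolding s_def using t by (intro defect_linear) simp
    also have "\<dots> \<le> overshoot2 y / (\<sigma>\<^sup>2 * (real n / 2))"
      using t n sigma_pos overshoot2_nonneg by (intro divide_left_mono mult_left_mono) auto
    also have "\<dots> = 2 / (\<sigma>\<^sup>2 * real n) * overshoot2 y" by simp
    finally show ?thesis .
  qed
  have "\<bar>1 / s - 1 / a\<bar> \<le> 2 * (a + real (Suc k)) / (real n * a)"
  proof -
    have "1 / s - 1 / a = (a - s) / (s * a)" using a s2 by (simp add: field_simps)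
    also have "a - s = (a * a - s * s) / (a + s)" using a s2 by (simp add: field_simps)
    also have "a * a - s * s = real (Suc k) - a"
      using k unfolding s2 a(2) t_def a_def by (simp add: of_nat_diff)
    finally have "\<bar>1 / s - 1 / a\<bar> = \<bar>real (Suc k) - a\<bar> / ((a + s) * (s * a))"
      using a s2 by (simp add: abs_mult)
    also have "\<dots> \<le> (a + real (Suc k)) / (a * (a / 2 * a))"
      using a(1) s s2(2) by (intro frac_le mult_mono) auto
    also have "\<dots> = 2 * (a + real (Suc k)) / (a * a * a)"
      by (simp add: mult_ac del: of_nat_Suc distrib_left_numeral)
    finally show ?thesis unfolding a(2) .
  qed
  hence "H_slope / \<sigma> * overshoot y * \<bar>1 / s - 1 / a\<bar> \<le> 1 / \<sigma> * overshoot y * (2 * (a + real (Suc k)) / (real n * a))"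
    using H_slope_pos H_slope_le_1 sigma_pos overshoot_nonneg
    by (intro mult_mono divide_right_mono mult_right_mono) auto
  moreover have "H_slope / (\<sigma> * s) * overshoot y - H_slope / (\<sigma> * a) * overshoot y
      = H_slope / \<sigma> * overshoot y * (1 / s - 1 / a)"
    by (simp add: right_diff_distrib)
  hence "\<bar>H_slope / (\<sigma> * s) * overshoot y - H_slope / (\<sigma> * a) * overshoot y\<bar>
      = H_slope / \<sigma> * overshoot y * \<bar>1 / s - 1 / a\<bar>"
    using H_slope_pos sigma_pos overshoot_nonneg[of y] by (simp only: abs_mult) (simp add: abs_mult)
  ultimately have def2: "\<bar>H_slope / (\<sigma> * s) * overshoot y - H_slope / (\<sigma> * a) * overshoot y\<bar>
      \<le> 2 / (\<sigma> * (real n * a)) * (a + real (Suc k)) * overshoot y"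
    by (simp add: mult_ac)
  show ?A using res def1 def2 by linarith
  have "0 < t" using t by simp
  hence d0: "0 \<le> defect t y" "defect t y \<le> H_slope / (\<sigma> * s) * overshoot y"
    unfolding s_def by (rule defect_nonneg, rule defect_le)
  have "H_slope / (\<sigma> * s) * overshoot y \<le> 1 / (\<sigma> * (a / 2)) * overshoot y"
    using H_slope_pos H_slope_le_1 sigma_pos overshoot_nonneg[of y] a s s2
    by (intro mult_right_mono frac_le mult_left_mono) auto
  moreover have "H_slope / (\<sigma> * a) * overshoot y \<le> 2 / (\<sigma> * a) * overshoot y"
    using H_slope_le_1 sigma_pos overshoot_nonneg[of y] a
    by (intro mult_right_mono divide_right_mono) auto
  moreover have "0 \<le> H_slope / (\<sigma> * a) * overshoot y"
    using H_slope_pos sigma_pos overshoot_nonneg[of y] a by simp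
  ultimately have "\<bar>- defect t y + H_slope / (\<sigma> * a) * overshoot y\<bar> \<le> 2 / (\<sigma> * a) * overshoot y"
    using d0 by simp
  thus ?B using res by linarith
qed

lemma sum_evolve_affine_le:
  assumes g: "\<And>k. adm (g k)" and x: "0 \<le> x"
    and le: "\<And>k y. k \<in> I \<Longrightarrow> 0 \<le> y \<Longrightarrow> \<bar>g k y\<bar> \<le> p k + q * overshoot2 y + r k * overshoot y"
  shows "\<bar>\<Sum>k\<in>I. evolve k (g k) x\<bar>
    \<le> (\<Sum>k\<in>I. p k * surv k x) + q * (\<Sum>k\<in>I. evolve k overshoot2 x) + (\<Sum>k\<in>I. r k * evolve k overshoot x)"
proof -
  have "\<bar>\<Sum>k\<in>I. evolve k (g k) x\<bar> \<le> (\<Sum>k\<in>I. \<bar>evolve k (g k) x\<bar>)" by (rule sum_abs)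
  also have "\<dots> \<le> (\<Sum>k\<in>I. evolve k (\<lambda>y. p k + q * overshoot2 y + r k * overshoot y) x)"
    by (intro sum_mono evolve_abs_le g x le adm_add adm_cmult adm_const adm_overshoot adm_overshoot2)
  also have "\<dots> = (\<Sum>k\<in>I. p k * surv k x + q * evolve k overshoot2 x + r k * evolve k overshoot x)"
  proof (rule sum.cong[OF refl])
    fix k
    show "evolve k (\<lambda>y. p k + q * overshoot2 y + r k * overshoot y) x
        = p k * surv k x + q * evolve k overshoot2 x + r k * evolve k overshoot x"
      by (subst evolve_add, (intro adm_add adm_cmult adm_const adm_overshoot adm_overshoot2)+,
          subst evolve_add, (intro adm_add adm_cmult adm_const adm_overshoot adm_overshoot2)+)
         (simp only: evolve_cmult evolve_const)
  qed
  finally show ?thesis by (simp only: sum.distrib sum_distrib_left)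
qed

text \<open>
  The exits in the first half of the time interval produce the correction \<theta> / (\<sigma>
  sqrt n) times the overshoot. The error is O((1 + x)/n) by the first part of
  \<open>residual_pointwise\<close> and O(1/sqrt n) by the second, and the minimum of the two is
  the weight divided by sqrt n.
\<close>
lemma early_residuals:
  obtains C where "0 \<le> C"
    "\<And>n x. 1 \<le> n \<Longrightarrow> 0 \<le> x \<Longrightarrow>
      \<bar>(\<Sum>k<n div 2. evolve k (residual (sqrt (real n) + real (n - Suc k))) x)
        + H_slope / (\<sigma> * sqrt (real n)) * potential (n div 2) overshoot x\<bar>
      \<le> C / sqrt (real n) * weight n x"
proof -
  obtain K where K: "0 \<le> K" "\<And>n x. 0 \<le> x \<Longrightarrow> potential n overshoot x \<le> K"
    using mean_overshoot_bounded by blast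
  obtain K2 where K2: "0 \<le> K2" "\<And>n x. 0 \<le> x \<Longrightarrow> potential n overshoot2 x \<le> K2 * (1 + x)"
    using potential_overshoot2_bounded by blast
  obtain S where S: "0 \<le> S" "\<And>n x. 0 \<le> x \<Longrightarrow> (\<Sum>k<n. surv k x) \<le> S * (1 + x) * sqrt (real n)"
    using surv_bound by metis
  define C where "C = 4 * lindeberg * S + 4 * lindeberg + 2 / \<sigma>\<^sup>2 * K2 + 2 / \<sigma> * (K + K * S)"
  have C0: "0 \<le> C" unfolding C_def using lindeberg_nonneg S(1) K(1) K2(1) sigma_pos by simp
  have "\<bar>(\<Sum>k<n div 2. evolve k (residual (sqrt (real n) + real (n - Suc k))) x)
        + H_slope / (\<sigma> * sqrt (real n)) * potential (n div 2) overshoot x\<bar> \<le> C / sqrt (real n) * weight n x"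
    if n: "1 \<le> n" and x: "0 \<le> x" for n x
  proof -
    define a where "a = sqrt (real n)"
    define m where "m = n div 2"
    define g where "g k y = residual (a + real (n - Suc k)) y + H_slope / (\<sigma> * a) * overshoot y" for k y
    define c1 where "c1 = 4 * lindeberg / (real n * a)"
    define c2 where "c2 = 2 / (\<sigma>\<^sup>2 * real n)"
    define c3 where "c3 = 2 / (\<sigma> * (real n * a))"
    define c4 where "c4 = 2 / (\<sigma> * a)"
    have a: "1 \<le> a" "a * a = real n" using n by (auto simp: a_def)
    have c: "0 \<le> c1" "0 \<le> c2" "0 \<le> c3" "0 \<le> c4"
      unfolding c1_def c2_def c3_def c4_def using lindeberg_nonneg a sigma_pos by auto
    have admg: "adm (g k)" for k unfolding g_def[abs_def] by (intro adm_add adm_cmult adm_residual adm_overshoot)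
    have lhs: "(\<Sum>k<m. evolve k (residual (a + real (n - Suc k))) x) + H_slope / (\<sigma> * a) * potential m overshoot x
        = (\<Sum>k<m. evolve k (g k) x)"
    proof -
      have "evolve k (g k) x = evolve k (residual (a + real (n - Suc k))) x + H_slope / (\<sigma> * a) * evolve k overshoot x" for k
        unfolding g_def[abs_def]
        by (subst evolve_add, (intro adm_cmult adm_residual adm_overshoot)+) (simp only: evolve_cmult)
      thus ?thesis by (simp only: potential_def sum.distrib sum_distrib_left)
    qed
    have survm: "(\<Sum>k<m. surv k x) \<le> S * (1 + x) * a"
    proof -
      have "sqrt (real m) \<le> a" unfolding a_def m_def by (intro real_sqrt_le_mono) simp
      hence "S * (1 + x) * sqrt (real m) \<le> S * (1 + x) * a" using S(1) x by (intro mult_left_mono) auto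
      thus ?thesis using S(2)[OF x, of m] by linarith
    qed
    have "\<bar>\<Sum>k<m. evolve k (g k) x\<bar> \<le> (\<Sum>k<m. c1 * surv k x) + c2 * (\<Sum>k<m. evolve k overshoot2 x)
         + (\<Sum>k<m. c3 * (a + real (Suc k)) * evolve k overshoot x)"
    proof (rule sum_evolve_affine_le[OF admg x])
      fix k y assume "k \<in> {..<m}"
      thus "\<bar>g k y\<bar> \<le> c1 + c2 * overshoot2 y + c3 * (a + real (Suc k)) * overshoot y"
        using residual_pointwise(1)[OF n, of k y] unfolding g_def a_def m_def c1_def c2_def c3_def by simp
    qed
    also have "\<dots> = c1 * (\<Sum>k<m. surv k x) + c2 * potential m overshoot2 x
         + c3 * (a * potential m overshoot x + (\<Sum>k<m. real (Suc k) * evolve k overshoot x))"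
      unfolding potential_def
      by (simp add: sum.distrib sum_distrib_left distrib_left distrib_right mult.assoc del: of_nat_Suc)
    also have "\<dots> \<le> c1 * (S * (1 + x) * a) + c2 * (K2 * (1 + x))
         + c3 * (a * (K * (1 + x)) + K * (S * (1 + x) * a))"
    proof (intro add_mono mult_left_mono survm K2(2) x)
      have "potential m overshoot x \<le> K * 1" using K(2)[OF x, of m] by simp
      also have "\<dots> \<le> K * (1 + x)" using K(1) x by (intro mult_left_mono) auto
      finally show "potential m overshoot x \<le> K * (1 + x)" .
      have "(\<Sum>k<m. real (Suc k) * evolve k overshoot x) \<le> K * (\<Sum>i<m. surv i x)"
        by (intro sum_index_overshoot K x)
      also have "\<dots> \<le> K * (S * (1 + x) * a)" by (intro mult_left_mono survm K)
      finally show "(\<Sum>k<m. real (Suc k) * evolve k overshoot x) \<le> K * (S * (1 + x) * a)" .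
    qed (use c a in auto)
    also have "\<dots> = (4 * lindeberg * S + 2 / \<sigma>\<^sup>2 * K2 + 2 / \<sigma> * (K + K * S)) * ((1 + x) / real n)"
    proof -
      have r: "c3 * (a * (K * (1 + x)) + K * (S * (1 + x) * a)) = 2 / \<sigma> * (K + K * S) * ((1 + x) / real n)"
        unfolding c3_def using a n sigma_pos by (simp add: divide_simps) (simp add: algebra_simps)
      have r1: "c1 * (S * (1 + x) * a) = 4 * lindeberg * S * ((1 + x) / real n)"
        unfolding c1_def using a(1) by simp
      have r2: "c2 * (K2 * (1 + x)) = 2 / \<sigma>\<^sup>2 * K2 * ((1 + x) / real n)"
        by (simp add: c2_def)
      show ?thesis unfolding r r1 r2 by (simp only: distrib_right)
    qed
    also have "\<dots> \<le> C * ((1 + x) / real n)"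
      unfolding C_def using x lindeberg_nonneg by (intro mult_right_mono) auto
    also have "\<dots> = C / a * ((1 + x) / a)" using a by (simp add: a(2)[symmetric])
    finally have bound1: "\<bar>\<Sum>k<m. evolve k (g k) x\<bar> \<le> C / a * ((1 + x) / a)" .
    have "\<bar>\<Sum>k<m. evolve k (g k) x\<bar> \<le> (\<Sum>k<m. c1 * surv k x) + 0 * (\<Sum>k<m. evolve k overshoot2 x)
         + (\<Sum>k<m. c4 * evolve k overshoot x)"
    proof (rule sum_evolve_affine_le[OF admg x])
      fix k y assume "k \<in> {..<m}"
      thus "\<bar>g k y\<bar> \<le> c1 + 0 * overshoot2 y + c4 * overshoot y"
        using residual_pointwise(2)[OF n, of k y] unfolding g_def a_def m_def c1_def c4_def by simp
    qed
    also have "\<dots> = c1 * (\<Sum>k<m. surv k x) + c4 * potential m overshoot x"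
      unfolding potential_def by (simp add: sum_distrib_left)
    also have "\<dots> \<le> c1 * real n + c4 * K"
    proof (intro add_mono mult_left_mono K(2) x)
      have "(\<Sum>k<m. surv k x) \<le> (\<Sum>k<m. 1)" by (intro sum_mono surv_le_1)
      also have "\<dots> \<le> real n" by (simp add: m_def)
      finally show "(\<Sum>k<m. surv k x) \<le> real n" .
    qed (use c a in auto)
    also have "\<dots> = (4 * lindeberg + 2 / \<sigma> * K) / a"
      unfolding c1_def c4_def using a n sigma_pos by (simp add: add_divide_distrib)
    also have "\<dots> \<le> C / a"
      unfolding C_def using lindeberg_nonneg S(1) K(1) K2(1) sigma_pos a
      by (intro divide_right_mono) (auto simp: distrib_left)
    finally have "\<bar>\<Sum>k<m. evolve k (g k) x\<bar> \<le> C / a * 1" by simp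
    with bound1 have "\<bar>\<Sum>k<m. evolve k (g k) x\<bar> \<le> C / a * weight n x"
      by (simp add: weight_def a_def min_def)
    thus ?thesis using lhs unfolding a_def m_def by simp
  qed
  thus ?thesis using C0 by (intro that[of C]) auto
qed

text \<open>
  In the second half the remaining time may be as small as T = sqrt n, and the heat profile is
  steep. Both the step errors and the exits then cost T^(-1/2) = n^(-1/4) times the probability of
  surviving until then.
\<close>
lemma late_residuals:
  obtains C where "0 \<le> C"
    "\<And>n m x. 1 \<le> n \<Longrightarrow> 0 \<le> x \<Longrightarrow> m \<le> n \<Longrightarrow>
      \<bar>\<Sum>k=m..<n. evolve k (residual (sqrt (real n) + real (n - Suc k))) x\<bar>
      \<le> C / sqrt (sqrt (real n)) * surv m x"
proof -
  obtain K where K: "0 \<le> K" "\<And>n x. 0 \<le> x \<Longrightarrow> potential n overshoot x \<le> K"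
    using mean_overshoot_bounded by blast
  have "\<bar>\<Sum>k=m..<n. evolve k (residual (sqrt (real n) + real (n - Suc k))) x\<bar>
      \<le> (4 * lindeberg + K / \<sigma>) / sqrt (sqrt (real n)) * surv m x"
    if n: "1 \<le> n" and x: "0 \<le> x" and mn: "m \<le> n" for n m x
  proof -
    define T where "T = sqrt (real n)"
    define t where "t k = T + real (n - Suc k)" for k
    have T: "1 \<le> T" using n by (simp add: T_def)
    have t: "T \<le> t k" for k by (simp add: t_def)
    have t1: "1 \<le> t k" for k using T t[of k] by linarith
    have t0: "0 \<le> t k" for k using t1[of k] by linarith
    have s: "sqrt T \<le> sqrt (t k)" for k using t by (rule real_sqrt_le_mono)
    have "\<bar>\<Sum>k=m..<n. evolve k (residual (t k)) x\<bar> \<le> (\<Sum>k=m..<n. lindeberg / (t k * sqrt (t k)) * surv k x)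
        + 0 * (\<Sum>k=m..<n. evolve k overshoot2 x) + (\<Sum>k=m..<n. 1 / (\<sigma> * sqrt T) * evolve k overshoot x)"
    proof (rule sum_evolve_affine_le[OF adm_residual x])
      fix k y
      have "H_slope / (\<sigma> * sqrt (t k)) * overshoot y \<le> 1 / (\<sigma> * sqrt T) * overshoot y"
        using H_slope_pos H_slope_le_1 sigma_pos overshoot_nonneg[of y] T s
        by (intro mult_right_mono frac_le mult_left_mono) auto
      moreover have "0 < t k" using t1[of k] by simp
      hence "0 \<le> defect (t k) y" "defect (t k) y \<le> H_slope / (\<sigma> * sqrt (t k)) * overshoot y"
        by (rule defect_nonneg, rule defect_le)
      ultimately show "\<bar>residual (t k) y\<bar> \<le> lindeberg / (t k * sqrt (t k)) + 0 * overshoot2 y + 1 / (\<sigma> * sqrt T) * overshoot y"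
        using residual_defect[OF t1[of k], of y] by linarith
    qed
    also have "(\<Sum>k=m..<n. lindeberg / (t k * sqrt (t k)) * surv k x) \<le> (\<Sum>k=m..<n. lindeberg / (t k * sqrt (t k)) * surv m x)"
      using lindeberg_nonneg t0 x by (intro sum_mono mult_left_mono surv_antimono) auto
    finally have "\<bar>\<Sum>k=m..<n. evolve k (residual (t k)) x\<bar>
        \<le> lindeberg * surv m x * (\<Sum>k=m..<n. 1 / (t k * sqrt (t k))) + 1 / (\<sigma> * sqrt T) * (\<Sum>k=m..<n. evolve k overshoot x)"
      by (simp add: sum_distrib_left mult_ac)
    also have "\<dots> \<le> lindeberg * surv m x * (4 / sqrt T) + 1 / (\<sigma> * sqrt T) * (K * surv m x)"
    proof (intro add_mono mult_left_mono evolve_overshoot_tail K x mn mult_nonneg_nonneg lindeberg_nonneg surv_nonneg)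
      have "(\<Sum>k=m..<n. 1 / (t k * sqrt (t k))) \<le> (\<Sum>k<n. 1 / (t k * sqrt (t k)))"
        using t0 by (intro sum_mono2) auto
      also have "\<dots> = (\<Sum>k<n. 1 / ((T + real k) * sqrt (T + real k)))"
        unfolding t_def by (rule sum.nat_diff_reindex)
      also have "\<dots> \<le> 4 / sqrt T" by (rule sum_inverse_three_halves[OF T])
      finally show "(\<Sum>k=m..<n. 1 / (t k * sqrt (t k))) \<le> 4 / sqrt T" .
    qed (use sigma_pos T in auto)
    also have "\<dots> = (4 * lindeberg + K / \<sigma>) / sqrt T * surv m x"
      using T sigma_pos by (simp add: field_simps)
    finally show ?thesis by (simp add: t_def T_def)
  qed
  thus ?thesis using lindeberg_nonneg K(1) sigma_pos by (intro that[of "4 * lindeberg + K / \<sigma>"]) auto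
qed

definition mean_exit_overshoot :: "real \<Rightarrow> real" where
  "mean_exit_overshoot x = (\<Sum>k. evolve k overshoot x)"

lemma evolve_overshoot_nonneg: "0 \<le> x \<Longrightarrow> 0 \<le> evolve k overshoot x"
  by (intro evolve_nonneg adm_overshoot overshoot_nonneg)

lemma summable_evolve_overshoot:
  assumes "0 \<le> x"
  shows "summable (\<lambda>k. evolve k overshoot x)"
proof -
  obtain K where K: "0 \<le> K" "\<And>n x. 0 \<le> x \<Longrightarrow> potential n overshoot x \<le> K"
    using mean_overshoot_bounded by blast
  show ?thesis
    by (rule summableI_nonneg_bounded[where x=K])
       (use K(2)[OF assms] assms in \<open>auto simp: potential_def evolve_overshoot_nonneg\<close>)
qed

lemma mean_exit_overshoot_nonneg: "0 \<le> x \<Longrightarrow> 0 \<le> mean_exit_overshoot x"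
  unfolding mean_exit_overshoot_def by (intro suminf_nonneg summable_evolve_overshoot evolve_overshoot_nonneg)

text \<open>
  What is missing after time m is the overshoot of the walks that have survived until then.
\<close>
lemma mean_exit_overshoot_remainder:
  assumes K: "\<And>n x. 0 \<le> x \<Longrightarrow> potential n overshoot x \<le> K" and x: "0 \<le> x"
  shows "potential m overshoot x \<le> mean_exit_overshoot x"
    and "mean_exit_overshoot x - potential m overshoot x \<le> K * surv m x"
proof -
  show "potential m overshoot x \<le> mean_exit_overshoot x"
    unfolding potential_def mean_exit_overshoot_def using x
    by (intro sum_le_suminf summable_evolve_overshoot evolve_overshoot_nonneg) auto
  have "(\<lambda>n. potential n overshoot x) \<longlonglongrightarrow> mean_exit_overshoot x"
    unfolding potential_def mean_exit_overshoot_def using x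
    by (intro summable_LIMSEQ summable_evolve_overshoot)
  moreover have "potential n overshoot x \<le> potential m overshoot x + K * surv m x" if "m \<le> n" for n
  proof -
    have "potential n overshoot x = potential m overshoot x + (\<Sum>k=m..<n. evolve k overshoot x)"
      using that unfolding potential_def
      by (metis atLeast0LessThan le0 sum.atLeastLessThan_concat)
    thus ?thesis using evolve_overshoot_tail[OF K x that] by simp
  qed
  ultimately have "mean_exit_overshoot x \<le> potential m overshoot x + K * surv m x"
    by (intro LIMSEQ_le_const2 exI[of _ m]) auto
  thus "mean_exit_overshoot x - potential m overshoot x \<le> K * surv m x" by simp
qed

text \<open>
  The comparison starts from time n + sqrt n rather than n; the relative change of time is 1/sqrt
  n.
\<close>
lemma heat_time_shift:
  assumes n: "1 \<le> n" and x: "0 \<le> x"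
  shows "\<bar>heat (real n) x - heat (sqrt (real n) + real n) x\<bar> \<le> (1 + 1 / \<sigma>) / sqrt (real n) * weight n x"
proof -
  define a where "a = sqrt (real n)"
  have a: "1 \<le> a" "a * a = real n" using n by (auto simp: a_def)
  define r where "r = sqrt (a + real n)"
  have r: "a \<le> r" "r * r = a + real n" unfolding r_def a_def by (auto intro: real_sqrt_le_mono)
  define u where "u = x / (\<sigma> * a)"
  define v where "v = x / (\<sigma> * r)"
  have v0: "0 \<le> v" using x sigma_pos a r by (simp add: v_def)
  have vu: "v \<le> u" unfolding u_def v_def using x sigma_pos a r by (intro divide_left_mono mult_left_mono) auto
  have "r \<le> a * (1 + 1 / a)"
  proof -
    have "r\<^sup>2 \<le> (a + 1)\<^sup>2" using r a by (simp add: power2_eq_square algebra_simps)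
    hence "r \<le> a + 1" by (rule power2_le_imp_le) (use a in simp)
    thus ?thesis using a by (simp add: algebra_simps)
  qed
  hence "x / (\<sigma> * a) \<le> x / (\<sigma> * r) * (1 + 1 / a)"
    using mult_left_mono[of r "a * (1 + 1 / a)" "x / (\<sigma> * (a * r))"] a r x sigma_pos by (simp add: mult_ac)
  hence "\<bar>normal_H u - normal_H v\<bar> \<le> 1 / a * min 1 v"
    using v0 vu a unfolding u_def v_def by (intro normal_H_rescale) auto
  also have "\<dots> \<le> 1 / a * ((1 + 1 / \<sigma>) * weight n x)"
  proof (intro mult_left_mono)
    have "min 1 v \<le> min 1 u" using vu by auto
    also have "\<dots> \<le> (1 + 1 / \<sigma>) * weight n x" unfolding u_def a_def by (rule min_le_weight[OF n x])
    finally show "min 1 v \<le> (1 + 1 / \<sigma>) * weight n x" .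
  qed (use a in auto)
  finally show ?thesis by (simp add: u_def v_def heat_def a_def r_def)
qed

theorem surv_gaussian_approximation:
  obtains C where "0 \<le> C"
    "\<And>n x. 1 \<le> n \<Longrightarrow> 0 \<le> x \<Longrightarrow>
      \<bar>surv n x - (heat (real n) x + H_slope / (\<sigma> * sqrt (real n)) * mean_exit_overshoot x)\<bar>
      \<le> C / sqrt (sqrt (real n)) * weight n x"
proof -
  obtain K where K: "0 \<le> K" "\<And>n x. 0 \<le> x \<Longrightarrow> potential n overshoot x \<le> K"
    using mean_overshoot_bounded by blast
  obtain P where P: "0 \<le> P" "\<And>n x. 1 \<le> n \<Longrightarrow> 0 \<le> x \<Longrightarrow> surv (n div 2) x \<le> P * weight n x"
    using surv_half_le_weight by blast
  obtain E where E: "0 \<le> E" "\<And>n x. 1 \<le> n \<Longrightarrow> 0 \<le> x \<Longrightarrow>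
      \<bar>(\<Sum>k<n div 2. evolve k (residual (sqrt (real n) + real (n - Suc k))) x)
        + H_slope / (\<sigma> * sqrt (real n)) * potential (n div 2) overshoot x\<bar> \<le> E / sqrt (real n) * weight n x"
    using early_residuals by blast
  obtain L where L: "0 \<le> L" "\<And>n m x. 1 \<le> n \<Longrightarrow> 0 \<le> x \<Longrightarrow> m \<le> n \<Longrightarrow>
      \<bar>\<Sum>k=m..<n. evolve k (residual (sqrt (real n) + real (n - Suc k))) x\<bar> \<le> L / sqrt (sqrt (real n)) * surv m x"
    using late_residuals by blast
  obtain F where F: "0 \<le> F" "\<And>T m x. 1 \<le> T \<Longrightarrow> 0 \<le> x \<Longrightarrow>
       evolve m (\<lambda>y. 1 - heat T y) x \<le> F * (1 / sqrt T + sqrt T / sqrt (T + real m))"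
    using evolve_heat_tail by blast
  define C where "C = 3 * F * P + (1 + 1 / \<sigma>) + E + L * P + 1 / \<sigma> * K * P"
  have C0: "0 \<le> C" unfolding C_def using F(1) P(1) E(1) L(1) K(1) sigma_pos by simp
  have "\<bar>surv n x - (heat (real n) x + H_slope / (\<sigma> * sqrt (real n)) * mean_exit_overshoot x)\<bar>
      \<le> C / sqrt (sqrt (real n)) * weight n x" if n: "1 \<le> n" and x: "0 \<le> x" for n x
  proof -
    \<comment> \<open>T is the extra time in the comparison, so that the heat profile is never steeper than at time T\<close>
    define T where "T = sqrt (real n)"
    define q where "q = sqrt T"
    define m where "m = n div 2"
    define w where "w = weight n x"
    define r where "r k = evolve k (residual (T + real (n - Suc k))) x" for k
    have T: "1 \<le> T" "T * T = real n" using n by (auto simp: T_def)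
    have q: "1 \<le> q" "q * q = T" using T by (auto simp: q_def)
    have w0: "0 \<le> w" using x by (simp add: w_def weight_nonneg)
    have qT: "c / T * w \<le> c / q * w" if "0 \<le> c" for c
    proof -
      have "q * 1 \<le> q * q" using q by (intro mult_left_mono) auto
      thus ?thesis using that q T w0 by (intro mult_right_mono divide_left_mono) auto
    qed
    have survm: "surv m x \<le> P * w" using P(2)[OF n x] by (simp add: m_def w_def)
    have survm0: "0 \<le> surv m x" using x by (rule surv_nonneg)
    have tail: "evolve (n - m) (\<lambda>y. 1 - heat T y) y \<le> 3 * F / q" if "0 \<le> y" for y
    proof -
      have "real n / 4 \<le> T + real (n - m)" unfolding m_def using T by linarith
      hence h: "T / 2 \<le> sqrt (T + real (n - m))" unfolding T_def by (rule half_sqrt_le)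
      have "q / sqrt (T + real (n - m)) \<le> q / (T / 2)"
        using h q T by (intro divide_left_mono) auto
      also have "\<dots> = 2 / q" using q by (simp add: q(2)[symmetric])
      finally have "1 / q + q / sqrt (T + real (n - m)) \<le> 3 / q" by simp
      hence "F * (1 / q + q / sqrt (T + real (n - m))) \<le> F * (3 / q)" using F(1) by (intro mult_left_mono) auto
      thus ?thesis using F(2)[OF T(1) that, of "n - m"] by (simp add: q_def mult_ac)
    qed
    have adm1: "adm (\<lambda>y. 1 - heat T y)" by (intro adm_diff adm_const adm_heat)
    have A1: "0 \<le> evolve n (\<lambda>y. 1 - heat T y) x" "evolve n (\<lambda>y. 1 - heat T y) x \<le> 3 * F * P / q * w"
    proof -
      show "0 \<le> evolve n (\<lambda>y. 1 - heat T y) x"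
        using heat_le_1 by (intro evolve_nonneg adm1 x) simp
      have "evolve n (\<lambda>y. 1 - heat T y) x = evolve m (evolve (n - m) (\<lambda>y. 1 - heat T y)) x"
        by (simp add: evolve_add_time[symmetric] m_def)
      also have "\<dots> \<le> evolve m (\<lambda>_. 3 * F / q) x"
        by (intro evolve_mono adm_evolve adm1 adm_const tail x)
      also have "\<dots> = 3 * F / q * surv m x" by (rule evolve_const)
      also have "\<dots> \<le> 3 * F / q * (P * w)" using survm F(1) q by (intro mult_left_mono) auto
      finally show "evolve n (\<lambda>y. 1 - heat T y) x \<le> 3 * F * P / q * w" by (simp add: mult_ac)
    qed
    have A2: "\<bar>heat (real n) x - heat (T + real n) x\<bar> \<le> (1 + 1 / \<sigma>) / q * w"
      using heat_time_shift[OF n x] qT[of "1 + 1 / \<sigma>"] sigma_pos by (simp add: T_def w_def)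
    have A3: "\<bar>(\<Sum>k<m. r k) + H_slope / (\<sigma> * T) * potential m overshoot x\<bar> \<le> E / q * w"
      using E(2)[OF n x] qT[OF E(1)] by (simp add: T_def w_def r_def m_def)
    have A4: "\<bar>\<Sum>k=m..<n. r k\<bar> \<le> L * P / q * w"
    proof -
      have "\<bar>\<Sum>k=m..<n. r k\<bar> \<le> L / q * surv m x"
        using L(2)[OF n x, of m] by (simp add: r_def T_def q_def m_def)
      also have "\<dots> \<le> L / q * (P * w)" using survm L(1) q by (intro mult_left_mono) auto
      finally show ?thesis by (simp add: mult_ac)
    qed
    have A5: "0 \<le> H_slope / (\<sigma> * T) * (mean_exit_overshoot x - potential m overshoot x)"
      "H_slope / (\<sigma> * T) * (mean_exit_overshoot x - potential m overshoot x) \<le> 1 / \<sigma> * K * P / q * w"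
    proof -
      note rem = mean_exit_overshoot_remainder[OF K(2) x, of m]
      show "0 \<le> H_slope / (\<sigma> * T) * (mean_exit_overshoot x - potential m overshoot x)"
        using rem(1) H_slope_pos sigma_pos T by (intro mult_nonneg_nonneg) auto
      have "H_slope / (\<sigma> * T) * (mean_exit_overshoot x - potential m overshoot x) \<le> 1 / (\<sigma> * T) * (K * (P * w))"
        using rem H_slope_le_1 sigma_pos T mult_left_mono[OF survm K(1)]
        by (intro mult_mono divide_right_mono) auto
      also have "\<dots> = (1 / \<sigma> * K * P) / T * w" by simp
      also have "\<dots> \<le> (1 / \<sigma> * K * P) / q * w" by (rule qT) (use K(1) P(1) sigma_pos in simp)
      finally show "H_slope / (\<sigma> * T) * (mean_exit_overshoot x - potential m overshoot x) \<le> 1 / \<sigma> * K * P / q * w" .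
    qed
    have tele: "heat (T + real n) x = evolve n (heat T) x + (\<Sum>k<n. r k)"
      using heat_telescope[of n n T x] by (simp add: r_def)
    have split: "(\<Sum>k<n. r k) = (\<Sum>k<m. r k) + (\<Sum>k=m..<n. r k)"
      by (metis atLeast0LessThan le0 sum.atLeastLessThan_concat div_le_dividend m_def)
    have one: "evolve n (\<lambda>y. 1 - heat T y) x = surv n x - evolve n (heat T) x"
      by (simp add: evolve_diff surv_def)
    have dist: "H_slope / (\<sigma> * T) * (mean_exit_overshoot x - potential m overshoot x)
      = H_slope / (\<sigma> * T) * mean_exit_overshoot x - H_slope / (\<sigma> * T) * potential m overshoot x"
      by (rule right_diff_distrib)
    have "\<bar>surv n x - (heat (real n) x + H_slope / (\<sigma> * T) * mean_exit_overshoot x)\<bar>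
      \<le> 3 * F * P / q * w + (1 + 1 / \<sigma>) / q * w + E / q * w + L * P / q * w + 1 / \<sigma> * K * P / q * w"
    proof -
      have gen: "\<bar>s - (h + hR)\<bar> \<le> b1 + b2 + b3 + b4 + b5"
        if "0 \<le> e" "e \<le> b1" "\<bar>h - h'\<bar> \<le> b2" "\<bar>r1 + hP\<bar> \<le> b3" "\<bar>r2\<bar> \<le> b4" "0 \<le> hR - hP" "hR - hP \<le> b5"
          "h' = s - e + (r1 + r2)" for s h hR b1 b2 b3 b4 b5 e h' r1 r2 hP :: real
        using that by linarith
      show ?thesis
        by (rule gen[OF A1 A2 A3 A4 A5[unfolded dist]]) (use tele split one in linarith)
    qed
    also have "\<dots> = C / q * w" by (simp add: C_def add_divide_distrib distrib_right)
    finally show ?thesis by (simp add: q_def T_def w_def)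
  qed
  thus ?thesis using C0 by (intro that[of C]) auto
qed

end

section \<open>The harmonic function\<close>

context step_law
begin

text \<open>
  The function V in terms of the step law: at the exit time, -S_\<tau> = x + (overshoot).
\<close>
definition harmonic :: "real \<Rightarrow> real" where
  "harmonic x = x + mean_exit_overshoot x"

lemma mean_exit_overshoot_measurable [measurable]: "mean_exit_overshoot \<in> borel_measurable borel"
proof -
  have [measurable]: "evolve k overshoot \<in> borel_measurable borel" for k
    by (intro adm_measurable adm_evolve adm_overshoot)
  show ?thesis unfolding mean_exit_overshoot_def[abs_def] by measurable
qed

lemma harmonic_measurable [measurable]: "harmonic \<in> borel_measurable borel"
  unfolding harmonic_def[abs_def] by measurable

lemma mean_exit_overshoot_bounded:
  obtains K where "0 \<le> K" "\<And>x. 0 \<le> x \<Longrightarrow> mean_exit_overshoot x \<le> K"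
proof -
  obtain K where K: "0 \<le> K" "\<And>n x. 0 \<le> x \<Longrightarrow> potential n overshoot x \<le> K"
    using mean_overshoot_bounded by blast
  have "mean_exit_overshoot x \<le> K" if "0 \<le> x" for x
    using mean_exit_overshoot_remainder(2)[OF K(2) that, of 0] K(1) mult_left_mono[OF surv_le_1 K(1), of 0 x]
    by (simp add: potential_def)
  thus ?thesis using K(1) by (intro that[of K]) auto
qed

lemma adm_mean_exit_overshoot [intro]: "adm mean_exit_overshoot"
proof -
  obtain K where "0 \<le> K" "\<And>x. 0 \<le> x \<Longrightarrow> mean_exit_overshoot x \<le> K"
    using mean_exit_overshoot_bounded by blast
  thus ?thesis by (intro admI[where B=K]) (auto simp: mean_exit_overshoot_nonneg)
qed

lemma potential_overshoot_tendsto: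
  "(\<lambda>n. potential n overshoot x) \<longlonglongrightarrow> overshoot x + killed mean_exit_overshoot x"
proof -
  obtain K where K: "0 \<le> K" "\<And>n x. 0 \<le> x \<Longrightarrow> potential n overshoot x \<le> K"
    using mean_overshoot_bounded by blast
  have lim: "(\<lambda>n. potential n overshoot y) \<longlonglongrightarrow> mean_exit_overshoot y" if "0 \<le> y" for y
    unfolding potential_def mean_exit_overshoot_def using that
    by (intro summable_LIMSEQ summable_evolve_overshoot)
  have [measurable]: "potential n overshoot \<in> borel_measurable borel" for n
    by (intro adm_measurable adm_potential adm_overshoot)
  have "(\<lambda>n. killed (potential n overshoot) x) \<longlonglongrightarrow> killed mean_exit_overshoot x"
    unfolding killed_def
  proof (rule integral_dominated_convergence[where w="\<lambda>_. K"])
    show "AE s in \<mu>. (\<lambda>n. indicator {0..} (x + s) * potential n overshoot (x + s))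
        \<longlonglongrightarrow> indicator {0..} (x + s) * mean_exit_overshoot (x + s)"
      by (intro AE_I2) (auto simp: indicator_def intro: lim)
    show "AE s in \<mu>. norm (indicator {0..} (x + s) * potential n overshoot (x + s)) \<le> K" for n
    proof (intro AE_I2)
      fix s
      have "0 \<le> potential n overshoot (x + s)" if "0 \<le> x + s"
        using that by (intro potential_nonneg adm_overshoot overshoot_nonneg)
      thus "norm (indicator {0..} (x + s) * potential n overshoot (x + s)) \<le> K"
        using K by (auto simp: indicator_def)
    qed
  qed auto
  hence "(\<lambda>n. overshoot x + killed (potential n overshoot) x) \<longlonglongrightarrow> overshoot x + killed mean_exit_overshoot x"
    by (intro tendsto_intros)
  hence "(\<lambda>n. potential (Suc n) overshoot x) \<longlonglongrightarrow> overshoot x + killed mean_exit_overshoot x"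
    by (simp add: potential_Suc)
  thus ?thesis by (rule LIMSEQ_imp_Suc)
qed

lemma evolve_overshoot_sums: "(\<lambda>k. evolve k overshoot x) sums mean_exit_overshoot x"
  using potential_overshoot_tendsto[of x] unfolding mean_exit_overshoot_def potential_def
  by (metis sums_def summable_def summable_sums)

lemma mean_exit_overshoot_step: "mean_exit_overshoot x = overshoot x + killed mean_exit_overshoot x"
  using evolve_overshoot_sums[of x] potential_overshoot_tendsto[of x]
  unfolding sums_def potential_def by (rule LIMSEQ_unique)

lemma integrable_killed_linear:
  assumes [measurable]: "f \<in> borel_measurable borel" and "\<And>y. 0 \<le> y \<Longrightarrow> \<bar>f y\<bar> \<le> A + y" "0 \<le> A"
  shows "integrable \<mu> (\<lambda>s. indicator {0..} (x + s) * f (x + s))"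
proof (rule Bochner_Integration.integrable_bound)
  show "integrable \<mu> (\<lambda>s. A + \<bar>x\<bar> + \<bar>s\<bar>)" using integrable_abs_step by auto
  show "AE s in \<mu>. norm (indicator {0..} (x + s) * f (x + s)) \<le> norm (A + \<bar>x\<bar> + \<bar>s\<bar>)"
  proof (intro AE_I2)
    fix s
    show "norm (indicator {0..} (x + s) * f (x + s)) \<le> norm (A + \<bar>x\<bar> + \<bar>s\<bar>)"
      using assms(2)[of "x + s"] assms(3) by (auto simp: indicator_def)
  qed
qed auto

lemma harmonic_abs_le:
  obtains K where "0 \<le> K" "\<And>y. 0 \<le> y \<Longrightarrow> harmonic y \<le> K + y" "\<And>y. 0 \<le> y \<Longrightarrow> \<bar>harmonic y\<bar> \<le> K + y"
proof -
  obtain K where K: "0 \<le> K" "\<And>x. 0 \<le> x \<Longrightarrow> mean_exit_overshoot x \<le> K"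
    using mean_exit_overshoot_bounded by blast
  have "harmonic y \<le> K + y" "\<bar>harmonic y\<bar> \<le> K + y" if "0 \<le> y" for y
    using K(2)[OF that] mean_exit_overshoot_nonneg[OF that] that by (auto simp: harmonic_def)
  thus ?thesis using K(1) that by blast
qed

lemma integrable_killed_harmonic: "integrable \<mu> (\<lambda>s. indicator {0..} (x + s) * harmonic (x + s))"
  by (rule harmonic_abs_le, rule integrable_killed_linear) auto

text \<open>
  Harmonicity, by decomposing at the first step. At negative points it expresses V through its
  values on the half-line.
\<close>
lemma harmonic_eq_killed: "harmonic x = killed harmonic x"
proof -
  have i1: "integrable \<mu> (\<lambda>s. indicator {0..} (x + s) * (x + s))"
    by (rule integrable_killed_linear[where A=0 and f="\<lambda>y. y"]) auto
  have i2: "integrable \<mu> (\<lambda>s. indicator {0..} (x + s) * mean_exit_overshoot (x + s))"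
    by (rule integrable_killed) auto
  have "(\<integral>s. indicator {0..} (x + s) * (x + s) \<partial>\<mu>) = (\<integral>s. x + s + max 0 (- (x + s)) \<partial>\<mu>)"
    by (rule Bochner_Integration.integral_cong) (auto simp: indicator_def)
  also have "\<dots> = x + overshoot x"
    using integrable_step integrable_overshoot[of x] mean_zero prob_space by (simp add: overshoot_def)
  finally have "killed harmonic x = x + overshoot x + killed mean_exit_overshoot x"
    using i1 i2 unfolding killed_def harmonic_def by (simp add: distrib_left)
  thus ?thesis using mean_exit_overshoot_step[of x] by (simp add: harmonic_def)
qed

lemma harmonic_ge_arg: "0 \<le> x \<Longrightarrow> x \<le> harmonic x"
  by (simp add: harmonic_def mean_exit_overshoot_nonneg)

lemma harmonic_nonneg: "0 \<le> harmonic x"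
proof (cases "0 \<le> x")
  case True
  thus ?thesis using harmonic_ge_arg[OF True] by linarith
next
  case False
  have "0 \<le> killed harmonic x"
    unfolding killed_def
  proof (intro integral_nonneg_AE AE_I2)
    fix s
    show "0 \<le> indicator {0..} (x + s) * harmonic (x + s)"
      using harmonic_ge_arg[of "x + s"] by (auto simp: indicator_def)
  qed
  thus ?thesis using harmonic_eq_killed[of x] by simp
qed

text \<open>
  For small x the first step alone contributes: x + o(x) \<ge> o(0), since moving up by x reduces
  an overshoot by at most x.
\<close>
lemma harmonic_ge_slab:
  assumes x: "0 \<le> x"
  shows "2 * slab \<le> harmonic x"
proof -
  have "overshoot 0 - x = (\<integral>s. max 0 (- (0 + s)) - x \<partial>\<mu>)"
    unfolding overshoot_def using integrable_overshoot[of 0] prob_space by simp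
  also have "\<dots> \<le> overshoot x"
    unfolding overshoot_def using integrable_overshoot[of 0] integrable_overshoot[of x] x
    by (intro integral_mono) auto
  also have "\<dots> \<le> mean_exit_overshoot x"
  proof -
    obtain K where K: "0 \<le> K" "\<And>n x. 0 \<le> x \<Longrightarrow> potential n overshoot x \<le> K"
      using mean_overshoot_bounded by blast
    have "potential 1 overshoot x \<le> mean_exit_overshoot x"
      by (rule mean_exit_overshoot_remainder(1)[OF K(2) x])
    thus ?thesis by (simp add: potential_def)
  qed
  finally show ?thesis by (simp add: overshoot_0 harmonic_def)
qed

lemma one_plus_le_harmonic:
  obtains C where "0 < C" "\<And>x. 0 \<le> x \<Longrightarrow> 1 + x \<le> C * harmonic x"
proof
  show "0 < 1 / (2 * slab) + 1" using slab_pos by (simp add: add_pos_pos)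
  fix x :: real assume x: "0 \<le> x"
  have "1 \<le> 1 / (2 * slab) * harmonic x" using harmonic_ge_slab[OF x] slab_pos by (simp add: field_simps)
  thus "1 + x \<le> (1 / (2 * slab) + 1) * harmonic x"
    using harmonic_ge_arg[OF x] by (simp add: distrib_right)
qed

definition main_term :: "nat \<Rightarrow> real \<Rightarrow> real" where
  "main_term n x = harmonic x * normal_L (x / (\<sigma> * sqrt (real n)))"

lemma main_term_nonneg: "0 \<le> main_term n x"
  unfolding main_term_def using harmonic_nonneg normal_L_pos by (intro mult_nonneg_nonneg) (auto intro: less_imp_le)

lemma main_term_le: "main_term n x \<le> harmonic x"
  unfolding main_term_def using harmonic_nonneg normal_L_le_1 normal_L_pos by (intro mult_left_le) auto

text \<open>
  Below the scale sqrt n the factor L is bounded below and V(x) dominates 1 + x. Above it L(u) has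
  order 1/u and cancels the growth V(x) \<ge> x.
\<close>
lemma weight_le_main_term:
  obtains C where "0 \<le> C" "\<And>n x. 1 \<le> n \<Longrightarrow> 0 \<le> x \<Longrightarrow> weight n x \<le> C * main_term n x / sqrt (real n)"
proof -
  obtain D where D: "0 < D" "\<And>x. 0 \<le> x \<Longrightarrow> 1 + x \<le> D * harmonic x"
    using one_plus_le_harmonic by blast
  define C where "C = 2 * D / H_slope + 2 / (H_slope * \<sigma>)"
  have parts: "0 \<le> 2 * D / H_slope" "0 \<le> 2 / (H_slope * \<sigma>)" using D(1) H_slope_pos sigma_pos by auto
  have "weight n x \<le> C * main_term n x / sqrt (real n)" if n: "1 \<le> n" and x: "0 \<le> x" for n x
  proof -
    define a where "a = sqrt (real n)"
    have a: "0 < a" using n by (simp add: a_def)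
    define u where "u = x / (\<sigma> * a)"
    define V where "V = harmonic x * normal_L u"
    have V: "V = main_term n x" by (simp add: V_def main_term_def u_def a_def)
    have V0: "0 \<le> V" unfolding V by (rule main_term_nonneg)
    show ?thesis
    proof (cases "u \<le> 1")
      case True
      hence "H_slope / 2 \<le> normal_L u" using x a sigma_pos by (intro normal_L_ge) (simp add: u_def)
      hence "harmonic x * (H_slope / 2) \<le> V" unfolding V_def using harmonic_nonneg by (intro mult_left_mono) auto
      hence "D * harmonic x \<le> 2 * D / H_slope * V" using D(1) H_slope_pos by (simp add: field_simps)
      hence "1 + x \<le> 2 * D / H_slope * V" using D(2)[OF x] by linarith
      also have "\<dots> \<le> C * V" unfolding C_def using parts V0 by (intro mult_right_mono) auto
      finally have "(1 + x) / a \<le> C * V / a" using a by (intro divide_right_mono) auto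
      thus ?thesis by (simp add: weight_def a_def[symmetric] V)
    next
      case False
      hence xpos: "0 < x" using x by (cases "x = 0") (auto simp: u_def)
      have "H_slope / (2 * u) \<le> normal_L u" using False by (intro normal_L_ge_inverse) simp
      hence "x * (H_slope / (2 * u)) \<le> V"
        unfolding V_def using harmonic_ge_arg[OF x] x H_slope_pos False by (intro mult_mono) auto
      hence "H_slope * \<sigma> * a / 2 \<le> V" using xpos a sigma_pos by (simp add: u_def)
      hence "a \<le> 2 / (H_slope * \<sigma>) * V" using H_slope_pos sigma_pos by (simp add: field_simps)
      also have "\<dots> \<le> C * V" unfolding C_def using parts V0 by (intro mult_right_mono) auto
      finally have "1 \<le> C * V / a" using a by simp
      thus ?thesis by (simp add: weight_def a_def[symmetric] V min_def)
    qed
  qed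
  thus ?thesis using parts by (intro that[of C]) (auto simp: C_def)
qed

lemma sqrt_sqrt_le_sqrt: "1 \<le> n \<Longrightarrow> sqrt (sqrt (real n)) \<le> sqrt (real n)"
  using mult_left_mono[of 1 "sqrt (real n)" "sqrt (real n)"] by (intro real_sqrt_le_mono) simp

text \<open>
  Since H(u) = u L(u), the first part of V(x) = x + R(x) reproduces H(u) exactly. For the second
  part \<theta> has to be replaced by L(u); this costs min(1, u), and R is bounded.
\<close>
theorem surv_main_term_weight:
  obtains C where "0 \<le> C" "\<And>n x. 1 \<le> n \<Longrightarrow> 0 \<le> x \<Longrightarrow>
      \<bar>surv n x - main_term n x / (\<sigma> * sqrt (real n))\<bar> \<le> C / sqrt (sqrt (real n)) * weight n x"
proof -
  obtain C where C: "0 \<le> C" "\<And>n x. 1 \<le> n \<Longrightarrow> 0 \<le> x \<Longrightarrow>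
      \<bar>surv n x - (heat (real n) x + H_slope / (\<sigma> * sqrt (real n)) * mean_exit_overshoot x)\<bar>
      \<le> C / sqrt (sqrt (real n)) * weight n x"
    using surv_gaussian_approximation by blast
  obtain K where K: "0 \<le> K" "\<And>x. 0 \<le> x \<Longrightarrow> mean_exit_overshoot x \<le> K"
    using mean_exit_overshoot_bounded by blast
  define E where "E = K * (1 + 1 / \<sigma>) / \<sigma>"
  have E0: "0 \<le> E" using K(1) sigma_pos by (simp add: E_def)
  have "\<bar>surv n x - main_term n x / (\<sigma> * sqrt (real n))\<bar> \<le> (C + E) / sqrt (sqrt (real n)) * weight n x"
    if n: "1 \<le> n" and x: "0 \<le> x" for n x
  proof -
    define a where "a = sqrt (real n)"
    have a: "1 \<le> a" using n by (simp add: a_def)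
    define u where "u = x / (\<sigma> * a)"
    define R where "R = mean_exit_overshoot x"
    have R: "0 \<le> R" "R \<le> K" using x K(2) by (auto simp: R_def mean_exit_overshoot_nonneg)
    have u0: "0 \<le> u" using x a sigma_pos by (simp add: u_def)
    have "heat (real n) x = x * normal_L u / (\<sigma> * a)"
      using normal_H_eq_L[of u] by (simp add: heat_def u_def a_def)
    hence "heat (real n) x + H_slope / (\<sigma> * a) * R - main_term n x / (\<sigma> * a) = R * (H_slope - normal_L u) / (\<sigma> * a)"
      by (simp add: main_term_def harmonic_def R_def u_def a_def[symmetric] add_divide_distrib diff_divide_distrib algebra_simps)
    moreover have "R * (H_slope - normal_L u) / (\<sigma> * a) \<le> K * ((1 + 1 / \<sigma>) * weight n x) / (\<sigma> * a)"
    proof (intro divide_right_mono mult_mono R K)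
      have "H_slope - normal_L u \<le> min 1 u"
        using normal_L_near_0[of u] normal_L_pos[of u] H_slope_le_1 u0 by auto
      also have "\<dots> \<le> (1 + 1 / \<sigma>) * weight n x" unfolding u_def a_def by (rule min_le_weight[OF n x])
      finally show "H_slope - normal_L u \<le> (1 + 1 / \<sigma>) * weight n x" .
    qed (use normal_L_le[of u] sigma_pos a in auto)
    moreover have "0 \<le> R * (H_slope - normal_L u) / (\<sigma> * a)"
      using R normal_L_le[of u] sigma_pos a by simp
    moreover have "K * ((1 + 1 / \<sigma>) * weight n x) / (\<sigma> * a) = E / a * weight n x" by (simp add: E_def)
    moreover have "E / a * weight n x \<le> E / sqrt a * weight n x"
      using E0 a weight_nonneg[OF x, of n] sqrt_sqrt_le_sqrt[OF n]
      by (intro mult_right_mono divide_left_mono) (auto simp: a_def)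
    moreover have "\<bar>surv n x - (heat (real n) x + H_slope / (\<sigma> * a) * R)\<bar> \<le> C / sqrt a * weight n x"
      using C(2)[OF n x] by (simp add: a_def R_def)
    moreover have "(C + E) / sqrt a * weight n x = C / sqrt a * weight n x + E / sqrt a * weight n x"
      by (simp only: add_divide_distrib distrib_right)
    ultimately have "\<bar>surv n x - main_term n x / (\<sigma> * a)\<bar> \<le> (C + E) / sqrt a * weight n x"
      by linarith
    thus ?thesis by (simp add: a_def)
  qed
  thus ?thesis using C(1) E0 by (intro that[of "C + E"]) auto
qed

theorem surv_main_term_relative:
  obtains C where "0 \<le> C" "\<And>n x. 1 \<le> n \<Longrightarrow> 0 \<le> x \<Longrightarrow>
      \<bar>surv n x - main_term n x / (\<sigma> * sqrt (real n))\<bar> \<le> C * main_term n x / (sqrt (real n) * sqrt (sqrt (real n)))"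
proof -
  obtain C where C: "0 \<le> C" "\<And>n x. 1 \<le> n \<Longrightarrow> 0 \<le> x \<Longrightarrow>
      \<bar>surv n x - main_term n x / (\<sigma> * sqrt (real n))\<bar> \<le> C / sqrt (sqrt (real n)) * weight n x"
    using surv_main_term_weight by blast
  obtain W where W: "0 \<le> W" "\<And>n x. 1 \<le> n \<Longrightarrow> 0 \<le> x \<Longrightarrow> weight n x \<le> W * main_term n x / sqrt (real n)"
    using weight_le_main_term by blast
  have "\<bar>surv n x - main_term n x / (\<sigma> * sqrt (real n))\<bar> \<le> C * W * main_term n x / (sqrt (real n) * sqrt (sqrt (real n)))"
    if n: "1 \<le> n" and x: "0 \<le> x" for n x
  proof -
    have "C / sqrt (sqrt (real n)) * weight n x \<le> C / sqrt (sqrt (real n)) * (W * main_term n x / sqrt (real n))"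
      using C(1) W(2)[OF n x] by (intro mult_left_mono) auto
    thus ?thesis using C(2)[OF n x] by (simp add: mult_ac)
  qed
  thus ?thesis using C(1) W(1) by (intro that[of "C * W"]) auto
qed

lemma surv_le_harmonic:
  obtains C where "0 \<le> C" "\<And>n x. 1 \<le> n \<Longrightarrow> 0 \<le> x \<Longrightarrow> surv n x \<le> C * harmonic x / sqrt (real n)"
proof -
  obtain C where C: "0 \<le> C" "\<And>n x. 0 \<le> x \<Longrightarrow> surv n x \<le> C * (1 + x) / sqrt (real (Suc n))"
    using surv_bound by metis
  obtain D where D: "0 < D" "\<And>x. 0 \<le> x \<Longrightarrow> 1 + x \<le> D * harmonic x"
    using one_plus_le_harmonic by blast
  have "surv n x \<le> C * D * harmonic x / sqrt (real n)" if n: "1 \<le> n" and x: "0 \<le> x" for n x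
  proof -
    have "surv n x \<le> C * (1 + x) / sqrt (real (Suc n))" by (rule C(2)[OF x])
    also have "\<dots> \<le> C * (D * harmonic x) / sqrt (real n)"
      using C(1) D x n harmonic_nonneg[of x] by (intro frac_le mult_left_mono) auto
    finally show ?thesis by simp
  qed
  thus ?thesis using C(1) D(1) by (intro that[of "C * D"]) auto
qed

lemma upper_tail_moment:
  assumes \<delta>: "1 \<le> \<delta>" and mom: "integrable \<mu> (\<lambda>s. \<bar>s\<bar> powr (2 + \<delta>))" and A: "1 \<le> A"
  shows "(\<integral>s. indicator {A<..} s * (1 + s) \<partial>\<mu>) \<le> 2 * (\<integral>s. \<bar>s\<bar> powr (2 + \<delta>) \<partial>\<mu>) / A powr (1 + \<delta>)"
proof -
  have "(\<integral>s. indicator {A<..} s * (1 + s) \<partial>\<mu>) \<le> (\<integral>s. 2 / A powr (1 + \<delta>) * \<bar>s\<bar> powr (2 + \<delta>) \<partial>\<mu>)"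
  proof (intro integral_mono integrable_mult_right mom)
    show "integrable \<mu> (\<lambda>s. indicator {A<..} s * (1 + s))"
      by (rule Bochner_Integration.integrable_bound[where f="\<lambda>s. 1 + \<bar>s\<bar>"])
         (use integrable_abs_step in \<open>auto simp: indicator_def\<close>)
    fix s
    show "indicator {A<..} s * (1 + s) \<le> 2 / A powr (1 + \<delta>) * \<bar>s\<bar> powr (2 + \<delta>)"
    proof (cases "A < s")
      case True
      have "A powr (1 + \<delta>) \<le> s powr (1 + \<delta>)" using True A \<delta> by (intro powr_mono2) auto
      hence "A powr (1 + \<delta>) * s \<le> s powr (1 + \<delta>) * s" using True A by (intro mult_right_mono) auto
      also have "\<dots> = s powr (2 + \<delta>)"
        using True A by (simp add: powr_mult_base mult.commute add_ac)
      finally have "s \<le> s powr (2 + \<delta>) / A powr (1 + \<delta>)" using A by (simp add: field_simps)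
      moreover have "1 + s \<le> 2 * s" using True A by simp
      ultimately show ?thesis using True A by simp
    qed simp
  qed
  thus ?thesis by simp
qed

text \<open>
  From x < 0 the half-line is reached only by a jump of length at least |x|, and there V grows
  linearly. The first two bounds are therefore integrals of 1 + s over long jumps, the last over
  all jumps.
\<close>
lemma harmonic_negative_arg:
  assumes \<delta>: "1 \<le> \<delta>" and mom: "integrable \<mu> (\<lambda>s. \<bar>s\<bar> powr (2 + \<delta>))"
  obtains C where "0 \<le> C"
    "\<And>x A. x < 0 \<Longrightarrow> 1 \<le> A \<Longrightarrow> (\<integral>s. indicator {A<..} (x + s) * harmonic (x + s) \<partial>\<mu>) \<le> C / A powr (1 + \<delta>)"
    "\<And>x A. 1 \<le> A \<Longrightarrow> x < - A \<Longrightarrow> harmonic x \<le> C / A powr (1 + \<delta>)"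
    "\<And>x. x < 0 \<Longrightarrow> harmonic x \<le> C"
proof -
  obtain K where K: "0 \<le> K" "\<And>y. 0 \<le> y \<Longrightarrow> harmonic y \<le> K + y"
    using harmonic_abs_le by metis
  define M where "M = (\<integral>s. \<bar>s\<bar> powr (2 + \<delta>) \<partial>\<mu>)"
  define M1 where "M1 = (\<integral>s. \<bar>s\<bar> \<partial>\<mu>)"
  have M0: "0 \<le> M" unfolding M_def by (intro integral_nonneg_AE) auto
  have M10: "0 \<le> M1" unfolding M1_def by (intro integral_nonneg_AE) auto
  define C where "C = (1 + K) * (2 * M) + (1 + K) * (1 + M1)"
  have iV: "integrable \<mu> (\<lambda>s. indicator B (x + s) * harmonic (x + s))"
    if [measurable]: "B \<in> sets borel" and "B \<subseteq> {0..}" for B x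
  proof (rule Bochner_Integration.integrable_bound[OF integrable_killed_harmonic[of x]])
    show "AE s in \<mu>. norm (indicator B (x + s) * harmonic (x + s)) \<le> norm (indicator {0..} (x + s) * harmonic (x + s))"
      using \<open>B \<subseteq> {0..}\<close> by (auto simp: indicator_def)
  qed measurable
  have iT: "integrable \<mu> (\<lambda>s. (1 + K) * (indicator {A<..} s * (1 + s)))" for A
    by (rule integrable_mult_right,
        rule Bochner_Integration.integrable_bound[where f="\<lambda>s. 1 + \<bar>s\<bar>"])
       (use integrable_abs_step in \<open>auto simp: indicator_def\<close>)
  have Vs: "harmonic (x + s) \<le> (1 + K) * (1 + s)" if "x < 0" "0 \<le> x + s" for x s
  proof -
    have "harmonic (x + s) \<le> K + (x + s)" using that K(2) by blast
    note 1 = this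
    have "0 \<le> K * s" using that K(1) by (intro mult_nonneg_nonneg) auto
    hence "K + (x + s) \<le> K * (1 + s) + (1 + s)" using that by (simp add: distrib_left)
    with 1 have "harmonic (x + s) \<le> K * (1 + s) + (1 + s)" by linarith
    thus ?thesis by (simp add: distrib_right)
  qed
  have tail: "(\<integral>s. indicator B (x + s) * harmonic (x + s) \<partial>\<mu>) \<le> C / A powr (1 + \<delta>)"
    if "x < 0" "1 \<le> A" and B: "B \<in> sets borel" "B \<subseteq> {0..}" "\<And>s. x + s \<in> B \<Longrightarrow> A < s" for x A B
  proof -
    have "(\<integral>s. indicator B (x + s) * harmonic (x + s) \<partial>\<mu>) \<le> (\<integral>s. (1 + K) * (indicator {A<..} s * (1 + s)) \<partial>\<mu>)"
    proof (intro integral_mono iV B iT)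
      fix s
      show "indicator B (x + s) * harmonic (x + s) \<le> (1 + K) * (indicator {A<..} s * (1 + s))"
        using Vs[OF that(1), of s] B(2) B(3)[of s] K(1) that(2)
        by (cases "x + s \<in> B") (auto simp: indicator_def)
    qed
    also have "\<dots> = (1 + K) * (\<integral>s. indicator {A<..} s * (1 + s) \<partial>\<mu>)" by simp
    also have "\<dots> \<le> (1 + K) * (2 * M / A powr (1 + \<delta>))"
      unfolding M_def using K(1) by (intro mult_left_mono upper_tail_moment \<delta> mom that) auto
    also have "\<dots> = (1 + K) * (2 * M) / A powr (1 + \<delta>)" by simp
    also have "\<dots> \<le> C / A powr (1 + \<delta>)"
      using K(1) M10 by (intro divide_right_mono) (auto simp: C_def)
    finally show ?thesis .
  qed
  show ?thesis
  proof (rule that[of C])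
    show "0 \<le> C" using K(1) M0 M10 by (simp add: C_def)
    show "(\<integral>s. indicator {A<..} (x + s) * harmonic (x + s) \<partial>\<mu>) \<le> C / A powr (1 + \<delta>)" if "x < 0" "1 \<le> A" for x A
      using that by (intro tail) auto
    show "harmonic x \<le> C / A powr (1 + \<delta>)" if "1 \<le> A" "x < - A" for x A
    proof -
      have "harmonic x = (\<integral>s. indicator {0..} (x + s) * harmonic (x + s) \<partial>\<mu>)"
        using harmonic_eq_killed[of x] by (simp add: killed_def)
      also have "\<dots> \<le> C / A powr (1 + \<delta>)" using that by (intro tail) auto
      finally show ?thesis .
    qed
    show "harmonic x \<le> C" if "x < 0" for x
    proof -
      have "harmonic x = (\<integral>s. indicator {0..} (x + s) * harmonic (x + s) \<partial>\<mu>)"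
        using harmonic_eq_killed[of x] by (simp add: killed_def)
      also have "\<dots> \<le> (\<integral>s. (1 + K) * (1 + \<bar>s\<bar>) \<partial>\<mu>)"
      proof (intro integral_mono integrable_killed_harmonic)
        fix s
        have "(1 + K) * (1 + s) \<le> (1 + K) * (1 + \<bar>s\<bar>)" using K(1) by (intro mult_left_mono) auto
        moreover have "0 \<le> (1 + K) * (1 + \<bar>s\<bar>)" using K(1) by simp
        ultimately show "indicator {0..} (x + s) * harmonic (x + s) \<le> (1 + K) * (1 + \<bar>s\<bar>)"
          using Vs[OF that, of s] by (auto simp: indicator_def)
      qed (use integrable_abs_step in auto)
      also have "\<dots> = (1 + K) * (1 + M1)"
        using integrable_abs_step prob_space by (simp add: M1_def)
      also have "\<dots> \<le> C" using K(1) M0 by (simp add: C_def)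
      finally show ?thesis .
    qed
  qed
qed

end

section \<open>Negative starting points\<close>

lemma normal_L_minus: "normal_L (- u) = normal_L u"
  by (simp add: normal_L_def normal_H_minus)

lemma normal_L_ge_on_interval:
  assumes "0 < s" "\<bar>u\<bar> \<le> 1 / s"
  shows "H_slope / 2 * min 1 s \<le> normal_L u"
proof (cases "\<bar>u\<bar> \<le> 1")
  case True
  have "H_slope / 2 * min 1 s \<le> H_slope / 2 * 1" using H_slope_pos by (intro mult_left_mono) auto
  thus ?thesis using normal_L_ge[OF True] by simp
next
  case False
  hence "H_slope / (2 * (1 / s)) \<le> H_slope / (2 * \<bar>u\<bar>)"
    using H_slope_pos assms by (intro divide_left_mono mult_pos_pos) auto
  also have "\<dots> \<le> normal_L \<bar>u\<bar>" using False by (intro normal_L_ge_inverse) simp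
  also have "normal_L \<bar>u\<bar> = normal_L u" using normal_L_minus[of u] by (simp add: abs_if)
  finally have "H_slope / 2 * s \<le> normal_L u" by simp
  moreover have "H_slope / 2 * min 1 s \<le> H_slope / 2 * s" using H_slope_pos by (intro mult_left_mono) auto
  ultimately show ?thesis by simp
qed

context step_law
begin

lemma surv_nonneg_all: "0 \<le> surv n x"
proof (cases n)
  case 0
  thus ?thesis by (simp add: surv_def)
next
  case (Suc m)
  thus ?thesis unfolding Suc surv_Suc killed_def
    by (intro integral_nonneg_AE AE_I2) (auto simp: indicator_def surv_nonneg)
qed

lemma surv_negative_arg:
  obtains C where "0 \<le> C" "\<And>n x. 2 \<le> n \<Longrightarrow> surv n x \<le> C * harmonic x / sqrt (real n)"
proof -
  obtain S where S: "0 \<le> S" "\<And>n x. 1 \<le> n \<Longrightarrow> 0 \<le> x \<Longrightarrow> surv n x \<le> S * harmonic x / sqrt (real n)"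
    using surv_le_harmonic by blast
  have "surv n x \<le> 2 * S * harmonic x / sqrt (real n)" if n: "2 \<le> n" for n x
  proof -
    obtain m where m: "n = Suc m" "1 \<le> m" using n by (cases n) auto
    have ab: "sqrt (real n) / 2 \<le> sqrt (real m)" by (rule half_sqrt_le) (use m in simp)
    have "surv n x = (\<integral>s. indicator {0..} (x + s) * surv m (x + s) \<partial>\<mu>)"
      by (simp add: m surv_Suc killed_def)
    also have "\<dots> \<le> (\<integral>s. S / sqrt (real m) * (indicator {0..} (x + s) * harmonic (x + s)) \<partial>\<mu>)"
    proof (intro integral_mono integrable_mult_right integrable_killed_harmonic integrable_killed[OF adm_surv])
      fix s
      show "indicator {0..} (x + s) * surv m (x + s) \<le> S / sqrt (real m) * (indicator {0..} (x + s) * harmonic (x + s))"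
        using S(2)[OF m(2), of "x + s"] by (auto simp: indicator_def)
    qed
    also have "\<dots> = S / sqrt (real m) * harmonic x"
      using harmonic_eq_killed[of x] by (simp add: killed_def)
    also have "\<dots> \<le> S / (sqrt (real n) / 2) * harmonic x"
      using ab S(1) n m(2) harmonic_nonneg by (intro mult_right_mono divide_left_mono) auto
    finally show ?thesis by (simp add: mult_ac)
  qed
  thus ?thesis using S(1) by (intro that[of "2 * S"]) auto
qed

text \<open>
  Far below the origin both quantities are at most a multiple of V(x)/sqrt n, and V(x) is already
  as small as the error allows.
\<close>
lemma negative_far:
  assumes \<delta>: "1 \<le> \<delta>" and mom: "integrable \<mu> (\<lambda>s. \<bar>s\<bar> powr (2 + \<delta>))"
  obtains C where "0 \<le> C" "\<And>n x. 2 \<le> n \<Longrightarrow> x < - sqrt (sqrt (real n)) \<Longrightarrow>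
     \<bar>surv n x - main_term n x / (\<sigma> * sqrt (real n))\<bar> \<le> C / sqrt (real n) * (1 / sqrt (sqrt (real n)) powr \<delta>)"
proof -
  obtain S where S: "0 \<le> S" "\<And>n x. 2 \<le> n \<Longrightarrow> surv n x \<le> S * harmonic x / sqrt (real n)"
    using surv_negative_arg by blast
  obtain H where H: "0 \<le> H" "\<And>x A. 1 \<le> A \<Longrightarrow> x < - A \<Longrightarrow> harmonic x \<le> H / A powr (1 + \<delta>)"
    using harmonic_negative_arg[OF \<delta> mom] by metis
  have "\<bar>surv n x - main_term n x / (\<sigma> * sqrt (real n))\<bar> \<le> (S + 1 / \<sigma>) * H / sqrt (real n) * (1 / sqrt (sqrt (real n)) powr \<delta>)"
    if n: "2 \<le> n" and x: "x < - sqrt (sqrt (real n))" for n x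
  proof -
    define a where "a = sqrt (real n)"
    define q where "q = sqrt a"
    have a: "1 \<le> a" using n by (simp add: a_def)
    have q: "1 \<le> q" using a by (simp add: q_def)
    have "harmonic x \<le> H / q powr (1 + \<delta>)" using x q by (intro H(2)) (auto simp: q_def a_def)
    also have "\<dots> \<le> H / q powr \<delta>"
      using H(1) q \<delta> by (intro divide_left_mono powr_mono) auto
    finally have V: "harmonic x \<le> H / q powr \<delta>" .
    have "main_term n x / (\<sigma> * a) \<le> harmonic x / (\<sigma> * a)"
      using main_term_le sigma_pos a by (intro divide_right_mono) auto
    moreover have "0 \<le> main_term n x / (\<sigma> * a)" using main_term_nonneg sigma_pos a by simp
    moreover have "surv n x \<le> S * harmonic x / a" using S(2)[OF n] by (simp add: a_def)
    moreover have "(S + 1 / \<sigma>) / a * harmonic x = S * harmonic x / a + harmonic x / (\<sigma> * a)"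
      by (simp add: add_divide_distrib distrib_right)
    ultimately have "\<bar>surv n x - main_term n x / (\<sigma> * a)\<bar> \<le> (S + 1 / \<sigma>) / a * harmonic x"
      using surv_nonneg_all[of n x] by linarith
    also have "\<dots> \<le> (S + 1 / \<sigma>) / a * (H / q powr \<delta>)"
      using V S(1) sigma_pos a by (intro mult_left_mono) auto
    finally show ?thesis by (simp add: a_def q_def mult_ac)
  qed
  thus ?thesis using S(1) H(1) sigma_pos by (intro that[of "(S + 1 / \<sigma>) * H"]) auto
qed

text \<open>
  The main terms at the two ends of the first step differ in the number of steps left, m = n - 1
  against n, and in the argument of L. As long as both |x| and y are at most n^(1/4), the
  arguments of L are O(n^(-1/4)) and L is close to \<theta>. The indicator accounts for the long
  jumps.
\<close>
lemma normal_L_change: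
  assumes n: "n = Suc m" "1 \<le> m" and u: "\<bar>x\<bar> \<le> sqrt (sqrt (real n))" and y: "0 \<le> y"
  shows "\<bar>normal_L (y / (\<sigma> * sqrt (real m))) / sqrt (real m) - normal_L (x / (\<sigma> * sqrt (real n))) / sqrt (real n)\<bar>
    \<le> (6 / \<sigma> + 2) / (sqrt (real n) * sqrt (sqrt (real n)))
       + 2 / sqrt (real n) * indicator {sqrt (sqrt (real n))<..} y"
proof -
  define a where "a = sqrt (real n)"
  define b where "b = sqrt (real m)"
  define q where "q = sqrt a"
  have a: "1 \<le> a" "a * a = real n" using n by (auto simp: a_def)
  have b: "1 \<le> b" "b * b = real m" using n by (auto simp: b_def)
  have q: "1 \<le> q" "q * q = a" using a by (auto simp: q_def)
  have qa: "q \<le> a" using q mult_left_mono[of 1 q q] by simp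
  have ab: "a / 2 \<le> b" unfolding a_def b_def by (rule half_sqrt_le) (use n in simp)
  have ba: "b \<le> a" unfolding a_def b_def using n by (intro real_sqrt_le_mono) simp
  define Lv where "Lv = normal_L (y / (\<sigma> * b))"
  define Lu where "Lu = normal_L (x / (\<sigma> * a))"
  have Lu: "\<bar>Lu - H_slope\<bar> \<le> 1 / (\<sigma> * q)"
  proof -
    have "\<bar>Lu - H_slope\<bar> \<le> \<bar>x / (\<sigma> * a)\<bar>" unfolding Lu_def by (rule normal_L_near_0)
    also have "\<dots> = \<bar>x\<bar> / (\<sigma> * a)" using sigma_pos a by simp
    also have "\<dots> \<le> q / (\<sigma> * a)" using u sigma_pos a by (intro divide_right_mono) (auto simp: q_def a_def)
    also have "\<dots> = 1 / (\<sigma> * q)" using q by (simp add: q(2)[symmetric])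
    finally show ?thesis .
  qed
  have Lv: "\<bar>Lv - H_slope\<bar> \<le> 2 / (\<sigma> * q) + indicator {q<..} y"
  proof (cases "q < y")
    case True
    have "\<bar>Lv - H_slope\<bar> \<le> 1"
      using normal_L_pos[of "y / (\<sigma> * b)"] normal_L_le[of "y / (\<sigma> * b)"] H_slope_le_1 by (simp add: Lv_def)
    moreover have "0 \<le> 2 / (\<sigma> * q)" using sigma_pos q by simp
    ultimately have "\<bar>Lv - H_slope\<bar> \<le> 2 / (\<sigma> * q) + 1" by linarith
    thus ?thesis using True by simp
  next
    case False
    have "\<bar>Lv - H_slope\<bar> \<le> \<bar>y / (\<sigma> * b)\<bar>" unfolding Lv_def by (rule normal_L_near_0)
    also have "\<dots> = y / (\<sigma> * b)" using sigma_pos b y by simp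
    also have "\<dots> \<le> q / (\<sigma> * (a / 2))"
      using False y sigma_pos a ab b by (intro frac_le mult_left_mono) auto
    also have "\<dots> = 2 / (\<sigma> * q)" using q by (simp add: q(2)[symmetric])
    finally show ?thesis using False by simp
  qed
  have diff: "\<bar>1 / b - 1 / a\<bar> \<le> 2 / (a * q)"
  proof -
    have "(a - b) * (a + b) = 1" using n by (simp add: algebra_simps a(2) b(2))
    hence "a - b = 1 / (a + b)" using a b by (simp add: field_simps)
    moreover have "1 / b - 1 / a = (a - b) / (b * a)" using a b by (simp add: field_simps)
    ultimately have "1 / b - 1 / a = 1 / ((a + b) * (b * a))" by simp
    also have "\<dots> \<le> 1 / (q * (1 / 2 * a))"
      using a b q qa ab by (intro divide_left_mono mult_mono mult_right_mono mult_pos_pos) auto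
    also have "\<dots> = 2 / (a * q)" by simp
    finally have "1 / b - 1 / a \<le> 2 / (a * q)" .
    moreover have "1 / a \<le> 1 / b" using ba b by (intro divide_left_mono) auto
    ultimately show ?thesis by simp
  qed
  have eq: "Lv / b - Lu / a = (Lv - H_slope) / b - (Lu - H_slope) / b + Lu * (1 / b - 1 / a)"
    by (simp add: algebra_simps diff_divide_distrib)
  have "\<bar>Lv - H_slope\<bar> / b \<le> (2 / (\<sigma> * q) + indicator {q<..} y) / (a / 2)"
    using Lv ab a by (intro frac_le) auto
  moreover have "\<bar>Lu - H_slope\<bar> / b \<le> (1 / (\<sigma> * q)) / (a / 2)"
    using Lu ab a sigma_pos q by (intro frac_le) auto
  moreover have "\<bar>Lu * (1 / b - 1 / a)\<bar> \<le> 1 * (2 / (a * q))"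
    unfolding abs_mult Lu_def using diff normal_L_le_1 normal_L_pos by (intro mult_mono) (auto simp: less_imp_le)
  moreover have "\<bar>Lv / b - Lu / a\<bar> \<le> \<bar>Lv - H_slope\<bar> / b + \<bar>Lu - H_slope\<bar> / b + \<bar>Lu * (1 / b - 1 / a)\<bar>"
  proof -
    have "\<bar>p - r + s\<bar> \<le> \<bar>p\<bar> + \<bar>r\<bar> + \<bar>s\<bar>" for p r s :: real by linarith
    from this[of "(Lv - H_slope) / b" "(Lu - H_slope) / b" "Lu * (1 / b - 1 / a)"]
    show ?thesis unfolding eq using b by simp
  qed
  moreover have "(2 / (\<sigma> * q) + indicator {q<..} y) / (a / 2) + (1 / (\<sigma> * q)) / (a / 2) + 1 * (2 / (a * q))
     = (6 / \<sigma> + 2) / (a * q) + 2 / a * indicator {q<..} y"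
    using a q sigma_pos by (simp add: field_simps)
  ultimately show ?thesis
    unfolding Lv_def Lu_def a_def[symmetric] b_def[symmetric] q_def[symmetric] by linarith
qed

text \<open>
  The difference of the two sides is integrated over the first step. Harmonicity turns the first
  error in \<open>normal_L_change\<close> into V(x), the long jumps are controlled by
  \<open>harmonic_negative_arg\<close>, and L(u) is bounded below because |u| \<le> 1/\<sigma>.
\<close>
lemma negative_near:
  assumes \<delta>: "1 \<le> \<delta>" and mom: "integrable \<mu> (\<lambda>s. \<bar>s\<bar> powr (2 + \<delta>))"
  obtains C where "0 \<le> C" "\<And>n x. 2 \<le> n \<Longrightarrow> x < 0 \<Longrightarrow> - sqrt (sqrt (real n)) \<le> x \<Longrightarrow>
     \<bar>surv n x - main_term n x / (\<sigma> * sqrt (real n))\<bar>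
       \<le> C / sqrt (real n) * (1 / sqrt (sqrt (real n)) powr \<delta> + main_term n x / sqrt (sqrt (real n)))"
proof -
  obtain R where R: "0 \<le> R" "\<And>n x. 1 \<le> n \<Longrightarrow> 0 \<le> x \<Longrightarrow>
      \<bar>surv n x - main_term n x / (\<sigma> * sqrt (real n))\<bar> \<le> R * main_term n x / (sqrt (real n) * sqrt (sqrt (real n)))"
    using surv_main_term_relative by blast
  obtain H where H: "0 \<le> H"
    "\<And>x A. x < 0 \<Longrightarrow> 1 \<le> A \<Longrightarrow> (\<integral>s. indicator {A<..} (x + s) * harmonic (x + s) \<partial>\<mu>) \<le> H / A powr (1 + \<delta>)"
    using harmonic_negative_arg[OF \<delta> mom] by metis
  \<comment> \<open>a lower bound for L on arguments of modulus at most the inverse of \<sigma>\<close>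
  define l where "l = H_slope / 2 * min 1 \<sigma>"
  have l: "0 < l" using H_slope_pos sigma_pos by (simp add: l_def)
  define B where "B = 4 * R + (6 / \<sigma> + 2) / \<sigma>"
  have B0: "0 \<le> B" using R(1) sigma_pos by (simp add: B_def)
  have "\<bar>surv n x - main_term n x / (\<sigma> * sqrt (real n))\<bar>
       \<le> (B / l + 2 / \<sigma> * H) / sqrt (real n) * (1 / sqrt (sqrt (real n)) powr \<delta> + main_term n x / sqrt (sqrt (real n)))"
    if n: "2 \<le> n" and x: "x < 0" and xq: "- sqrt (sqrt (real n)) \<le> x" for n x
  proof -
    obtain m where m: "n = Suc m" "1 \<le> m" using n by (cases n) auto
    define a where "a = sqrt (real n)"
    define b where "b = sqrt (real m)"
    define q where "q = sqrt a"
    have a: "1 \<le> a" "a * a = real n" using n by (auto simp: a_def)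
    have b: "1 \<le> b" using m by (simp add: b_def)
    have q: "1 \<le> q" "q * q = a" using a by (auto simp: q_def)
    have ab: "a / 2 \<le> b" unfolding a_def b_def by (rule half_sqrt_le) (use m in simp)
    have qb: "q / 2 \<le> sqrt b" unfolding q_def by (rule half_sqrt_le) (use ab a in simp)
    define u where "u = x / (\<sigma> * a)"
    define Lu where "Lu = normal_L u"
    have pt: "\<bar>surv m y - harmonic y * Lu / (\<sigma> * a)\<bar> \<le> harmonic y * (B / (a * q)) + harmonic y * (2 / (\<sigma> * a)) * indicator {q<..} y"
      if y: "0 \<le> y" for y
    proof -
      define Lv where "Lv = normal_L (y / (\<sigma> * b))"
      have V: "0 \<le> harmonic y" by (rule harmonic_nonneg)
      have "\<bar>surv m y - harmonic y * Lv / (\<sigma> * b)\<bar> \<le> R * main_term m y / (b * sqrt b)"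
        using R(2)[OF m(2) y] by (simp add: main_term_def Lv_def b_def)
      also have "\<dots> \<le> R * harmonic y / (a / 2 * (q / 2))"
        using R(1) main_term_le[of m y] ab qb a q V by (intro frac_le mult_left_mono mult_mono) auto
      also have "\<dots> = harmonic y * (4 * R / (a * q))" by simp
      finally have e1: "\<bar>surv m y - harmonic y * Lv / (\<sigma> * b)\<bar> \<le> harmonic y * (4 * R / (a * q))" .
      have "\<bar>harmonic y * Lv / (\<sigma> * b) - harmonic y * Lu / (\<sigma> * a)\<bar> = harmonic y / \<sigma> * \<bar>Lv / b - Lu / a\<bar>"
      proof -
        have "harmonic y * Lv / (\<sigma> * b) - harmonic y * Lu / (\<sigma> * a) = harmonic y / \<sigma> * (Lv / b - Lu / a)"
          by (simp add: right_diff_distrib)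
        thus ?thesis using V sigma_pos by (simp only: abs_mult) simp
      qed
      also have "\<dots> \<le> harmonic y / \<sigma> * ((6 / \<sigma> + 2) / (a * q) + 2 / a * indicator {q<..} y)"
        unfolding Lv_def Lu_def u_def a_def b_def q_def using V sigma_pos x xq
        by (intro mult_left_mono normal_L_change m y) auto
      also have "\<dots> = harmonic y * ((6 / \<sigma> + 2) / \<sigma> / (a * q)) + harmonic y * (2 / (\<sigma> * a)) * indicator {q<..} y"
      proof -
        have "v / \<sigma> * (e / c + 2 / a * i) = v * (e / \<sigma> / c) + v * (2 / (\<sigma> * a)) * i" for v e c i :: real
          by (simp add: distrib_left)
        thus ?thesis .
      qed
      finally have e2: "\<bar>harmonic y * Lv / (\<sigma> * b) - harmonic y * Lu / (\<sigma> * a)\<bar>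
         \<le> harmonic y * ((6 / \<sigma> + 2) / \<sigma> / (a * q)) + harmonic y * (2 / (\<sigma> * a)) * indicator {q<..} y" .
      have eqB: "harmonic y * (B / (a * q)) = harmonic y * (4 * R / (a * q)) + harmonic y * ((6 / \<sigma> + 2) / \<sigma> / (a * q))"
        unfolding B_def by (simp only: add_divide_distrib distrib_left)
      have "\<bar>s - r\<bar> \<le> d + e" if "\<bar>s - t\<bar> \<le> d" "\<bar>t - r\<bar> \<le> e" for s r t d e :: real
        using that by linarith
      from this[OF e1 e2] show ?thesis unfolding eqB by (simp only: add.assoc)
    qed
    define V where "V s = indicator {0..} (x + s) * harmonic (x + s)" for s
    define V' where "V' s = indicator {q<..} (x + s) * harmonic (x + s)" for s
    define P where "P s = indicator {0..} (x + s) * surv m (x + s)" for s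
    have iV: "integrable \<mu> V" unfolding V_def[abs_def] by (rule integrable_killed_harmonic)
    have iT: "integrable \<mu> V'"
      by (rule Bochner_Integration.integrable_bound[OF iV]) (use q in \<open>auto simp: V_def V'_def[abs_def] indicator_def\<close>)
    have iP: "integrable \<mu> P" unfolding P_def[abs_def] by (intro integrable_killed adm_surv)
    have V: "harmonic x = (\<integral>s. V s \<partial>\<mu>)" unfolding V_def by (subst harmonic_eq_killed) (simp add: killed_def)
    have "surv n x = (\<integral>s. P s \<partial>\<mu>)" by (simp add: m surv_Suc killed_def P_def)
    moreover have "main_term n x / (\<sigma> * a) = Lu / (\<sigma> * a) * (\<integral>s. V s \<partial>\<mu>)"
      by (simp add: V[symmetric] main_term_def Lu_def u_def a_def)
    ultimately have "surv n x - main_term n x / (\<sigma> * a) = (\<integral>s. P s - Lu / (\<sigma> * a) * V s \<partial>\<mu>)"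
      using iP iV by simp
    hence "\<bar>surv n x - main_term n x / (\<sigma> * a)\<bar> \<le> (\<integral>s. \<bar>P s - Lu / (\<sigma> * a) * V s\<bar> \<partial>\<mu>)"
      by (simp only: integral_abs_bound)
    also have "\<dots> \<le> (\<integral>s. B / (a * q) * V s + 2 / (\<sigma> * a) * V' s \<partial>\<mu>)"
    proof (intro integral_mono integrable_abs Bochner_Integration.integrable_add Bochner_Integration.integrable_diff
        integrable_mult_right iV iT iP)
      fix s
      show "\<bar>P s - Lu / (\<sigma> * a) * V s\<bar> \<le> B / (a * q) * V s + 2 / (\<sigma> * a) * V' s"
        using pt[of "x + s"] q
        by (cases "0 \<le> x + s") (auto simp: V_def V'_def P_def indicator_def mult_ac)
    qed
    also have "\<dots> = B / (a * q) * harmonic x + 2 / (\<sigma> * a) * (\<integral>s. V' s \<partial>\<mu>)"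
      using iV iT by (simp add: V)
    also have "\<dots> \<le> B / (a * q) * (main_term n x / l) + 2 / (\<sigma> * a) * (H / q powr \<delta>)"
    proof (intro add_mono mult_left_mono)
      have "q \<le> a" unfolding q_def a_def by (rule sqrt_sqrt_le_sqrt) (use n in simp)
      moreover have "- q \<le> x" using xq by (simp only: q_def a_def)
      ultimately have "\<bar>x\<bar> / (\<sigma> * a) \<le> a / (\<sigma> * a)" using x sigma_pos a by (intro divide_right_mono) auto
      hence "\<bar>u\<bar> \<le> 1 / \<sigma>" using sigma_pos a by (simp add: u_def)
      hence "l \<le> Lu" unfolding l_def Lu_def by (rule normal_L_ge_on_interval[OF sigma_pos])
      hence "harmonic x * l \<le> main_term n x"
        unfolding main_term_def a_def[symmetric] u_def[symmetric] Lu_def[symmetric]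
        using harmonic_nonneg by (intro mult_left_mono) auto
      thus "harmonic x \<le> main_term n x / l" using l by (simp add: field_simps)
      have "(\<integral>s. V' s \<partial>\<mu>) \<le> H / q powr (1 + \<delta>)"
        unfolding V'_def by (rule H(2)[OF x q(1)])
      also have "\<dots> \<le> H / q powr \<delta>" using H(1) q \<delta> by (intro divide_left_mono powr_mono) auto
      finally show "(\<integral>s. V' s \<partial>\<mu>) \<le> H / q powr \<delta>" .
    qed (use B0 a q sigma_pos in auto)
    also have "\<dots> = B / l / a * (main_term n x / q) + 2 / \<sigma> * H / a * (1 / q powr \<delta>)" by simp
    also have "\<dots> \<le> (B / l + 2 / \<sigma> * H) / a * (main_term n x / q) + (B / l + 2 / \<sigma> * H) / a * (1 / q powr \<delta>)"
      using B0 l H(1) sigma_pos a q main_term_nonneg[of n x]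
      by (intro add_mono mult_right_mono divide_right_mono) auto
    also have "\<dots> = (B / l + 2 / \<sigma> * H) / a * (1 / q powr \<delta> + main_term n x / q)"
      by (simp only: distrib_left add.commute)
    finally show ?thesis by (simp only: a_def q_def)
  qed
  thus ?thesis using B0 l H(1) sigma_pos by (intro that[of "B / l + 2 / \<sigma> * H"]) auto
qed

lemma powr_quarter:
  assumes "1 \<le> n"
  shows "real n powr (1 / 4) = sqrt (sqrt (real n))" "real n powr (d / 4) = sqrt (sqrt (real n)) powr d"
proof -
  have "sqrt (sqrt (real n)) = (real n powr (1 / 2)) powr (1 / 2)" by (simp add: powr_half_sqrt)
  also have "\<dots> = real n powr (1 / 4)" by (simp add: powr_powr)
  finally show *: "real n powr (1 / 4) = sqrt (sqrt (real n))" by simp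
  show "real n powr (d / 4) = sqrt (sqrt (real n)) powr d"
    unfolding *[symmetric] by (simp add: powr_powr)
qed

text \<open>
  In each of the three ranges x \<ge> 0, -n^(1/4) \<le> x < 0 and x < -n^(1/4) the error is at
  most a multiple of n^(-1/2) times n^(-\<delta>/4) plus n^(-1/4) times the main term. For n \<ge>
  2 the factor ln n only costs the constant 1/ln 2.
\<close>
theorem surv_main_term:
  assumes \<delta>: "1 \<le> \<delta>" and mom: "integrable \<mu> (\<lambda>s. \<bar>s\<bar> powr (2 + \<delta>))"
  obtains C where "0 < C" "\<And>n x. 1 \<le> n \<Longrightarrow>
     \<bar>surv n x - main_term n x / (\<sigma> * sqrt (real n))\<bar>
       \<le> C / sqrt (real n) * (1 / real n powr (\<delta> / 4) + main_term n x / real n powr (1 / 4) * ln (real n))"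
proof -
  obtain W where W: "0 \<le> W" "\<And>n x. 1 \<le> n \<Longrightarrow> 0 \<le> x \<Longrightarrow>
      \<bar>surv n x - main_term n x / (\<sigma> * sqrt (real n))\<bar> \<le> W / sqrt (sqrt (real n)) * weight n x"
    using surv_main_term_weight by blast
  obtain R where R: "0 \<le> R" "\<And>n x. 1 \<le> n \<Longrightarrow> 0 \<le> x \<Longrightarrow>
      \<bar>surv n x - main_term n x / (\<sigma> * sqrt (real n))\<bar> \<le> R * main_term n x / (sqrt (real n) * sqrt (sqrt (real n)))"
    using surv_main_term_relative by blast
  obtain F where F: "0 \<le> F" "\<And>n x. 2 \<le> n \<Longrightarrow> x < - sqrt (sqrt (real n)) \<Longrightarrow>
     \<bar>surv n x - main_term n x / (\<sigma> * sqrt (real n))\<bar> \<le> F / sqrt (real n) * (1 / sqrt (sqrt (real n)) powr \<delta>)"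
    using negative_far[OF \<delta> mom] by blast
  obtain N where N: "0 \<le> N" "\<And>n x. 2 \<le> n \<Longrightarrow> x < 0 \<Longrightarrow> - sqrt (sqrt (real n)) \<le> x \<Longrightarrow>
     \<bar>surv n x - main_term n x / (\<sigma> * sqrt (real n))\<bar>
       \<le> N / sqrt (real n) * (1 / sqrt (sqrt (real n)) powr \<delta> + main_term n x / sqrt (sqrt (real n)))"
    using negative_near[OF \<delta> mom] by blast
  obtain H where H: "0 \<le> H" "\<And>x. x < 0 \<Longrightarrow> harmonic x \<le> H"
    using harmonic_negative_arg[OF \<delta> mom] by metis
  define D where "D = R + F + N"
  \<comment> \<open>for n = 1 the logarithm vanishes and the first error term alone has to cover the difference\<close>
  define C where "C = 1 + W + H / \<sigma> + D + D / ln 2"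
  have D0: "0 \<le> D" using R(1) F(1) N(1) by (simp add: D_def)
  have C: "1 + W + H / \<sigma> \<le> C" "D \<le> C" "D / ln 2 \<le> C" "0 < C"
    unfolding C_def using W(1) H(1) D0 sigma_pos by (auto simp: add_pos_nonneg add_increasing add_increasing2)
  have "\<bar>surv n x - main_term n x / (\<sigma> * sqrt (real n))\<bar>
       \<le> C / sqrt (real n) * (1 / real n powr (\<delta> / 4) + main_term n x / real n powr (1 / 4) * ln (real n))"
    if n: "1 \<le> n" for n x
  proof (cases "n = 1")
    case True
    have "\<bar>surv 1 x - main_term 1 x / \<sigma>\<bar> \<le> C"
    proof (cases "0 \<le> x")
      case True
      have "W * weight 1 x \<le> W * 1" by (intro mult_left_mono W(1)) (simp add: weight_def)
      moreover have "\<bar>surv 1 x - main_term 1 x / \<sigma>\<bar> \<le> W * weight 1 x" using W(2)[of 1 x] True by simp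
      moreover have "0 \<le> H / \<sigma>" using H(1) sigma_pos by simp
      ultimately show ?thesis using C(1) by linarith
    next
      case False
      have "main_term 1 x / \<sigma> \<le> H / \<sigma>"
        using main_term_le[of 1 x] H(2)[of x] False sigma_pos by (intro divide_right_mono) auto
      moreover have "0 \<le> main_term 1 x / \<sigma>" using main_term_nonneg sigma_pos by simp
      ultimately show ?thesis
        using surv_le_1[of 1 x] surv_nonneg_all[of 1 x] C(1) W(1) H(1) by (simp add: abs_le_iff)
    qed
    thus ?thesis using True by simp
  next
    case False
    hence n2: "2 \<le> n" using n by simp
    define a where "a = sqrt (real n)"
    define q where "q = sqrt a"
    define t where "t = main_term n x / q"
    have a: "1 \<le> a" using n by (simp add: a_def)
    have q: "1 \<le> q" using a by (simp add: q_def)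
    have t0: "0 \<le> t" using q main_term_nonneg by (simp add: t_def)
    have p0: "0 \<le> 1 / q powr \<delta>" by simp
    have "\<bar>surv n x - main_term n x / (\<sigma> * a)\<bar> \<le> D / a * (1 / q powr \<delta> + t)"
    proof -
      have up: "c / a * e \<le> D / a * (1 / q powr \<delta> + t)" if "c \<le> D" "0 \<le> e" "e \<le> 1 / q powr \<delta> + t" for c e
        using that D0 a by (intro mult_mono divide_right_mono) auto
      have D_ge: "R \<le> D" "F \<le> D" "N \<le> D" using R(1) F(1) N(1) by (auto simp: D_def)
      consider "0 \<le> x" | "x < - q" | "x < 0" "- q \<le> x" by linarith
      thus ?thesis
      proof cases
        case 1
        have "\<bar>surv n x - main_term n x / (\<sigma> * a)\<bar> \<le> R / a * t"
          using R(2)[OF n 1] by (simp add: a_def q_def t_def)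
        also have "\<dots> \<le> D / a * (1 / q powr \<delta> + t)" using D_ge t0 by (intro up) auto
        finally show ?thesis .
      next
        case 2
        have "\<bar>surv n x - main_term n x / (\<sigma> * a)\<bar> \<le> F / a * (1 / q powr \<delta>)"
          using F(2)[OF n2] 2 by (simp add: a_def q_def)
        also have "\<dots> \<le> D / a * (1 / q powr \<delta> + t)" using D_ge t0 by (intro up) auto
        finally show ?thesis .
      next
        case 3
        have "\<bar>surv n x - main_term n x / (\<sigma> * a)\<bar> \<le> N / a * (1 / q powr \<delta> + t)"
          using N(2)[OF n2] 3 by (simp add: a_def q_def t_def)
        also have "\<dots> \<le> D / a * (1 / q powr \<delta> + t)" using D_ge t0 by (intro up) auto
        finally show ?thesis .
      qed
    qed
    also have "\<dots> = D * (1 / q powr \<delta>) / a + D * t / a"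
      by (simp add: distrib_left)
    also have "\<dots> \<le> C * (1 / q powr \<delta>) / a + C * (t * ln (real n)) / a"
    proof (intro add_mono divide_right_mono mult_right_mono C p0)
      have "ln 2 \<le> ln (real n)" using n2 by simp
      hence "D / ln 2 * (t * ln 2) \<le> C * (t * ln (real n))"
        using C(3,4) t0 D0 by (intro mult_mono mult_left_mono) auto
      thus "D * t \<le> C * (t * ln (real n))" by (simp add: mult.commute)
    qed (use a in auto)
    also have "\<dots> = C / a * (1 / q powr \<delta> + t * ln (real n))" by (simp add: distrib_left)
    finally show ?thesis
      unfolding powr_quarter[OF n] by (simp add: a_def q_def t_def)
  qed
  thus ?thesis using C(4) that by blast
qed

end

section \<open>From the law of a step to the random walk\<close>

lemma exit_time_gt_iff:
  "enat n < exit_time X x \<omega> \<longleftrightarrow> (\<forall>k\<in>{1..n}. 0 \<le> x + partial_sum X k \<omega>)"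
proof -
  define A where "A = {enat k | k. k \<ge> 1 \<and> x + partial_sum X k \<omega> < 0}"
  have "enat n < exit_time X x \<omega> \<longleftrightarrow> enat (Suc n) \<le> Inf A"
    by (simp only: exit_time_def A_def Suc_ile_eq)
  also have "\<dots> \<longleftrightarrow> (\<forall>a\<in>A. enat (Suc n) \<le> a)"
    by (rule le_Inf_iff)
  also have "\<dots> \<longleftrightarrow> (\<forall>k. 1 \<le> k \<and> x + partial_sum X k \<omega> < 0 \<longrightarrow> enat (Suc n) \<le> enat k)"
    unfolding A_def by blast
  also have "\<dots> \<longleftrightarrow> (\<forall>k\<in>{1..n}. 0 \<le> x + partial_sum X k \<omega>)"
    unfolding enat_ord_simps Ball_def atLeastAtMost_iff by (meson linorder_not_le not_less_eq_eq)
  finally show ?thesis .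
qed

lemma partial_sum_Suc: "partial_sum X (Suc k) \<omega> = partial_sum X k \<omega> + X (Suc k) \<omega>"
  by (simp add: partial_sum_def)

locale random_walk = prob_space M for M :: "'a measure" +
  fixes X :: "nat \<Rightarrow> 'a \<Rightarrow> real" and \<mu> :: "real measure"
  assumes indep: "indep_vars (\<lambda>_. borel) X {1..}"
    and step_distr: "\<And>i. 1 \<le> i \<Longrightarrow> distr M borel (X i) = \<mu>"
begin

lemma X_measurable: "1 \<le> i \<Longrightarrow> X i \<in> borel_measurable M"
  using indep by (auto simp: indep_vars_def)

lemma partial_sum_measurable [measurable]: "partial_sum X k \<in> borel_measurable M"
  unfolding partial_sum_def[abs_def] by (intro borel_measurable_sum X_measurable) auto

text \<open>
  The event that the exit time exceeds k, as a real function: it is multiplied with other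
  functions throughout.
\<close>
definition alive :: "real \<Rightarrow> nat \<Rightarrow> 'a \<Rightarrow> real" where
  "alive x k \<omega> = (if \<forall>j\<in>{1..k}. 0 \<le> x + partial_sum X j \<omega> then 1 else 0)"

lemma alive_measurable [measurable]: "alive x k \<in> borel_measurable M"
  unfolding alive_def[abs_def] by measurable

lemma alive_bounds: "0 \<le> alive x k \<omega>" "alive x k \<omega> \<le> 1"
  by (auto simp: alive_def)

lemma alive_Suc:
  "alive x (Suc k) \<omega> = alive x k \<omega> * indicator {0..} (x + partial_sum X k \<omega> + X (Suc k) \<omega>)"
proof -
  have "{1..Suc k} = insert (Suc k) {1..k}" by auto
  thus ?thesis by (auto simp: alive_def indicator_def partial_sum_Suc add_ac)
qed

text \<open>
  Fubini's theorem for the past and the next step. The past is represented by the whole vector of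
  the first k steps, so that independence of disjoint blocks of coordinates applies directly.
\<close>
lemma expectation_next_step:
  fixes F :: "real \<Rightarrow> real \<Rightarrow> real"
  assumes F [measurable]: "case_prod F \<in> borel_measurable (borel \<Otimes>\<^sub>M borel)"
    and int: "integrable M (\<lambda>\<omega>. alive x k \<omega> * F (x + partial_sum X k \<omega>) (X (Suc k) \<omega>))"
  shows "(\<integral>\<omega>. alive x k \<omega> * F (x + partial_sum X k \<omega>) (X (Suc k) \<omega>) \<partial>M)
    = (\<integral>\<omega>. alive x k \<omega> * (\<integral>s. F (x + partial_sum X k \<omega>) s \<partial>\<mu>) \<partial>M)"
proof -
  define P where "P = PiM {1..k} (\<lambda>_. borel :: real measure)"
  define N where "N = PiM {Suc k} (\<lambda>_. borel :: real measure)"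
  define U where "U \<omega> = restrict (\<lambda>i. X i \<omega>) {1..k}" for \<omega>
  define Z where "Z \<omega> = restrict (\<lambda>i. X i \<omega>) {Suc k}" for \<omega>
  define a where "a f = (if \<forall>j\<in>{1..k}. 0 \<le> x + (\<Sum>i=1..j. f i) then 1 else 0 :: real)" for f
  define y where "y f = x + (\<Sum>i=1..k. f i :: real)" for f :: "nat \<Rightarrow> real"
  define G where "G p = a (fst p) * F (y (fst p)) (snd p (Suc k))" for p
  have X_meas [measurable]: "X (Suc k) \<in> borel_measurable M" by (rule X_measurable) simp
  have sum_meas: "(\<lambda>f. \<Sum>i=1..j. f i) \<in> borel_measurable P" if "j \<in> {1..k}" for j
    unfolding P_def using that by (intro borel_measurable_sum measurable_component_singleton) auto
  have "Measurable.pred P (\<lambda>f. 0 \<le> x + (\<Sum>i=1..j. f i))" if "j \<in> {1..k}" for j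
    using sum_meas[OF that] by measurable
  hence "Measurable.pred P (\<lambda>f. \<forall>j\<in>{1..k}. 0 \<le> x + (\<Sum>i=1..j. f i))"
    by (intro pred_intros_finite) auto
  hence [measurable]: "a \<in> borel_measurable P"
    unfolding a_def[abs_def] by measurable
  have [measurable]: "y \<in> borel_measurable P"
    unfolding y_def[abs_def] P_def
    by (intro borel_measurable_add borel_measurable_const borel_measurable_sum measurable_component_singleton) auto
  have comp [measurable]: "(\<lambda>g. g (Suc k)) \<in> borel_measurable N"
    unfolding N_def by (rule measurable_component_singleton) simp
  have [measurable]: "G \<in> borel_measurable (P \<Otimes>\<^sub>M N)" unfolding G_def[abs_def] by measurable
  have U_sum: "(\<Sum>i=1..j. U \<omega> i) = partial_sum X j \<omega>" if "j \<le> k" for j \<omega>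
    unfolding partial_sum_def U_def using that by (intro sum.cong) auto
  have U: "a (U \<omega>) = alive x k \<omega>" "y (U \<omega>) = x + partial_sum X k \<omega>" for \<omega>
  proof -
    have "(\<forall>j\<in>{1..k}. 0 \<le> x + (\<Sum>i=1..j. U \<omega> i)) \<longleftrightarrow> (\<forall>j\<in>{1..k}. 0 \<le> x + partial_sum X j \<omega>)"
      by (intro ball_cong refl) (simp add: U_sum del: One_nat_def)
    thus "a (U \<omega>) = alive x k \<omega>" by (simp only: a_def alive_def)
    show "y (U \<omega>) = x + partial_sum X k \<omega>" by (simp only: y_def U_sum[OF order_refl])
  qed
  have Z: "Z \<omega> (Suc k) = X (Suc k) \<omega>" for \<omega> by (simp add: Z_def)
  have "indep_var P U N Z"
    unfolding U_def[abs_def] Z_def[abs_def] P_def N_def by (rule indep_var_restrict[OF indep]) auto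
  hence [measurable]: "U \<in> measurable M P" "Z \<in> measurable M N"
    and joint: "distr M P U \<Otimes>\<^sub>M distr M N Z = distr M (P \<Otimes>\<^sub>M N) (\<lambda>\<omega>. (U \<omega>, Z \<omega>))"
    unfolding indep_var_distribution_eq by auto
  interpret U: prob_space "distr M P U" by (rule prob_space_distr) simp
  interpret Z: prob_space "distr M N Z" by (rule prob_space_distr) simp
  interpret UZ: pair_prob_space "distr M P U" "distr M N Z" ..
  have law: "(\<integral>g. F v (g (Suc k)) \<partial>distr M N Z) = (\<integral>s. F v s \<partial>\<mu>)" for v
  proof -
    have "(\<integral>g. F v (g (Suc k)) \<partial>distr M N Z) = (\<integral>\<omega>. F v (X (Suc k) \<omega>) \<partial>M)"
      by (subst integral_distr) (auto simp: Z)
    also have "\<dots> = (\<integral>s. F v s \<partial>distr M borel (X (Suc k)))" by (subst integral_distr) auto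
    finally show ?thesis using step_distr[of "Suc k"] by simp
  qed
  have "(\<integral>\<omega>. G (U \<omega>, Z \<omega>) \<partial>M) = (\<integral>p. G p \<partial>(distr M P U \<Otimes>\<^sub>M distr M N Z))"
    unfolding joint by (subst integral_distr) auto
  also have "\<dots> = (\<integral>f. (\<integral>g. G (f, g) \<partial>distr M N Z) \<partial>distr M P U)"
  proof (rule UZ.integral_fst'[symmetric])
    show "integrable (distr M P U \<Otimes>\<^sub>M distr M N Z) G"
      unfolding joint by (subst integrable_distr_eq) (use int in \<open>auto simp: G_def U Z\<close>)
  qed
  also have "\<dots> = (\<integral>\<omega>. (\<integral>g. G (U \<omega>, g) \<partial>distr M N Z) \<partial>M)"
    by (subst integral_distr) auto
  finally show ?thesis by (simp add: G_def U Z law)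
qed

end

locale moment_walk = random_walk M X \<mu> + law: step_law \<mu> \<sigma>
  for M :: "'a measure" and X \<mu> \<sigma>
begin

lemma integrable_X: "1 \<le> i \<Longrightarrow> integrable M (X i)"
proof -
  assume i: "1 \<le> i"
  have "integrable (distr M borel (X i)) (\<lambda>s. s)" unfolding step_distr[OF i] by (rule law.integrable_step)
  thus ?thesis using X_measurable[OF i] by (simp add: integrable_distr_eq)
qed

lemma integrable_partial_sum: "integrable M (partial_sum X k)"
  unfolding partial_sum_def[abs_def] by (intro Bochner_Integration.integrable_sum integrable_X) auto

lemma expectation_alive:
  assumes "law.adm f"
  shows "(\<integral>\<omega>. alive x k \<omega> * f (x + partial_sum X k \<omega>) \<partial>M) = law.evolve k f x"
  using assms
proof (induction k arbitrary: f)
  case 0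
  thus ?case by (simp add: alive_def partial_sum_def prob_space)
next
  case (Suc k)
  have [measurable]: "f \<in> borel_measurable borel" using Suc.prems by (rule law.adm_measurable)
  have [measurable]: "X (Suc k) \<in> borel_measurable M" by (rule X_measurable) simp
  obtain B where B: "0 \<le> B" "\<And>y. 0 \<le> y \<Longrightarrow> \<bar>f y\<bar> \<le> B" using law.adm_bound[OF Suc.prems] by blast
  define F where "F y s = indicator {0..} (y + s) * f (y + s)" for y s :: real
  have [measurable]: "case_prod F \<in> borel_measurable (borel \<Otimes>\<^sub>M borel)"
    unfolding F_def by measurable
  have int: "integrable M (\<lambda>\<omega>. alive x k \<omega> * F (x + partial_sum X k \<omega>) (X (Suc k) \<omega>))"
  proof (rule integrable_const_bound[where B=B])
    show "AE \<omega> in M. norm (alive x k \<omega> * F (x + partial_sum X k \<omega>) (X (Suc k) \<omega>)) \<le> B"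
    proof (intro AE_I2)
      fix \<omega>
      have "\<bar>F (x + partial_sum X k \<omega>) (X (Suc k) \<omega>)\<bar> \<le> B" using B by (auto simp: F_def indicator_def)
      thus "norm (alive x k \<omega> * F (x + partial_sum X k \<omega>) (X (Suc k) \<omega>)) \<le> B"
        using B(1) by (auto simp: alive_def)
    qed
  qed (unfold F_def, measurable)
  have "(\<integral>\<omega>. alive x (Suc k) \<omega> * f (x + partial_sum X (Suc k) \<omega>) \<partial>M)
      = (\<integral>\<omega>. alive x k \<omega> * F (x + partial_sum X k \<omega>) (X (Suc k) \<omega>) \<partial>M)"
    by (simp add: alive_Suc F_def partial_sum_Suc add_ac mult_ac)
  also have "\<dots> = (\<integral>\<omega>. alive x k \<omega> * law.killed f (x + partial_sum X k \<omega>) \<partial>M)"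
    using expectation_next_step[OF _ int] by (simp add: F_def law.killed_def)
  also have "\<dots> = law.evolve k (law.killed f) x"
    by (rule Suc.IH) (use Suc.prems in auto)
  finally show ?case by (simp add: law.evolve_Suc')
qed

lemma expectation_alive_eq_surv: "(\<integral>\<omega>. alive x k \<omega> \<partial>M) = law.surv k x"
  using expectation_alive[of "\<lambda>_. 1" x k] by (simp add: law.surv_def)

lemma integrable_alive: "integrable M (alive x k)"
  by (rule integrable_const_bound[where B=1]) (auto simp: alive_def)

theorem prob_exit_time_gt: "measure M {\<omega> \<in> space M. enat n < exit_time X x \<omega>} = law.surv n x"
proof -
  have set: "{\<omega> \<in> space M. enat n < exit_time X x \<omega>} = {\<omega> \<in> space M. \<forall>j\<in>{1..n}. 0 \<le> x + partial_sum X j \<omega>}"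
    by (simp add: exit_time_gt_iff)
  have [measurable]: "{\<omega> \<in> space M. \<forall>j\<in>{1..n}. 0 \<le> x + partial_sum X j \<omega>} \<in> sets M" by measurable
  have "law.surv n x = (\<integral>\<omega>. indicator {\<omega> \<in> space M. \<forall>j\<in>{1..n}. 0 \<le> x + partial_sum X j \<omega>} \<omega> \<partial>M)"
    unfolding expectation_alive_eq_surv[symmetric]
    by (rule Bochner_Integration.integral_cong) (auto simp: alive_def indicator_def)
  thus ?thesis unfolding set by simp
qed

definition exit_overshoot :: "real \<Rightarrow> nat \<Rightarrow> 'a \<Rightarrow> real" where
  "exit_overshoot x k \<omega> = alive x k \<omega> * max 0 (- (x + partial_sum X (Suc k) \<omega>))"

lemma integrable_exit_overshoot: "integrable M (exit_overshoot x k)"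
  unfolding exit_overshoot_def[abs_def]
proof (rule Bochner_Integration.integrable_bound)
  show "integrable M (\<lambda>\<omega>. \<bar>x\<bar> + \<bar>partial_sum X (Suc k) \<omega>\<bar>)" using integrable_partial_sum by auto
qed (auto simp: alive_def)

lemma expectation_exit_overshoot:
  "(\<integral>\<omega>. exit_overshoot x k \<omega> \<partial>M) = law.evolve k law.overshoot x"
proof -
  have "(\<integral>\<omega>. alive x k \<omega> * max 0 (- (x + partial_sum X k \<omega> + X (Suc k) \<omega>)) \<partial>M)
     = (\<integral>\<omega>. alive x k \<omega> * law.overshoot (x + partial_sum X k \<omega>) \<partial>M)"
    unfolding law.overshoot_def
    by (rule expectation_next_step[of "\<lambda>y s. max 0 (- (y + s))"])
       (use integrable_exit_overshoot[of x k] in \<open>simp_all add: exit_overshoot_def[abs_def] partial_sum_Suc add.assoc\<close>)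
  also have "\<dots> = law.evolve k law.overshoot x"
    by (intro expectation_alive law.adm_overshoot)
  finally show ?thesis by (simp add: exit_overshoot_def partial_sum_Suc add.assoc)
qed

text \<open>
  The contribution of the exit at time k + 1. For each outcome at most one of these is nonzero,
  and all of them vanish if the walk never exits.
\<close>
definition exit_term :: "real \<Rightarrow> nat \<Rightarrow> 'a \<Rightarrow> real" where
  "exit_term x k \<omega> = (if exit_time X x \<omega> = enat (Suc k) then partial_sum X (Suc k) \<omega> else 0)"

lemma exit_term_eq:
  "exit_term x k \<omega> = - exit_overshoot x k \<omega> - x * (alive x k \<omega> - alive x (Suc k) \<omega>)"
proof -
  have "exit_time X x \<omega> = enat (Suc k) \<longleftrightarrow> enat k < exit_time X x \<omega> \<and> \<not> enat (Suc k) < exit_time X x \<omega>"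
    by (cases "exit_time X x \<omega>") auto
  moreover have "alive x k \<omega> = (if enat k < exit_time X x \<omega> then 1 else 0)" for k
    by (simp add: alive_def exit_time_gt_iff)
  moreover have "enat (Suc k) < exit_time X x \<omega> \<longleftrightarrow> enat k < exit_time X x \<omega> \<and> 0 \<le> x + partial_sum X (Suc k) \<omega>"
    unfolding exit_time_gt_iff by (auto simp: le_Suc_eq)
  ultimately show ?thesis by (auto simp: exit_term_def exit_overshoot_def)
qed

lemma exit_term_support: "finite {k. exit_term x k \<omega> \<noteq> 0}"
proof (rule finite_subset)
  show "{k. exit_term x k \<omega> \<noteq> 0} \<subseteq> {the_enat (exit_time X x \<omega>) - 1}"
    by (auto simp: exit_term_def split: if_splits)
qed simp

lemma exit_sum_eq_suminf: "exit_sum X x \<omega> = (\<Sum>k. exit_term x k \<omega>)"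
proof (cases "exit_time X x \<omega>")
  case infinity
  thus ?thesis by (simp add: exit_sum_def exit_term_def)
next
  case (enat N)
  have "enat 0 < exit_time X x \<omega>" by (subst exit_time_gt_iff) simp
  then obtain m where m: "N = Suc m" using enat by (cases N) auto
  have "exit_term x k \<omega> = (if k = m then partial_sum X N \<omega> else 0)" for k
    by (auto simp: exit_term_def enat m)
  thus ?thesis using sums_single[of m "\<lambda>_. partial_sum X N \<omega>"]
    by (simp add: exit_sum_def enat sums_iff)
qed

lemma surv_tendsto_0: "(\<lambda>n. law.surv n x) \<longlonglongrightarrow> 0"
proof -
  obtain C where C: "0 \<le> C" "\<And>n x. 2 \<le> n \<Longrightarrow> law.surv n x \<le> C * law.harmonic x / sqrt (real n)"
    using law.surv_negative_arg by blast
  have "filterlim (\<lambda>n. sqrt (real n)) at_top sequentially"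
    by (rule filterlim_compose[OF sqrt_at_top filterlim_real_sequentially])
  hence lim: "(\<lambda>n. C * law.harmonic x / sqrt (real n)) \<longlonglongrightarrow> 0"
    by (rule tendsto_divide_0[OF tendsto_const filterlim_at_top_imp_at_infinity])
  have upper: "\<forall>\<^sub>F n in sequentially. law.surv n x \<le> C * law.harmonic x / sqrt (real n)"
    using C(2) by (auto simp: eventually_sequentially)
  have lower: "\<forall>\<^sub>F n in sequentially. 0 \<le> law.surv n x"
    by (simp add: law.surv_nonneg_all)
  show ?thesis
    by (rule tendsto_sandwich[OF lower upper tendsto_const lim])
qed

text \<open>
  On exit at time k + 1 the value of the walk is -x minus the overshoot. Summing the first part
  over k gives -x times the probability of ever exiting, which is one because the survival
  probabilities tend to zero.
\<close>
theorem harmonic_V_eq: "harmonic_V M X x = law.harmonic x"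
proof -
  define d where "d k = law.surv k x - law.surv (Suc k) x" for k
  have d_sums: "d sums 1"
    using telescope_sums'[OF surv_tendsto_0[of x]] by (simp add: d_def[abs_def] law.surv_def)
  have int: "integrable M (exit_term x k)" for k
    unfolding exit_term_eq[abs_def]
    using integrable_exit_overshoot[of x k] integrable_alive[of x k] integrable_alive[of x "Suc k"] by auto
  have exp: "(\<integral>\<omega>. exit_term x k \<omega> \<partial>M) = - law.evolve k law.overshoot x - x * d k" for k
    unfolding exit_term_eq[abs_def] d_def
    using integrable_exit_overshoot[of x k] integrable_alive[of x k] integrable_alive[of x "Suc k"]
    by (simp add: expectation_exit_overshoot expectation_alive_eq_surv)
  have abs_le: "(\<integral>\<omega>. norm (exit_term x k \<omega>) \<partial>M) \<le> law.evolve k law.overshoot x + \<bar>x\<bar> * d k" for k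
  proof -
    have "(\<integral>\<omega>. norm (exit_term x k \<omega>) \<partial>M)
       \<le> (\<integral>\<omega>. exit_overshoot x k \<omega> + \<bar>x\<bar> * (alive x k \<omega> - alive x (Suc k) \<omega>) \<partial>M)"
    proof (intro integral_mono integrable_norm int)
      show "integrable M (\<lambda>\<omega>. exit_overshoot x k \<omega> + \<bar>x\<bar> * (alive x k \<omega> - alive x (Suc k) \<omega>))"
        using integrable_exit_overshoot[of x k] integrable_alive[of x k] integrable_alive[of x "Suc k"] by auto
      fix \<omega>
      have "alive x (Suc k) \<omega> \<le> alive x k \<omega>" by (auto simp: alive_def)
      hence "\<bar>x * (alive x k \<omega> - alive x (Suc k) \<omega>)\<bar> = \<bar>x\<bar> * (alive x k \<omega> - alive x (Suc k) \<omega>)"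
        by (simp add: abs_mult)
      moreover have "0 \<le> exit_overshoot x k \<omega>"
        unfolding exit_overshoot_def using alive_bounds by (intro mult_nonneg_nonneg) auto
      ultimately show "norm (exit_term x k \<omega>) \<le> exit_overshoot x k \<omega> + \<bar>x\<bar> * (alive x k \<omega> - alive x (Suc k) \<omega>)"
        unfolding exit_term_eq real_norm_def by linarith
    qed
    also have "\<dots> = law.evolve k law.overshoot x + \<bar>x\<bar> * d k"
      using integrable_exit_overshoot[of x k] integrable_alive[of x k] integrable_alive[of x "Suc k"]
      by (simp add: expectation_exit_overshoot expectation_alive_eq_surv d_def)
    finally show ?thesis .
  qed
  have "(\<integral>\<omega>. exit_sum X x \<omega> \<partial>M) = (\<Sum>k. \<integral>\<omega>. exit_term x k \<omega> \<partial>M)"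
    unfolding exit_sum_eq_suminf
  proof (rule integral_suminf[OF int])
    show "AE \<omega> in M. summable (\<lambda>k. norm (exit_term x k \<omega>))"
      by (intro AE_I2 summable_finite[OF exit_term_support[of x]]) auto
    have "summable (\<lambda>k. law.evolve k law.overshoot x + \<bar>x\<bar> * d k)"
      by (intro summable_add summable_mult sums_summable[OF d_sums] sums_summable[OF law.evolve_overshoot_sums])
    thus "summable (\<lambda>k. \<integral>\<omega>. norm (exit_term x k \<omega>) \<partial>M)"
      by (rule summable_comparison_test[rotated]) (use abs_le in \<open>auto intro!: exI[of _ 0] simp: integral_nonneg_AE\<close>)
  qed
  also have "\<dots> = - law.mean_exit_overshoot x - x * 1"
    unfolding exp
    by (intro sums_unique[symmetric] sums_diff sums_minus sums_mult d_sums law.evolve_overshoot_sums)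
  finally show ?thesis by (simp add: harmonic_V_def law.harmonic_def)
qed

end

theorem theorem1p3:
  fixes M :: "'a measure" and X :: "nat \<Rightarrow> 'a \<Rightarrow> real" and \<sigma> \<delta> :: real
  assumes "prob_space M"
    and indep: "prob_space.indep_vars M (\<lambda>_. borel) X {1..}"
    and ident: "\<And>i. i \<ge> 1 \<Longrightarrow> distr M borel (X i) = distr M borel (X 1)"
    and mean: "(\<integral>\<omega>. X 1 \<omega> \<partial>M) = 0"
    and sigma: "\<sigma> > 0"
    and variance: "(\<integral>\<omega>. (X 1 \<omega>)\<^sup>2 \<partial>M) = \<sigma>\<^sup>2"
    and delta: "\<delta> \<ge> 1"
    and moment: "integrable M (\<lambda>\<omega>. \<bar>X 1 \<omega>\<bar> powr (2 + \<delta>))"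
  shows "\<exists>c>0. \<forall>n\<ge>1. \<forall>x::real.
    \<bar>measure M {\<omega> \<in> space M. exit_time X x \<omega> > enat n}
        - harmonic_V M X x * normal_L (x / (\<sigma> * sqrt (real n))) / (\<sigma> * sqrt (real n))\<bar>
      \<le> c / sqrt (real n)
        * (1 / real n powr (\<delta> / 4)
           + harmonic_V M X x * normal_L (x / (\<sigma> * sqrt (real n))) / real n powr (1 / 4)
             * ln (real n))"
proof -
  interpret P: prob_space M by fact
  define \<mu> where "\<mu> = distr M borel (X 1)"
  interpret W: random_walk M X \<mu>
  proof unfold_locales
    show "P.indep_vars (\<lambda>_. borel) X {1..}" by (rule indep)
    show "distr M borel (X i) = \<mu>" if "1 \<le> i" for i
      unfolding \<mu>_def using ident that by blast
  qed
  have X1: "X 1 \<in> borel_measurable M" by (rule W.X_measurable) simp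
  have sets_\<mu> [measurable_cong]: "sets \<mu> = sets borel" by (simp add: \<mu>_def)
  have int_iff: "integrable \<mu> f \<longleftrightarrow> integrable M (\<lambda>\<omega>. f (X 1 \<omega>))" if "f \<in> borel_measurable borel" for f :: "real \<Rightarrow> real"
    unfolding \<mu>_def by (rule integrable_distr_eq[OF X1 that])
  have int_eq: "(\<integral>s. f s \<partial>\<mu>) = (\<integral>\<omega>. f (X 1 \<omega>) \<partial>M)" if "f \<in> borel_measurable borel" for f :: "real \<Rightarrow> real"
    unfolding \<mu>_def by (rule integral_distr[OF X1 that])
  have mom: "integrable \<mu> (\<lambda>s. \<bar>s\<bar> powr (2 + \<delta>))"
    using moment by (subst int_iff) auto
  have cube: "\<bar>s\<bar> ^ 3 \<le> 1 + \<bar>s\<bar> powr (2 + \<delta>)" for s :: real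
  proof (cases "\<bar>s\<bar> \<le> 1")
    case True
    hence "\<bar>s\<bar> ^ 3 \<le> 1" by (simp add: power_le_one)
    thus ?thesis by (simp add: add_increasing2)
  next
    case False
    hence "\<bar>s\<bar> ^ 3 = \<bar>s\<bar> powr 3" by (simp add: powr_numeral)
    also have "\<dots> \<le> \<bar>s\<bar> powr (2 + \<delta>)" using False delta by (intro powr_mono) auto
    finally show ?thesis by simp
  qed
  interpret D: prob_space \<mu> unfolding \<mu>_def by (rule P.prob_space_distr[OF X1])
  interpret law: step_law \<mu> \<sigma>
  proof unfold_locales
    show "integrable \<mu> (\<lambda>s. \<bar>s\<bar> ^ 3)"
    proof (rule Bochner_Integration.integrable_bound)
      show "integrable \<mu> (\<lambda>s. 1 + \<bar>s\<bar> powr (2 + \<delta>))"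
        by (intro Bochner_Integration.integrable_add D.integrable_const mom)
      show "AE s in \<mu>. norm (\<bar>s\<bar> ^ 3) \<le> norm (1 + \<bar>s\<bar> powr (2 + \<delta>))"
        using cube by (intro AE_I2) simp
    qed measurable
    show "(\<integral>s. s \<partial>\<mu>) = 0" using int_eq[of "\<lambda>s. s"] mean by simp
    show "(\<integral>s. s\<^sup>2 \<partial>\<mu>) = \<sigma>\<^sup>2" using int_eq[of "\<lambda>s. s\<^sup>2"] variance by simp
  qed (fact sets_\<mu> sigma)+
  interpret W: moment_walk M X \<mu> \<sigma> ..
  obtain C where C: "0 < C" "\<And>n x. 1 \<le> n \<Longrightarrow>
     \<bar>law.surv n x - law.main_term n x / (\<sigma> * sqrt (real n))\<bar>
       \<le> C / sqrt (real n) * (1 / real n powr (\<delta> / 4) + law.main_term n x / real n powr (1 / 4) * ln (real n))"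
    using law.surv_main_term[OF delta mom] by blast
  show ?thesis
    using C unfolding W.prob_exit_time_gt W.harmonic_V_eq law.main_term_def by blast
qed

end
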